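(* Let $\xi$ be a Lévy process with $\psi(1)=\log\mathbb{E}e^{\xi(1)}<\infty$ and let $\theta_+,\theta_-\ge0$ satisfy $\psi(1)=\theta_--\theta_+$. Assume $\theta_+>0$. Let $\rho_+=\sum_{i=1}^\infty\delta_{(S_i^+,V_i^+)}$ be a Poisson point process on $\mathbb{R}\times\mathbb{R}$ with intensity $\theta_+ds\times e^{-v}dv$, and, independently of $\rho_+$, let $L_1^+,L_2^+,\ldots$ be i.i.d. copies of the killed Lévy process $L^+$. Put $$W_i^+(t)=\begin{cases}-\infty,& t<S_i^+,\\ V_i^++L_i^+(t-S_i^+),& t\ge S_i^+.\end{cases}$$ Then the Poisson point process $\Pi':=\sum_{i=1}^\infty\delta_{W_i^+}$ on $\bar D$ has the same intensity measure as the Poisson point process $\Pi=\sum_{i}\delta_{V_i}+\sum_{i}\delta_{\tilde V_i^+}+\sum_{i}\delta_{\tilde V_i^-}$ (constructed in the context).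
   Context: Construction of $\Pi$. Let $\{\xi(t)\colon t\ge0\}$ be a real-valued Lévy process with $\psi(1):=\log\mathbb{E}e^{\xi(1)}<\infty$ and transition kernel $p_t(x,dy)$ (law of $x+\xi(t)$). Let $\theta_+\ge0$, $\theta_-\ge0$ satisfy $\psi(1)=\theta_--\theta_+$. Let $L^+$ be $\xi$ killed at rate $\theta_-$ (killed means set to $-\infty$ from an independent exponential time with rate $\theta_-$ on; no killing if $\theta_-=0$), with subprobability transition kernel $q_t^+(x,dy)=e^{-\theta_-t}p_t(x,dy)$ on $\mathbb{R}$. Let $L^-$ be the (killed) Lévy process started at $0$ whose subprobability transition kernel $q_t^-$ is given by $e^{-x}dx\,q_t^-(x,dy)=e^{-y}dy\,q_t^+(y,dx)$; its killing rate is $\theta_+$, and after killing it equals $-\infty$. $L^+$ is taken càdlàg and $L^-$ left-continuous with right limits. With $L^+,L^-$ independent, put $L(t)=L^+(t)$ for $t\ge0$ and $L(t)=L^-(-t)$ for $t<0$. Let $\pi_0=\sum_i\delta_{U_i}$ be a Poisson point process (PPP) on $\mathbb{R}$ with intensity $e^{-u}du$; $\pi_+=\sum_i\delta_{(\tilde T_i^+,\tilde U_i^+)}$ a PPP on $(0,\infty)\times\mathbb{R}$ with intensity $\theta_+dt\times e^{-u}du$; $\pi_-=\sum_i\delta_{(\tilde T_i^-,\tilde U_i^-)}$ a PPP on $(-\infty,0)\times\mathbb{R}$ with intensity $\theta_-dt\times e^{-u}du$ (a PPP with zero intensity is empty). Let $L_1,L_2,\ldots$ be copies of $L$, $\tilde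 L_1^+,\tilde L_2^+,\ldots$ copies of $L^+$, $\tilde L_1^-,\tilde L_2^-,\ldots$ copies of $L^-$, with $\pi_0,\pi_+,\pi_-,L_i,\tilde L_i^+,\tilde L_i^-$ ($i\in\mathbb{N}$) all independent. Define, for $t\in\mathbb{R}$: $V_i(t)=U_i+L_i(t)$; $\tilde V_i^+(t)=-\infty$ for $t<\tilde T_i^+$ and $\tilde V_i^+(t)=\tilde U_i^++\tilde L_i^+(t-\tilde T_i^+)$ for $t\ge\tilde T_i^+$; $\tilde V_i^-(t)=\tilde U_i^-+\tilde L_i^-(\tilde T_i^--t)$ for $t<\tilde T_i^-$ and $\tilde V_i^-(t)=-\infty$ for $t\ge\tilde T_i^-$. (The random functions $V_i$ are unrelated to the random variables $V_i^+$ in the claim.) $\bar D$ is the Skorokhod space of càdlàg functions $f:\mathbb{R}\to\mathbb{R}\cup\{-\infty\}$. *)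

theory Defs
  imports "HOL-Probability.Probability"
begin

section \<open>Levy processes, killing and duality\<close>

text \<open>
  Levy process started at 0, defined up to modification: stochastic continuity is required here,
  while the path regularity is imposed on the versions of the killed processes that enter the
  point processes.
\<close>
definition levy_process :: "'w measure \<Rightarrow> (real \<Rightarrow> 'w \<Rightarrow> real) \<Rightarrow> bool" where
  "levy_process P X \<longleftrightarrow>
     prob_space P \<and>
     (\<forall>t\<ge>0. X t \<in> borel_measurable P) \<and>
     (AE \<omega> in P. X 0 \<omega> = 0) \<and>
     (\<forall>(n::nat) t. 0 \<le> t 0 \<and> mono t \<longrightarrow>
        prob_space.indep_vars P (\<lambda>_. borel) (\<lambda>k \<omega>. X (t (Suc k)) \<omega> - X (t k) \<omega>) {..<n}) \<and>
     (\<forall>s\<ge>0. \<forall>t\<ge>0. distr P borel (\<lambda>\<omega>. X (s + t) \<omega> - X s \<omega>) = distr P borel (X t)) \<and>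
     (\<forall>t\<ge>0. \<forall>\<epsilon>>0.
        ((\<lambda>s. measure P {\<omega> \<in> space P. \<epsilon> < \<bar>X s \<omega> - X t \<omega>\<bar>}) \<longlongrightarrow> 0) (at t within {0..}))"

text \<open>Transition kernel on the reals of the process killed at rate \<open>\<theta>\<close>.\<close>
definition killed_kernel ::
    "'w measure \<Rightarrow> (real \<Rightarrow> 'w \<Rightarrow> real) \<Rightarrow> real \<Rightarrow> real \<Rightarrow> real \<Rightarrow> real measure" where
  "killed_kernel P X \<theta> t x =
     scale_measure (ennreal (exp (- \<theta> * t))) (distr P borel (\<lambda>\<omega>. x + X t \<omega>))"

text \<open>
  The identity \<open>e^(-x) dx qm(t,x,dy) = e^(-y) dy qp(t,y,dx)\<close> of measures on the plane,
  tested on rectangles.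
\<close>
definition dual_kernels ::
    "(real \<Rightarrow> real \<Rightarrow> real measure) \<Rightarrow> (real \<Rightarrow> real \<Rightarrow> real measure) \<Rightarrow> bool" where
  "dual_kernels qm qp \<longleftrightarrow>
     (\<forall>t\<ge>0. \<forall>A\<in>sets borel. \<forall>B\<in>sets borel.
        (\<integral>\<^sup>+x\<in>A. ennreal (exp (- x)) * emeasure (qm t x) B \<partial>lborel) =
        (\<integral>\<^sup>+y\<in>B. ennreal (exp (- y)) * emeasure (qp t y) A \<partial>lborel))"

abbreviation path_space :: "real set \<Rightarrow> (real \<Rightarrow> ereal) measure" where
  "path_space T \<equiv> PiM T (\<lambda>_. borel)"

definition killing_time :: "real \<Rightarrow> ereal measure" where
  "killing_time \<theta> =
     (if \<theta> = 0 then return borel \<infinity>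
      else distr (density lborel (exponential_density \<theta>)) borel ereal)"

text \<open>Law of \<open>X\<close> set to \<open>-\<infinity>\<close> from an independent killing time on.\<close>
definition killed_law ::
    "'w measure \<Rightarrow> (real \<Rightarrow> 'w \<Rightarrow> real) \<Rightarrow> real \<Rightarrow> (real \<Rightarrow> ereal) measure" where
  "killed_law P X \<theta> =
     distr (P \<Otimes>\<^sub>M killing_time \<theta>) (path_space {0..})
       (\<lambda>(\<omega>, e). \<lambda>t\<in>{0..}. if ereal t < e then ereal (X t \<omega>) else - \<infinity>)"

text \<open>Law of the two-sided process built from independent one-sided processes with the given laws.\<close>
definition two_sided_law ::
    "(real \<Rightarrow> ereal) measure \<Rightarrow> (real \<Rightarrow> ereal) measure \<Rightarrow> (real \<Rightarrow> ereal) measure" where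
  "two_sided_law Qp Qm =
     distr (Qp \<Otimes>\<^sub>M Qm) (path_space UNIV) (\<lambda>(f, g) t. if 0 \<le> t then f t else g (- t))"


section \<open>Paths\<close>

text \<open>
  Intended for \<open>T = UNIV\<close> and \<open>T = {0..}\<close>. All values and one-sided limits are
  taken in \<open>\<real> \<union> {-\<infinity>}\<close>, that is, they differ from \<open>\<infinity>\<close>.
\<close>
definition cadlag_on :: "real set \<Rightarrow> (real \<Rightarrow> ereal) \<Rightarrow> bool" where
  "cadlag_on T f \<longleftrightarrow>
     (\<forall>t\<in>T. f t \<noteq> \<infinity> \<and> (f \<longlongrightarrow> f t) (at_right t)) \<and>
     (\<forall>t\<in>interior T. \<exists>l. l \<noteq> \<infinity> \<and> (f \<longlongrightarrow> l) (at_left t))"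

text \<open>Left-continuous with right limits.\<close>
definition caglad_on :: "real set \<Rightarrow> (real \<Rightarrow> ereal) \<Rightarrow> bool" where
  "caglad_on T f \<longleftrightarrow>
     (\<forall>t\<in>T. f t \<noteq> \<infinity> \<and> (\<exists>l. l \<noteq> \<infinity> \<and> (f \<longlongrightarrow> l) (at_right t))) \<and>
     (\<forall>t\<in>interior T. (f \<longlongrightarrow> f t) (at_left t))"

text \<open>
  The space of cadlag functions with its usual sigma-algebra, generated by the evaluation maps
  (this is also the Borel sigma-algebra of the Skorokhod topology).
\<close>
definition Dbar :: "(real \<Rightarrow> ereal) measure" where
  "Dbar = restrict_space (path_space UNIV) {f. cadlag_on UNIV f}"

text \<open>A random path on \<open>T\<close> with law \<open>Q\<close>.\<close>
definition is_copy ::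
    "'a measure \<Rightarrow> real set \<Rightarrow> (real \<Rightarrow> ereal) measure \<Rightarrow> ('a \<Rightarrow> real \<Rightarrow> ereal) \<Rightarrow> bool" where
  "is_copy M T Q Y \<longleftrightarrow>
     (\<lambda>\<omega>. restrict (Y \<omega>) T) \<in> M \<rightarrow>\<^sub>M path_space T \<and>
     distr M (path_space T) (\<lambda>\<omega>. restrict (Y \<omega>) T) = Q"

definition shift_path :: "real \<Rightarrow> (real \<Rightarrow> ereal) \<Rightarrow> real \<Rightarrow> ereal" where
  "shift_path u f t = ereal u + f t"

definition birth_path :: "real \<times> real \<Rightarrow> (real \<Rightarrow> ereal) \<Rightarrow> real \<Rightarrow> ereal" where
  "birth_path p f t = (if t < fst p then - \<infinity> else ereal (snd p) + f (t - fst p))"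

definition death_path :: "real \<times> real \<Rightarrow> (real \<Rightarrow> ereal) \<Rightarrow> real \<Rightarrow> ereal" where
  "death_path p f t = (if t < fst p then ereal (snd p) + f (fst p - t) else - \<infinity>)"


section \<open>Point processes\<close>

text \<open>The random measure given by the sum of the Dirac measures at \<open>X i\<close>, \<open>i \<in> I\<close>.\<close>
definition dirac_sum ::
    "'i set \<Rightarrow> 'p measure \<Rightarrow> ('i \<Rightarrow> 'a \<Rightarrow> 'p) \<Rightarrow> 'a \<Rightarrow> 'p measure" where
  "dirac_sum I S X \<omega> = distr (count_space I) S (\<lambda>i. X i \<omega>)"

definition intensity :: "'a measure \<Rightarrow> 'p measure \<Rightarrow> ('a \<Rightarrow> 'p measure) \<Rightarrow> 'p measure" where
  "intensity M S N =
     measure_of (space S) (sets S) (\<lambda>A. \<integral>\<^sup>+\<omega>. emeasure (N \<omega>) A \<partial>M)"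

text \<open>\<open>N\<close> is a Poisson point process with intensity measure \<open>\<mu>\<close>.\<close>
definition poisson_pp :: "'a measure \<Rightarrow> 'p measure \<Rightarrow> ('a \<Rightarrow> 'p measure) \<Rightarrow> bool" where
  "poisson_pp M \<mu> N \<longleftrightarrow>
     (\<forall>\<omega>\<in>space M. sets (N \<omega>) = sets \<mu>) \<and>
     (\<forall>A\<in>sets \<mu>. (\<lambda>\<omega>. emeasure (N \<omega>) A) \<in> borel_measurable M) \<and>
     (\<forall>A\<in>sets \<mu>. emeasure \<mu> A < \<infinity> \<longrightarrow>
        (\<forall>k::nat. measure M {\<omega> \<in> space M. emeasure (N \<omega>) A = of_nat k} =
           exp (- measure \<mu> A) * measure \<mu> A ^ k / fact k)) \<and>
     (\<forall>A\<in>sets \<mu>. emeasure \<mu> A = \<infinity> \<longrightarrow> (AE \<omega> in M. emeasure (N \<omega>) A = \<infinity>)) \<and>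
     (\<forall>(n::nat) A. A ` {..<n} \<subseteq> sets \<mu> \<and> disjoint_family_on A {..<n} \<longrightarrow>
        prob_space.indep_vars M (\<lambda>_. borel) (\<lambda>i \<omega>. emeasure (N \<omega>) (A i)) {..<n})"

text \<open>The random points \<open>X i\<close>, \<open>i \<in> I\<close>, enumerate a Poisson point process with intensity \<open>\<mu>\<close>.\<close>
definition poisson_points ::
    "'a measure \<Rightarrow> 'i set \<Rightarrow> 'p measure \<Rightarrow> ('i \<Rightarrow> 'a \<Rightarrow> 'p) \<Rightarrow> bool" where
  "poisson_points M I \<mu> X \<longleftrightarrow>
     (\<forall>i\<in>I. X i \<in> M \<rightarrow>\<^sub>M \<mu>) \<and> poisson_pp M \<mu> (dirac_sum I \<mu> X)"

definition exp_intensity :: "real measure" where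
  "exp_intensity = density lborel (\<lambda>u. ennreal (exp (- u)))"

text \<open>The measure \<open>\<theta> dt \<times> e^(-u) du\<close> on \<open>T \<times> \<real>\<close>.\<close>
definition time_intensity :: "real \<Rightarrow> real set \<Rightarrow> (real \<times> real) measure" where
  "time_intensity \<theta> T =
     density (restrict_space lborel T) (\<lambda>_. ennreal \<theta>) \<Otimes>\<^sub>M exp_intensity"

text \<open>
  All intensities in use have infinite total mass or vanish, so the points of the corresponding
  process are enumerated by all natural numbers or there are none.
\<close>
definition atom_index :: "real \<Rightarrow> nat set" where
  "atom_index \<theta> = (if \<theta> = 0 then {} else UNIV)"

text \<open>
  The process built from the points \<open>U\<close>, \<open>Tp\<close>, \<open>Tm\<close>, two-sided paths \<open>L\<close> and one-sided paths
  \<open>Lp\<close>, \<open>Lm\<close>; the disjoint union of the index sets makes it the sum of the three processes.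
\<close>
definition Pi_process ::
    "real \<Rightarrow> real \<Rightarrow> (nat \<Rightarrow> 'a \<Rightarrow> real) \<Rightarrow> (nat \<Rightarrow> 'a \<Rightarrow> real \<times> real) \<Rightarrow> (nat \<Rightarrow> 'a \<Rightarrow> real \<times> real) \<Rightarrow>
     (nat \<Rightarrow> 'a \<Rightarrow> real \<Rightarrow> ereal) \<Rightarrow> (nat \<Rightarrow> 'a \<Rightarrow> real \<Rightarrow> ereal) \<Rightarrow> (nat \<Rightarrow> 'a \<Rightarrow> real \<Rightarrow> ereal) \<Rightarrow>
     'a \<Rightarrow> (real \<Rightarrow> ereal) measure" where
  "Pi_process \<theta>p \<theta>m U Tp Tm L Lp Lm =
     dirac_sum (UNIV <+> (atom_index \<theta>p <+> atom_index \<theta>m)) Dbar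
       (\<lambda>k \<omega>. case k of
            Inl i \<Rightarrow> shift_path (U i \<omega>) (L i \<omega>)
          | Inr (Inl i) \<Rightarrow> birth_path (Tp i \<omega>) (Lp i \<omega>)
          | Inr (Inr i) \<Rightarrow> death_path (Tm i \<omega>) (Lm i \<omega>))"

definition Pi'_process ::
    "(nat \<Rightarrow> 'b \<Rightarrow> real \<times> real) \<Rightarrow> (nat \<Rightarrow> 'b \<Rightarrow> real \<Rightarrow> ereal) \<Rightarrow> 'b \<Rightarrow> (real \<Rightarrow> ereal) measure" where
  "Pi'_process SV Lp = dirac_sum UNIV Dbar (\<lambda>i \<omega>. birth_path (SV i \<omega>) (Lp i \<omega>))"


section \<open>Independence of random elements of different types\<close>

definition generated_by :: "'a measure \<Rightarrow> 'b measure \<Rightarrow> ('a \<Rightarrow> 'b) \<Rightarrow> 'a set set" where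
  "generated_by M N Y = sets (vimage_algebra (space M) Y N)"

definition points_sigma ::
    "'a measure \<Rightarrow> 'i set \<Rightarrow> 'p measure \<Rightarrow> ('i \<Rightarrow> 'a \<Rightarrow> 'p) \<Rightarrow> 'a set set" where
  "points_sigma M I \<mu> X = generated_by M (PiM I (\<lambda>_. \<mu>)) (\<lambda>\<omega>. \<lambda>i\<in>I. X i \<omega>)"

definition path_sigma ::
    "'a measure \<Rightarrow> real set \<Rightarrow> ('a \<Rightarrow> real \<Rightarrow> ereal) \<Rightarrow> 'a set set" where
  "path_sigma M T Y = generated_by M (path_space T) (\<lambda>\<omega>. restrict (Y \<omega>) T)"

datatype ingredient =
  Points_0 | Points_plus | Points_minus | Two_sided nat | Path_plus nat | Path_minus nat

end

theory Submission
  imports Defs "HOL-Real_Asymp.Real_Asymp"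
begin

text \<open>
  The Laplace functional turns a Poisson process with independent marks into a Poisson process
  with product intensity: the marks are integrated out one at a time. Hence the two processes are
  Poisson, and their intensities are the images of the intensities of the points and the laws of
  the marks.

  On cylinder sets that force a path to be alive at times \<open>t\<^sub>1 < \<dots> < t\<^sub>n\<close> all three parts of
  \<open>\<Pi>\<close>, as well as \<open>\<Pi>'\<close>, give multiples of one weight, namely the law of \<open>L\<^sup>+\<close> over
  these times started from \<open>e\<^sup>-\<^sup>x dx\<close> at time \<open>t\<^sub>1\<close>: duality moves the starting
  point along the times. A path born at \<open>s \<le> t\<^sub>1\<close> contributes the factor
  \<open>exp (- \<theta>\<^sub>+ (t\<^sub>1 - s))\<close>, the killing of \<open>L\<^sup>-\<close>. Integrated over all births
  this is \<open>1\<close>; births after \<open>0\<close> and paths through \<open>0\<close> share the same total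
  mass, and symmetrically for the deaths before \<open>0\<close>. These cylinder sets determine the
  intensity because the path that is \<open>-\<infinity>\<close> throughout has measure \<open>0\<close>.
\<close>

section \<open>Laplace transforms of counts\<close>

text \<open>The intensities are infinite unless they vanish, and so is the number of points. Laplace
  functionals are therefore taken in the extended non-negative numbers, where \<open>exp_neg\<close>
  sends an infinite sum to 0 and integrability never has to be checked. The enumeration of the
  points is arbitrary: the points may depend on each other in any way, and only their joint
  sigma-algebra is independent of the marks. Hence a mark is replaced by its average while all
  points stay, and what remains is a Laplace functional of the points alone, taken at minus the
  logarithm of the averaged factor. That logarithm is infinite where the average is 0, which
  \<open>neg_ln\<close> admits. Infinite mass is also the obstacle in comparing the intensities.
  Agreement on cylinder sets is used only within the sets of paths that exceed a finite level at a
  rational time. Such a set has finite mass because \<open>e\<^sup>-\<^sup>x dx\<close> is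
  integrable at infinity, and only the path that is never alive escapes all of them.\<close>

text \<open>\<open>exp (- x)\<close> with the convention \<open>exp (- \<infinity>) = 0\<close>; \<open>neg_ln\<close> inverts it on \<open>[0, 1]\<close>.\<close>
definition exp_neg :: "ennreal \<Rightarrow> ennreal" where
  "exp_neg x = (if x = \<top> then 0 else ennreal (exp (- enn2real x)))"

definition neg_ln :: "ennreal \<Rightarrow> ennreal" where
  "neg_ln y = (if y = 0 then \<top> else ennreal (- ln (enn2real y)))"

lemma exp_neg_ennreal: "0 \<le> r \<Longrightarrow> exp_neg (ennreal r) = ennreal (exp (- r))"
  by (simp add: exp_neg_def)

lemma exp_neg_0 [simp]: "exp_neg 0 = 1" and exp_neg_top [simp]: "exp_neg \<top> = 0"
  by (simp_all add: exp_neg_def)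

lemma exp_neg_le_1: "exp_neg x \<le> 1"
  by (cases x) (auto simp: exp_neg_ennreal)

lemma exp_neg_neq_top [simp]: "exp_neg x \<noteq> \<top>"
  by (simp add: exp_neg_def)

lemma exp_neg_antimono: "x \<le> y \<Longrightarrow> exp_neg y \<le> exp_neg x"
  by (cases x; cases y) (auto simp: exp_neg_ennreal top_unique)

lemma exp_neg_add: "exp_neg (x + y) = exp_neg x * exp_neg y"
  by (cases x; cases y)
    (auto simp: exp_neg_ennreal ennreal_plus[symmetric] ennreal_mult[symmetric] exp_add[symmetric]
      simp del: ennreal_plus)

lemma exp_neg_sum: "exp_neg (sum f A) = (\<Prod>i\<in>A. exp_neg (f i))"
  by (induction A rule: infinite_finite_induct) (auto simp: exp_neg_add)

lemma measurable_exp_neg [measurable]: "exp_neg \<in> borel_measurable borel"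
  unfolding exp_neg_def by measurable

lemma measurable_neg_ln [measurable]: "neg_ln \<in> borel_measurable borel"
  unfolding neg_ln_def by measurable

lemma exp_neg_neg_ln: assumes "y \<le> 1" shows "exp_neg (neg_ln y) = y"
proof (cases y)
  case (real r)
  with assms have "r \<le> 1" by auto
  with real show ?thesis by (cases "r = 0") (auto simp: neg_ln_def exp_neg_ennreal)
qed (use assms in \<open>auto simp: top_unique\<close>)

text \<open>For a finite supremum this is ordinary continuity; for an infinite one the values
  decrease to 0, the value of \<open>exp_neg\<close> there. Monotone limits of sums thus become
  decreasing limits of products.\<close>

lemma exp_neg_SUP:
  fixes f :: "nat \<Rightarrow> ennreal"
  assumes "incseq f"
  shows "exp_neg (SUP n. f n) = (INF n. exp_neg (f n))"
proof (rule antisym)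
  show "exp_neg (SUP n. f n) \<le> (INF n. exp_neg (f n))"
    by (intro INF_greatest exp_neg_antimono SUP_upper) simp
next
  show "(INF n. exp_neg (f n)) \<le> exp_neg (SUP n. f n)"
  proof (cases "(SUP n. f n) = \<top>")
    case True
    have "(INF n. exp_neg (f n)) \<le> ennreal e" if "e > 0" for e
    proof -
      \<comment> \<open>\<open>exp_neg\<close> drops to \<open>e\<close> once its argument passes
        \<open>- ln e\<close>; the maximum with 0 covers \<open>e > 1\<close>, where this bound is
        negative.\<close>
      have "ennreal (max 0 (- ln e)) < (SUP n. f n)" unfolding True by (rule ennreal_less_top)
      then obtain n where "ennreal (max 0 (- ln e)) < f n" by (auto simp: less_SUP_iff)
      then have "exp_neg (f n) \<le> exp_neg (ennreal (max 0 (- ln e)))" by (intro exp_neg_antimono) auto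
      also have "\<dots> \<le> ennreal e"
        using that by (auto simp: exp_neg_ennreal max_def ennreal_le_iff)
      finally show ?thesis by (meson INF_lower2 UNIV_I)
    qed
    then have "(INF n. exp_neg (f n)) \<le> 0"
      by - (rule ennreal_le_epsilon, simp)
    then show ?thesis by simp
  next
    case False
    then obtain s where s: "(SUP n. f n) = ennreal s" "0 \<le> s" by (cases "SUP n. f n") auto
    have fle: "f n \<le> ennreal s" for n unfolding s(1)[symmetric] by (simp add: SUP_upper)
    define g where "g n = enn2real (f n)" for n
    have "f n < \<top>" for n using fle[of n] by (rule le_less_trans) simp
    then have fg: "f n = ennreal (g n)" for n by (simp add: g_def)
    have g0: "0 \<le> g n" for n by (simp add: g_def)
    have "f \<longlonglongrightarrow> ennreal s" using LIMSEQ_SUP[OF assms] s by simp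
    then have "g \<longlonglongrightarrow> s" unfolding fg using s(2) g0 by (simp add: tendsto_ennreal_iff)
    then have "(\<lambda>n. ennreal (exp (- g n))) \<longlonglongrightarrow> ennreal (exp (- s))"
      by (intro tendsto_ennrealI tendsto_intros)
    moreover have "(INF n. exp_neg (f n)) \<le> ennreal (exp (- g n))" for n
      using INF_lower[of n UNIV "\<lambda>n. exp_neg (f n)"] fg[of n] g0[of n] by (simp add: exp_neg_ennreal)
    ultimately have "(INF n. exp_neg (f n)) \<le> ennreal (exp (- s))"
      by - (rule LIMSEQ_le_const, assumption, blast)
    with s show ?thesis by (simp add: exp_neg_ennreal)
  qed
qed

lemma exp_neg_suminf:
  fixes f :: "nat \<Rightarrow> ennreal"
  shows "exp_neg (\<Sum>i. f i) = (INF n. \<Prod>i<n. exp_neg (f i))"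
  unfolding suminf_eq_SUP
  by (subst exp_neg_SUP) (auto simp: exp_neg_sum intro!: incseq_SucI)

text \<open>The lowest non-zero coefficient of the difference, after division by the corresponding
  power, is the limit at 0 of a series that vanishes on (0, 1). Only this one-sided interval is
  available, because the argument will be \<open>z = exp (- s)\<close> with
  \<open>s > 0\<close>.\<close>

lemma powser_unique_right:
  fixes a b :: "nat \<Rightarrow> real"
  assumes a: "\<And>z. 0 < z \<Longrightarrow> z < 1 \<Longrightarrow> summable (\<lambda>k. a k * z ^ k)"
    and b: "\<And>z. 0 < z \<Longrightarrow> z < 1 \<Longrightarrow> summable (\<lambda>k. b k * z ^ k)"
    and eq: "\<And>z. 0 < z \<Longrightarrow> z < 1 \<Longrightarrow> (\<Sum>k. a k * z ^ k) = (\<Sum>k. b k * z ^ k)"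
  shows "a = b"
proof (rule ccontr)
  assume "a \<noteq> b"
  define c where "c = (\<lambda>k. a k - b k)"
  from \<open>a \<noteq> b\<close> have "\<exists>k. c k \<noteq> 0" by (auto simp: c_def fun_eq_iff)
  define m where "m = (LEAST k. c k \<noteq> 0)"
  have m: "c m \<noteq> 0" and less: "\<And>k. k < m \<Longrightarrow> c k = 0"
    unfolding m_def using LeastI_ex[OF \<open>\<exists>k. c k \<noteq> 0\<close>] not_less_Least[of _ "\<lambda>k. c k \<noteq> 0"]
    by blast+
  have sc: "(\<lambda>k. c k * z ^ k) sums 0" if "0 < z" "z < 1" for z
    using sums_diff[OF summable_sums[OF a[OF that]] summable_sums[OF b[OF that]]] eq[OF that]
    by (simp add: c_def algebra_simps)
  have sm: "(\<lambda>k. c (k + m) * z ^ k) sums 0" if "0 < z" "z < 1" for z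
  proof -
    have "(\<lambda>k. c (k + m) * z ^ (k + m)) sums (0 - (\<Sum>i<m. c i * z ^ i))"
      using sc[OF that] by (subst sums_iff_shift) (simp add: less)
    then have "(\<lambda>k. c (k + m) * z ^ (k + m)) sums 0" by (simp add: less)
    from sums_mult[OF this, of "1 / z ^ m"] that show ?thesis by (simp add: power_add)
  qed
  define d where "d = (\<lambda>k. c (k + m))"
  \<comment> \<open>The limit at 0 is taken from both sides first, so summability must be carried
    over to negative \<open>x\<close>; any point strictly between the absolute value of
    \<open>x\<close> and 1 does this.\<close>
  have sd: "summable (\<lambda>k. d k * x ^ k)" if "norm x < (1::real)" for x
  proof -
    define y where "y = (1 + norm x) / 2"
    have y: "norm x < norm y" "0 < y" "y < 1" using that by (auto simp: y_def)
    show ?thesis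
      by (rule powser_inside[OF _ y(1)]) (use sm[OF y(2,3)] in \<open>auto simp: d_def sums_iff\<close>)
  qed
  have "((\<lambda>x. \<Sum>k. d k * x ^ k) \<longlongrightarrow> d 0) (at 0)"
    by (rule powser_limit_0[of 1]) (simp, intro summable_sums sd, simp)
  then have "((\<lambda>x. \<Sum>k. d k * x ^ k) \<longlongrightarrow> d 0) (at_right 0)"
    by (rule filterlim_mono) (simp_all add: at_le)
  moreover have "\<forall>\<^sub>F x in at_right 0. (\<Sum>k. d k * x ^ k) = 0"
    using eventually_at_right_real[OF zero_less_one]
  proof eventually_elim
    case (elim x)
    then have "(\<lambda>k. d k * x ^ k) sums 0" unfolding d_def by (intro sm) simp_all
    then show ?case by (rule sums_unique[symmetric])
  qed
  ultimately have "((\<lambda>x. 0) \<longlongrightarrow> d 0) (at_right (0::real))"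
    by (rule Lim_transform_eventually)
  then have "d 0 = 0" by (simp add: tendsto_const_iff)
  with m show False by (simp add: d_def)
qed

text \<open>For \<open>m = \<infinity>\<close> all mass sits at \<open>\<infinity>\<close>, so every finite count has weight \<open>0\<close>.\<close>
definition poisson_weight :: "ennreal \<Rightarrow> nat \<Rightarrow> ennreal" where
  "poisson_weight m k = (if m = \<top> then 0 else ennreal (exp (- enn2real m) * enn2real m ^ k / fact k))"

lemma poisson_weight_neq_top [simp]: "poisson_weight m k \<noteq> \<top>"
  by (simp add: poisson_weight_def)

lemma exp_neg_real_mult_nat:
  assumes "0 \<le> s" shows "exp_neg (ennreal s * of_nat k) = ennreal (exp (- s) ^ k)"
  using assms
  by (simp add: exp_neg_ennreal exp_of_nat_mult[symmetric] ennreal_of_nat_eq_real_of_nat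
      ennreal_mult[symmetric] mult.commute)

lemma exp_neg_real_mult_top: "0 < s \<Longrightarrow> exp_neg (ennreal s * \<top>) = 0"
  by (simp add: ennreal_mult_top)

text \<open>The generating function of the Poisson law. For infinite \<open>m\<close> both sides
  vanish: \<open>z < 1\<close> makes the exponent infinite.\<close>

lemma exp_neg_eq_suminf_poisson_weight:
  assumes z: "0 < z" "z < 1"
  shows "exp_neg (ennreal (1 - z) * m) = (\<Sum>k. poisson_weight m k * ennreal (z ^ k))"
proof (cases m)
  case (real r)
  have "(\<lambda>k. (exp (- r) * r ^ k / fact k) * z ^ k) sums (exp (- r) * exp (r * z))"
    using sums_mult[OF exp_converges[of "r * z"], of "exp (- r)"]
    by (simp add: divide_inverse power_mult_distrib mult_ac)
  then have "(\<Sum>k. ennreal ((exp (- r) * r ^ k / fact k) * z ^ k)) = ennreal (exp (- r) * exp (r * z))"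
    using real z by (subst suminf_ennreal2) (auto simp: sums_iff)
  moreover have "exp (- r) * exp (r * z) = exp (- ((1 - z) * r))"
    by (simp add: exp_add[symmetric] left_diff_distrib)
  moreover have "exp_neg (ennreal (1 - z) * m) = ennreal (exp (- ((1 - z) * r)))"
    using real z by (simp add: ennreal_mult[symmetric] exp_neg_ennreal)
  moreover have "poisson_weight m k * ennreal (z ^ k) = ennreal ((exp (- r) * r ^ k / fact k) * z ^ k)" for k
    using real z by (subst ennreal_mult) (simp_all add: poisson_weight_def)
  ultimately show ?thesis by simp
qed (use z in \<open>simp add: poisson_weight_def exp_neg_real_mult_top\<close>)

lemma ennreal_power_series_unique:
  fixes f g :: "nat \<Rightarrow> ennreal"
  assumes eq: "\<And>z. 0 < z \<Longrightarrow> z < 1 \<Longrightarrow> (\<Sum>k. f k * ennreal (z ^ k)) = (\<Sum>k. g k * ennreal (z ^ k))"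
    and fin: "\<And>z. 0 < z \<Longrightarrow> z < 1 \<Longrightarrow> (\<Sum>k. f k * ennreal (z ^ k)) \<noteq> \<top>"
    and f: "\<And>k. f k \<noteq> \<top>" and g: "\<And>k. g k \<noteq> \<top>"
  shows "f k = g k"
proof -
  have *: "h k * ennreal (z ^ k) = ennreal (enn2real (h k) * z ^ k)"
    if "h k \<noteq> \<top>" "0 < z" for h :: "nat \<Rightarrow> ennreal" and k z
    using that by (simp add: ennreal_mult less_top)
  have sf: "summable (\<lambda>k. enn2real (f k) * z ^ k)" if z: "0 < z" "z < 1" for z
    by (rule summable_suminf_not_top) (use fin[OF z] z in \<open>auto simp: *[of f, OF f]\<close>)
  have sg: "summable (\<lambda>k. enn2real (g k) * z ^ k)" if z: "0 < z" "z < 1" for z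
    by (rule summable_suminf_not_top) (use fin[OF z] eq[OF z] z in \<open>auto simp: *[of g, OF g]\<close>)
  have "(\<lambda>k. enn2real (f k)) = (\<lambda>k. enn2real (g k))"
  proof (rule powser_unique_right[OF sf sg], assumption+)
    fix z :: real assume z: "0 < z" "z < 1"
    have "ennreal (\<Sum>k. enn2real (f k) * z ^ k) = ennreal (\<Sum>k. enn2real (g k) * z ^ k)"
      using eq[OF z] z sf[OF z] sg[OF z] by (simp add: *[of f, OF f] *[of g, OF g] suminf_ennreal2)
    then show "(\<Sum>k. enn2real (f k) * z ^ k) = (\<Sum>k. enn2real (g k) * z ^ k)"
      using z sf[OF z] sg[OF z] by (subst (asm) ennreal_inj) (auto intro!: suminf_nonneg)
  qed
  then have "enn2real (f k) = enn2real (g k)" by (rule fun_cong)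
  then show ?thesis using f[of k] g[of k] by (cases "f k"; cases "g k") auto
qed

definition nat_valued :: "ennreal \<Rightarrow> bool" where
  "nat_valued x \<longleftrightarrow> x = \<top> \<or> (\<exists>k::nat. x = of_nat k)"

text \<open>Since \<open>s\<close> is positive, an infinite count contributes 0 to the transform,
  and it matches none of the indicators on the right.\<close>

lemma exp_neg_nat_valued:
  assumes "nat_valued x" "0 < s"
  shows "exp_neg (ennreal s * x) = (\<Sum>k. indicator {of_nat k} x * ennreal (exp (- s) ^ k))"
proof (cases "x = \<top>")
  case True
  then show ?thesis using assms by (simp add: exp_neg_real_mult_top)
next
  case False
  then obtain n :: nat where n: "x = of_nat n" using assms by (auto simp: nat_valued_def)
  have "(\<Sum>k. indicator {of_nat k} x * ennreal (exp (- s) ^ k))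
      = (\<Sum>k\<in>{n}. indicator {of_nat k} x * ennreal (exp (- s) ^ k))"
    by (rule suminf_finite) (auto simp: n indicator_def)
  with n assms show ?thesis by (simp add: exp_neg_real_mult_nat)
qed

text \<open>In the variable \<open>z = exp (- s)\<close> both transforms are power series, so their
  coefficients agree. The weight \<open>W\<close> lets several counts be treated one after the
  other.\<close>

lemma nn_integral_count_eq:
  assumes W [measurable]: "W \<in> borel_measurable M" and Wfin: "(\<integral>\<^sup>+\<omega>. W \<omega> \<partial>M) \<noteq> \<top>"
    and N [measurable]: "N \<in> borel_measurable M" and nat: "\<And>\<omega>. \<omega> \<in> space M \<Longrightarrow> nat_valued (N \<omega>)"
    and c: "c \<noteq> \<top>"
    and lap: "\<And>s. 0 < s \<Longrightarrow> (\<integral>\<^sup>+\<omega>. W \<omega> * exp_neg (ennreal s * N \<omega>) \<partial>M) = c * exp_neg (ennreal (1 - exp (- s)) * m)"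
  shows "(\<integral>\<^sup>+\<omega>. W \<omega> * indicator {of_nat k} (N \<omega>) \<partial>M) = c * poisson_weight m k"
proof -
  let ?f = "\<lambda>k. \<integral>\<^sup>+\<omega>. W \<omega> * indicator {of_nat k} (N \<omega>) \<partial>M"
  have f: "(\<Sum>k. ?f k * ennreal (z ^ k)) = c * exp_neg (ennreal (1 - z) * m)" if z: "0 < z" "z < 1" for z
  proof -
    have s: "0 < - ln z" "exp (- (- ln z)) = z" using z by auto
    have "(\<Sum>k. ?f k * ennreal (z ^ k))
        = (\<integral>\<^sup>+\<omega>. (\<Sum>k. W \<omega> * indicator {of_nat k} (N \<omega>) * ennreal (z ^ k)) \<partial>M)"
      by (simp add: nn_integral_suminf nn_integral_multc)
    also have "\<dots> = (\<integral>\<^sup>+\<omega>. W \<omega> * exp_neg (ennreal (- ln z) * N \<omega>) \<partial>M)"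
      by (intro nn_integral_cong, subst exp_neg_nat_valued[OF nat s(1)])
        (use s(2) in \<open>simp_all add: mult.assoc ennreal_suminf_cmult[symmetric] del: ennreal_suminf_cmult\<close>)
    also have "\<dots> = c * exp_neg (ennreal (1 - z) * m)" using lap[OF s(1)] s(2) by simp
    finally show ?thesis .
  qed
  show ?thesis
  proof (rule ennreal_power_series_unique)
    fix z :: real assume z: "0 < z" "z < 1"
    show "(\<Sum>k. ?f k * ennreal (z ^ k)) \<noteq> \<top>"
      unfolding f[OF z] using c by (simp add: ennreal_mult_eq_top_iff)
    show "(\<Sum>k. ?f k * ennreal (z ^ k)) = (\<Sum>k. c * poisson_weight m k * ennreal (z ^ k))"
      unfolding f[OF z] exp_neg_eq_suminf_poisson_weight[OF z] by (simp add: mult.assoc)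
  next
    fix k
    have "?f k \<le> (\<integral>\<^sup>+\<omega>. W \<omega> \<partial>M)"
      by (intro nn_integral_mono) (auto simp: indicator_def)
    then show "?f k \<noteq> \<top>" using Wfin by (auto simp: top_unique)
    show "c * poisson_weight m k \<noteq> \<top>" using c by (simp add: ennreal_mult_eq_top_iff)
  qed
qed

context prob_space
begin

text \<open>Transforms are exchanged for point probabilities one index at a time: \<open>I1\<close>
  collects the indices already converted, \<open>I2\<close> those still in Laplace form, and
  everything except the current index serves as the weight in \<open>nn_integral_count_eq\<close>.
  The transform is assumed for all subsets of \<open>J\<close> because leaving out an index replaces
  the parameter 0.\<close>

lemma joint_counts_eq:
  fixes N :: "'i \<Rightarrow> 'a \<Rightarrow> ennreal"
  assumes N [measurable]: "\<And>j. j \<in> J \<Longrightarrow> N j \<in> borel_measurable M"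
    and nat: "\<And>j \<omega>. j \<in> J \<Longrightarrow> \<omega> \<in> space M \<Longrightarrow> nat_valued (N j \<omega>)"
    and J: "finite J"
    and lap: "\<And>I s. I \<subseteq> J \<Longrightarrow> (\<And>j. j \<in> I \<Longrightarrow> 0 < s j) \<Longrightarrow>
      (\<integral>\<^sup>+\<omega>. (\<Prod>j\<in>I. exp_neg (ennreal (s j) * N j \<omega>)) \<partial>M) = (\<Prod>j\<in>I. exp_neg (ennreal (1 - exp (- s j)) * m j))"
  shows "emeasure M {\<omega> \<in> space M. \<forall>j\<in>J. N j \<omega> = of_nat (k j)} = (\<Prod>j\<in>J. poisson_weight (m j) (k j))"
proof -
  have *: "(\<integral>\<^sup>+\<omega>. (\<Prod>j\<in>I1. indicator {of_nat (k j)} (N j \<omega>)) * (\<Prod>j\<in>I2. exp_neg (ennreal (s j) * N j \<omega>)) \<partial>M)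
      = (\<Prod>j\<in>I1. poisson_weight (m j) (k j)) * (\<Prod>j\<in>I2. exp_neg (ennreal (1 - exp (- s j)) * m j))"
    if "finite I1" "I1 \<subseteq> J" "I2 \<subseteq> J" "I1 \<inter> I2 = {}" "\<And>j. j \<in> I2 \<Longrightarrow> 0 < s j" for I1 I2 s
    using that
  proof (induction I1 arbitrary: I2 s rule: finite_induct)
    case empty
    then show ?case by (simp add: lap)
  next
    case (insert x I1)
    have fin: "finite I2" "finite I1" using insert J finite_subset by auto
    have x: "x \<in> J" "x \<notin> I2" "x \<notin> I1" using insert by auto
    have sub: "\<And>j. j \<in> I1 \<Longrightarrow> j \<in> J" "\<And>j. j \<in> I2 \<Longrightarrow> j \<in> J" using insert by auto
    let ?W = "\<lambda>\<omega>. (\<Prod>j\<in>I1. indicator {of_nat (k j)} (N j \<omega>)) * (\<Prod>j\<in>I2. exp_neg (ennreal (s j) * N j \<omega>))"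
    let ?c = "(\<Prod>j\<in>I1. poisson_weight (m j) (k j)) * (\<Prod>j\<in>I2. exp_neg (ennreal (1 - exp (- s j)) * m j))"
    have W [measurable]: "?W \<in> borel_measurable M"
      using sub N by measurable
    have [measurable]: "N x \<in> borel_measurable M" using x N by auto
    have W1: "?W \<omega> \<le> 1 * 1" for \<omega>
      by (intro mult_mono prod_le_1) (auto simp: exp_neg_le_1 indicator_def)
    have "(\<integral>\<^sup>+\<omega>. ?W \<omega> \<partial>M) \<le> (\<integral>\<^sup>+\<omega>. 1 \<partial>M)"
      using W1 by (intro nn_integral_mono) auto
    then have Wfin: "(\<integral>\<^sup>+\<omega>. ?W \<omega> \<partial>M) \<noteq> \<top>" by (auto simp: emeasure_space_1 top_unique)
    have c: "?c \<noteq> \<top>"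
      by (auto simp: ennreal_mult_eq_top_iff ennreal_prod_eq_top)
    have "(\<integral>\<^sup>+\<omega>. ?W \<omega> * indicator {of_nat (k x)} (N x \<omega>) \<partial>M) = ?c * poisson_weight (m x) (k x)"
    proof (rule nn_integral_count_eq[OF W Wfin _ _ c])
      fix t :: real assume t: "0 < t"
      \<comment> \<open>The current index is first put on the Laplace side with the parameter
        \<open>t\<close>, so that the induction hypothesis applies with \<open>I2\<close> enlarged
        by \<open>x\<close>.\<close>
      let ?s = "s(x := t)"
      have "(\<integral>\<^sup>+\<omega>. (\<Prod>j\<in>I1. indicator {of_nat (k j)} (N j \<omega>)) * (\<Prod>j\<in>insert x I2. exp_neg (ennreal (?s j) * N j \<omega>)) \<partial>M)
        = (\<Prod>j\<in>I1. poisson_weight (m j) (k j)) * (\<Prod>j\<in>insert x I2. exp_neg (ennreal (1 - exp (- ?s j)) * m j))"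
        using insert.prems x t by (intro insert.IH) auto
      moreover have "(\<Prod>j\<in>I2. exp_neg (ennreal (?s j) * N j \<omega>)) = (\<Prod>j\<in>I2. exp_neg (ennreal (s j) * N j \<omega>))" for \<omega>
        using x by (intro prod.cong) auto
      moreover have "(\<Prod>j\<in>I2. exp_neg (ennreal (1 - exp (- ?s j)) * m j)) = (\<Prod>j\<in>I2. exp_neg (ennreal (1 - exp (- s j)) * m j))"
        using x by (intro prod.cong) auto
      ultimately show "(\<integral>\<^sup>+\<omega>. ?W \<omega> * exp_neg (ennreal t * N x \<omega>) \<partial>M) = ?c * exp_neg (ennreal (1 - exp (- t)) * m x)"
        using x fin by (simp add: mult_ac)
    qed (use x nat in auto)
    then show ?case using x fin by (simp add: mult_ac)
  qed
  have "emeasure M {\<omega> \<in> space M. \<forall>j\<in>J. N j \<omega> = of_nat (k j)}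
     = (\<integral>\<^sup>+\<omega>. indicator {\<omega> \<in> space M. \<forall>j\<in>J. N j \<omega> = of_nat (k j)} \<omega> \<partial>M)"
    using J by (subst nn_integral_indicator) auto
  also have "\<dots> = (\<integral>\<^sup>+\<omega>. (\<Prod>j\<in>J. indicator {of_nat (k j)} (N j \<omega>)) \<partial>M)"
    using J by (intro nn_integral_cong) (auto simp: indicator_def prod_zero_iff)
  also have "\<dots> = (\<Prod>j\<in>J. poisson_weight (m j) (k j))"
    using *[of J "{}"] J by simp
  finally show ?thesis .
qed

text \<open>The events that a count takes a given finite value generate its sigma-algebra: the value
  \<open>\<top>\<close> is the complement of their union. Probabilities of finite values therefore
  suffice.\<close>

lemma indep_nat_valued:
  fixes N :: "'i \<Rightarrow> 'a \<Rightarrow> ennreal"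
  assumes N [measurable]: "\<And>j. j \<in> I \<Longrightarrow> N j \<in> borel_measurable M"
    and nat: "\<And>j \<omega>. j \<in> I \<Longrightarrow> \<omega> \<in> space M \<Longrightarrow> nat_valued (N j \<omega>)"
    and joint: "\<And>J k. J \<subseteq> I \<Longrightarrow> finite J \<Longrightarrow>
      emeasure M {\<omega> \<in> space M. \<forall>j\<in>J. N j \<omega> = of_nat (k j :: nat)} = (\<Prod>j\<in>J. p j (k j))"
  shows "indep_vars (\<lambda>_. borel) N I"
proof -
  define S where "S j k = {\<omega> \<in> space M. N j \<omega> = of_nat (k::nat)}" for j k
  \<comment> \<open>The empty set makes the generator closed under intersection, since two different
    values of the same count exclude each other.\<close>
  define F where "F j = insert {} (range (S j))" for j
  have single: "emeasure M (S j k) = p j k" if "j \<in> I" for j k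
    using joint[of "{j}" "\<lambda>_. k"] that by (simp add: S_def)
  have Sm: "S j k \<in> sets M" if "j \<in> I" for j k
    unfolding S_def using N[OF that] by measurable
  have ind: "indep_sets F I"
    unfolding indep_sets_def
  proof (intro conjI ballI allI impI)
    fix j assume "j \<in> I" then show "F j \<subseteq> events" using Sm by (auto simp: F_def)
  next
    fix J A assume J: "J \<subseteq> I" "J \<noteq> {}" "finite J" and A: "A \<in> Pi J F"
    show "prob (\<Inter> (A ` J)) = (\<Prod>j\<in>J. prob (A j))"
    proof (cases "\<exists>j\<in>J. A j = {}")
      case True
      then have "\<Inter> (A ` J) = {}" by auto
      then show ?thesis using True J by (simp add: prod_zero_iff) (metis measure_empty)
    next
      case False
      then have "\<forall>j\<in>J. \<exists>k. A j = S j k" using A by (fastforce simp: F_def Pi_iff)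
      then obtain k where k: "\<And>j. j \<in> J \<Longrightarrow> A j = S j (k j)" by metis
      have "\<Inter> (A ` J) = {\<omega> \<in> space M. \<forall>j\<in>J. N j \<omega> = of_nat (k j)}"
        using J by (auto simp: k S_def)
      then have "emeasure M (\<Inter> (A ` J)) = (\<Prod>j\<in>J. p j (k j))" using joint J by simp
      also have "\<dots> = (\<Prod>j\<in>J. emeasure M (A j))"
        using J by (intro prod.cong) (auto simp: k single)
      finally have "ennreal (prob (\<Inter> (A ` J))) = ennreal (\<Prod>j\<in>J. prob (A j))"
        by (simp add: emeasure_eq_measure prod_ennreal)
      then show ?thesis by (simp add: prod_nonneg)
    qed
  qed
  have "Int_stable (F j)" for j
    by (auto simp: Int_stable_def F_def S_def)
  then have ind': "indep_sets (\<lambda>j. sigma_sets (space M) (F j)) I"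
    using ind by (intro indep_sets_sigma) auto
  show ?thesis
    unfolding indep_vars_def2
  proof (intro conjI ballI indep_sets_mono_sets[OF ind'] subsetI)
    fix j X assume j: "j \<in> I" and "X \<in> {N j -` B \<inter> space M |B. B \<in> sets borel}"
    then obtain B where X: "X = N j -` B \<inter> space M" by auto
    define C where "C = (\<Union>k\<in>{k. of_nat k \<in> B}. S j k)"
    have S: "S j k \<in> sigma_sets (space M) (F j)" for k by (auto simp: F_def)
    interpret F: sigma_algebra "space M" "sigma_sets (space M) (F j)"
      by (rule sigma_algebra_sigma_sets) (auto simp: F_def S_def)
    have C: "C \<in> sigma_sets (space M) (F j)" unfolding C_def using S by (intro F.countable_UN'') auto
    have T: "space M - (\<Union>k. S j k) \<in> sigma_sets (space M) (F j)" using S by auto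
    have "X = C \<union> (if \<top> \<in> B then space M - (\<Union>k. S j k) else {})"
      unfolding X C_def S_def using nat[OF j, unfolded nat_valued_def] by auto metis
    then show "X \<in> sigma_sets (space M) (F j)" using C T F.Un[OF C T] by simp
  qed (use N in auto)
qed

end

section \<open>Poisson processes and the joint Laplace transform of their counts\<close>

lemma poisson_weight_emeasure:
  "emeasure \<mu> A \<noteq> \<infinity> \<Longrightarrow>
    poisson_weight (emeasure \<mu> A) k = ennreal (exp (- measure \<mu> A) * measure \<mu> A ^ k / fact k)"
  by (simp add: poisson_weight_def measure_def)

context prob_space
begin

text \<open>The transform on finitely many disjoint sets fixes the joint probabilities of finite
  counts. All clauses on the distribution follow from these: a single set gives the Poisson law, the
  product form gives independence.\<close>

lemma poisson_ppI:
  assumes sets: "\<And>\<omega>. \<omega> \<in> space M \<Longrightarrow> sets (N \<omega>) = sets \<mu>"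
    and meas: "\<And>A. A \<in> sets \<mu> \<Longrightarrow> (\<lambda>\<omega>. emeasure (N \<omega>) A) \<in> borel_measurable M"
    and nat: "\<And>A \<omega>. A \<in> sets \<mu> \<Longrightarrow> \<omega> \<in> space M \<Longrightarrow> nat_valued (emeasure (N \<omega>) A)"
    and lap: "\<And>(J::nat set) A s. finite J \<Longrightarrow> A ` J \<subseteq> sets \<mu> \<Longrightarrow> disjoint_family_on A J \<Longrightarrow>
      (\<And>j. j \<in> J \<Longrightarrow> 0 < s j) \<Longrightarrow>
      (\<integral>\<^sup>+\<omega>. (\<Prod>j\<in>J. exp_neg (ennreal (s j) * emeasure (N \<omega>) (A j))) \<partial>M)
        = (\<Prod>j\<in>J. exp_neg (ennreal (1 - exp (- s j)) * emeasure \<mu> (A j)))"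
  shows "poisson_pp M \<mu> N"
proof -
  have joint: "emeasure M {\<omega> \<in> space M. \<forall>j\<in>J. emeasure (N \<omega>) (A j) = of_nat (k j)}
      = (\<Prod>j\<in>J. poisson_weight (emeasure \<mu> (A j)) (k j))"
    if J: "finite J" "A ` J \<subseteq> sets \<mu>" "disjoint_family_on A J" for J :: "nat set" and A k
  proof (rule joint_counts_eq)
    show "(\<integral>\<^sup>+\<omega>. (\<Prod>j\<in>I. exp_neg (ennreal (s j) * emeasure (N \<omega>) (A j))) \<partial>M)
        = (\<Prod>j\<in>I. exp_neg (ennreal (1 - exp (- s j)) * emeasure \<mu> (A j)))"
      if I: "I \<subseteq> J" and s: "\<And>j. j \<in> I \<Longrightarrow> 0 < s j" for I s
      using J I finite_subset[OF I] s
      by (intro lap) (auto simp: disjoint_family_on_def subset_iff)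
  qed (use J meas nat in auto)
  have single: "emeasure M {\<omega> \<in> space M. emeasure (N \<omega>) A = of_nat k} = poisson_weight (emeasure \<mu> A) k"
    if "A \<in> sets \<mu>" for A k
    using joint[of "{0}" "\<lambda>_. A" "\<lambda>_. k"] that by (simp add: disjoint_family_on_def)
  show ?thesis
    unfolding poisson_pp_def
  proof (intro conjI ballI allI impI)
    fix A k assume A: "A \<in> sets \<mu>" "emeasure \<mu> A < \<infinity>"
    have "ennreal (prob {\<omega> \<in> space M. emeasure (N \<omega>) A = of_nat k})
        = ennreal (exp (- measure \<mu> A) * measure \<mu> A ^ k / fact k)"
      using single[OF A(1), of k] A(2) by (subst (asm) poisson_weight_emeasure) (auto simp: emeasure_eq_measure)
    then show "prob {\<omega> \<in> space M. emeasure (N \<omega>) A = of_nat k}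
        = exp (- measure \<mu> A) * measure \<mu> A ^ k / fact k" by simp
  next
    fix A assume A: "A \<in> sets \<mu>" "emeasure \<mu> A = \<infinity>"
    \<comment> \<open>With infinite intensity every finite value has probability 0, and a count that
      takes no finite value is infinite.\<close>
    have "AE \<omega> in M. \<forall>k::nat. emeasure (N \<omega>) A \<noteq> of_nat k"
      unfolding AE_all_countable
    proof
      fix k :: nat
      show "AE \<omega> in M. emeasure (N \<omega>) A \<noteq> of_nat k"
        using single[OF A(1), of k] A meas[OF A(1)]
        by (intro AE_I[of _ _ "{\<omega> \<in> space M. emeasure (N \<omega>) A = of_nat k}"]) (auto simp: poisson_weight_def)
    qed
    then show "AE \<omega> in M. emeasure (N \<omega>) A = \<infinity>"
      by (rule AE_mp) (intro AE_I2 impI, use nat[OF A(1)] in \<open>force simp: nat_valued_def\<close>)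
  next
    fix n :: nat and A assume A: "A ` {..<n} \<subseteq> sets \<mu> \<and> disjoint_family_on A {..<n}"
    show "indep_vars (\<lambda>_. borel) (\<lambda>i \<omega>. emeasure (N \<omega>) (A i)) {..<n}"
    proof (rule indep_nat_valued)
      show "emeasure M {\<omega> \<in> space M. \<forall>j\<in>J. emeasure (N \<omega>) (A j) = of_nat (k j)}
          = (\<Prod>j\<in>J. poisson_weight (emeasure \<mu> (A j)) (k j))" if "J \<subseteq> {..<n}" "finite J" for J k
        using that A by (intro joint) (auto simp: disjoint_family_on_def subset_iff)
    qed (use A meas nat in auto)
  qed (use sets meas in auto)
qed

lemma poisson_pp_emeasure_count:
  assumes pp: "poisson_pp M \<mu> N" and A: "A \<in> sets \<mu>"
  shows "emeasure M {\<omega> \<in> space M. emeasure (N \<omega>) A = of_nat k} = poisson_weight (emeasure \<mu> A) k"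
proof (cases "emeasure \<mu> A = \<infinity>")
  case True
  then have "AE \<omega> in M. emeasure (N \<omega>) A = \<infinity>" using pp A by (auto simp: poisson_pp_def)
  then have "AE \<omega> in M. \<not> emeasure (N \<omega>) A = of_nat k"
    by eventually_elim simp
  then have "emeasure M {\<omega> \<in> space M. emeasure (N \<omega>) A = of_nat k} = 0"
    by (rule emeasure_eq_0_AE)
  with True show ?thesis by (simp add: poisson_weight_def)
next
  case False
  then have "prob {\<omega> \<in> space M. emeasure (N \<omega>) A = of_nat k} = exp (- measure \<mu> A) * measure \<mu> A ^ k / fact k"
    using pp A by (auto simp: poisson_pp_def less_top)
  with False show ?thesis by (simp add: emeasure_eq_measure poisson_weight_emeasure)
qed

lemma poisson_pp_laplace_count:
  assumes pp: "poisson_pp M \<mu> N" and A: "A \<in> sets \<mu>"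
    and nat: "\<And>\<omega>. \<omega> \<in> space M \<Longrightarrow> nat_valued (emeasure (N \<omega>) A)" and s: "s \<noteq> \<top>"
  shows "(\<integral>\<^sup>+\<omega>. exp_neg (s * emeasure (N \<omega>) A) \<partial>M) = exp_neg ((1 - exp_neg s) * emeasure \<mu> A)"
proof (cases "s = 0")
  case True
  then show ?thesis by (simp add: emeasure_space_1)
next
  case False
  with s obtain r where r: "s = ennreal r" "0 < r" by (cases s) auto
  have [measurable]: "(\<lambda>\<omega>. emeasure (N \<omega>) A) \<in> borel_measurable M"
    using pp A by (auto simp: poisson_pp_def)
  have "(\<integral>\<^sup>+\<omega>. exp_neg (s * emeasure (N \<omega>) A) \<partial>M)
      = (\<integral>\<^sup>+\<omega>. (\<Sum>k. indicator {of_nat k} (emeasure (N \<omega>) A) * ennreal (exp (- r) ^ k)) \<partial>M)"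
    unfolding r(1) by (intro nn_integral_cong exp_neg_nat_valued nat r)
  also have "\<dots> = (\<Sum>k. (\<integral>\<^sup>+\<omega>. indicator {of_nat k} (emeasure (N \<omega>) A) \<partial>M) * ennreal (exp (- r) ^ k))"
    by (simp add: nn_integral_suminf nn_integral_multc)
  also have "(\<lambda>k. \<integral>\<^sup>+\<omega>. indicator {of_nat k} (emeasure (N \<omega>) A) \<partial>M)
      = (\<lambda>k. \<integral>\<^sup>+\<omega>. indicator {\<omega> \<in> space M. emeasure (N \<omega>) A = of_nat k} \<omega> \<partial>M)"
    by (intro ext nn_integral_cong) (auto simp: indicator_def)
  also have "\<dots> = (\<lambda>k. poisson_weight (emeasure \<mu> A) k)"
    by (simp add: poisson_pp_emeasure_count[OF pp A])
  also have "(\<Sum>k. poisson_weight (emeasure \<mu> A) k * ennreal (exp (- r) ^ k)) = exp_neg (ennreal (1 - exp (- r)) * emeasure \<mu> A)"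
    using r by (intro exp_neg_eq_suminf_poisson_weight[symmetric]) auto
  also have "ennreal (1 - exp (- r)) = 1 - exp_neg s"
    using r by (simp add: exp_neg_ennreal ennreal_minus[symmetric])
  finally show ?thesis .
qed

text \<open>The mean of a Poisson variable is its parameter. The processes are first shown to be
  Poisson with respect to an explicit measure; this identifies that measure with their
  \<open>intensity\<close>.\<close>

lemma poisson_pp_intensity:
  assumes pp: "poisson_pp M \<mu> N" and S: "sets S = sets \<mu>"
    and nat: "\<And>A \<omega>. A \<in> sets \<mu> \<Longrightarrow> \<omega> \<in> space M \<Longrightarrow> nat_valued (emeasure (N \<omega>) A)"
  shows "intensity M S N = \<mu>"
proof -
  have "(\<integral>\<^sup>+\<omega>. emeasure (N \<omega>) A \<partial>M) = emeasure \<mu> A" if A: "A \<in> sets \<mu>" for A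
  proof (cases "emeasure \<mu> A = \<infinity>")
    case True
    then have "AE \<omega> in M. emeasure (N \<omega>) A = \<infinity>" using pp A by (auto simp: poisson_pp_def)
    then have "(\<integral>\<^sup>+\<omega>. emeasure (N \<omega>) A \<partial>M) = (\<integral>\<^sup>+\<omega>. \<infinity> \<partial>M)" by (rule nn_integral_cong_AE)
    then show ?thesis using True by (simp add: emeasure_space_1 ennreal_top_mult)
  next
    case False
    then obtain r where r: "emeasure \<mu> A = ennreal r" "0 \<le> r" by (cases "emeasure \<mu> A") auto
    have [measurable]: "(\<lambda>\<omega>. emeasure (N \<omega>) A) \<in> borel_measurable M"
      using pp A by (auto simp: poisson_pp_def)
    let ?S = "\<lambda>k. {\<omega> \<in> space M. emeasure (N \<omega>) A = of_nat k}"
    have p: "emeasure M (?S k) = ennreal (exp (- r) * r ^ k / fact k)" for k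
      unfolding poisson_pp_emeasure_count[OF pp A] using r by (simp add: poisson_weight_def)
    have ps: "(\<lambda>k. exp (- r) * r ^ k / fact k) sums 1"
      using sums_mult[OF exp_converges[of r], of "exp (- r)"] by (simp add: divide_inverse mult_ac exp_minus)
    \<comment> \<open>The term for \<open>k = 0\<close> vanishes, and after a shift of the index
      each term is \<open>r\<close> times a Poisson weight.\<close>
    have qs: "(\<lambda>k. real k * (exp (- r) * r ^ k / fact k)) sums r"
    proof -
      have "(\<lambda>k. real (Suc k) * (exp (- r) * r ^ Suc k / fact (Suc k))) = (\<lambda>k. r * (exp (- r) * r ^ k / fact k))"
        by (rule ext) (simp add: field_simps del: of_nat_Suc)
      moreover have "(\<lambda>k. r * (exp (- r) * r ^ k / fact k)) sums r"
        using sums_mult[OF ps, of r] by simp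
      ultimately have "(\<lambda>k. real (Suc k) * (exp (- r) * r ^ Suc k / fact (Suc k))) sums r"
        by (simp only:)
      then show ?thesis by (subst (asm) sums_Suc_iff) simp
    qed
    have disj: "disjoint_family ?S" by (auto simp: disjoint_family_on_def)
    have "emeasure M (\<Union>k. ?S k) = (\<Sum>k. emeasure M (?S k))"
      by (rule suminf_emeasure[symmetric]) (auto simp: disj)
    also have "\<dots> = 1"
      unfolding p using ps r by (subst suminf_ennreal2) (auto simp: sums_iff)
    finally have "prob (\<Union>k. ?S k) = 1" by (simp add: emeasure_eq_measure)
    then have "AE \<omega> in M. \<omega> \<in> (\<Union>k. ?S k)" by (rule AE_prob_1)
    then have "AE \<omega> in M. emeasure (N \<omega>) A = (\<Sum>k. of_nat k * indicator (?S k) \<omega>)"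
    proof (rule AE_mp, intro AE_I2 impI)
      fix \<omega> assume "\<omega> \<in> space M" "\<omega> \<in> (\<Union>k. ?S k)"
      then obtain n :: nat where n: "emeasure (N \<omega>) A = of_nat n" by auto
      have "(\<Sum>k. of_nat k * indicator (?S k) \<omega>) = (\<Sum>k\<in>{n}. of_nat k * indicator (?S k) \<omega> :: ennreal)"
        by (rule suminf_finite) (auto simp: n indicator_def)
      then show "emeasure (N \<omega>) A = (\<Sum>k. of_nat k * indicator (?S k) \<omega>)"
        using n \<open>\<omega> \<in> space M\<close> by simp
    qed
    then have "(\<integral>\<^sup>+\<omega>. emeasure (N \<omega>) A \<partial>M) = (\<integral>\<^sup>+\<omega>. (\<Sum>k. of_nat k * indicator (?S k) \<omega>) \<partial>M)"
      by (rule nn_integral_cong_AE)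
    also have "\<dots> = (\<Sum>k. of_nat k * emeasure M (?S k))"
      by (simp add: nn_integral_suminf nn_integral_cmult_indicator)
    also have "\<dots> = (\<Sum>k. ennreal (real k * (exp (- r) * r ^ k / fact k)))"
      unfolding p using r by (intro suminf_cong) (simp only: ennreal_of_nat_eq_real_of_nat, subst ennreal_mult[symmetric], auto)
    also have "\<dots> = ennreal r"
      using qs r by (subst suminf_ennreal2) (auto simp: sums_iff)
    finally show ?thesis using r by simp
  qed
  then have "intensity M S N = measure_of (space \<mu>) (sets \<mu>) (emeasure \<mu>)"
    unfolding intensity_def S sets_eq_imp_space_eq[OF S]
    by (intro measure_of_eq sets.space_closed) (simp add: sets.sigma_sets_eq)
  then show ?thesis by (simp add: measure_of_of_measure)
qed

end

lemma nn_integral_simple_compose: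
  fixes \<phi> :: "'b \<Rightarrow> ennreal"
  assumes h: "simple_function M h"
  shows "(\<integral>\<^sup>+x. \<phi> (h x) \<partial>M) = (\<Sum>y\<in>h ` space M. \<phi> y * emeasure M (h -` {y} \<inter> space M))"
proof -
  have fin: "finite (h ` space M)" and s: "\<And>y. h -` {y} \<inter> space M \<in> sets M"
    using h simple_functionD by auto
  have "(\<integral>\<^sup>+x. \<phi> (h x) \<partial>M) = (\<integral>\<^sup>+x. (\<Sum>y\<in>h ` space M. \<phi> y * indicator (h -` {y} \<inter> space M) x) \<partial>M)"
  proof (rule nn_integral_cong)
    fix x assume x: "x \<in> space M"
    have "(\<Sum>y\<in>h ` space M. \<phi> y * indicator (h -` {y} \<inter> space M) x)
        = (\<Sum>y\<in>{h x}. \<phi> y * indicator (h -` {y} \<inter> space M) x)"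
      using fin x by (intro sum.mono_neutral_right) (auto simp: indicator_def)
    with x show "\<phi> (h x) = (\<Sum>y\<in>h ` space M. \<phi> y * indicator (h -` {y} \<inter> space M) x)" by simp
  qed
  then show ?thesis using s by (simp add: nn_integral_sum nn_integral_cmult_indicator)
qed

section \<open>Laplace functionals and marking\<close>

context prob_space
begin

text \<open>The integral of a simple function is a combination of counts on its level sets. These
  are disjoint, so the counts are independent and the transform factors.\<close>

lemma poisson_pp_laplace_simple:
  assumes pp: "poisson_pp M \<mu> N"
    and nat: "\<And>A \<omega>. A \<in> sets \<mu> \<Longrightarrow> \<omega> \<in> space M \<Longrightarrow> nat_valued (emeasure (N \<omega>) A)"
    and h: "simple_function \<mu> h" and fin: "\<And>x. h x < \<top>"
  shows "(\<integral>\<^sup>+\<omega>. exp_neg (\<integral>\<^sup>+x. h x \<partial>N \<omega>) \<partial>M) = exp_neg (\<integral>\<^sup>+x. 1 - exp_neg (h x) \<partial>\<mu>)"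
    and "(\<lambda>\<omega>. exp_neg (\<integral>\<^sup>+x. h x \<partial>N \<omega>)) \<in> borel_measurable M"
proof -
  let ?A = "\<lambda>y. h -` {y} \<inter> space \<mu>" and ?H = "h ` space \<mu>"
  have finH: "finite ?H" and A: "\<And>y. ?A y \<in> sets \<mu>"
    using h simple_functionD by auto
  have setsN: "sets (N \<omega>) = sets \<mu>" if "\<omega> \<in> space M" for \<omega>
    using pp that by (auto simp: poisson_pp_def)
  have meas: "(\<lambda>\<omega>. emeasure (N \<omega>) B) \<in> borel_measurable M" if "B \<in> sets \<mu>" for B
    using pp that by (auto simp: poisson_pp_def)
  have int: "exp_neg (\<integral>\<^sup>+x. h x \<partial>N \<omega>) = (\<Prod>y\<in>?H. exp_neg (y * emeasure (N \<omega>) (?A y)))" if \<omega>: "\<omega> \<in> space M" for \<omega>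
  proof -
    have sp: "space (N \<omega>) = space \<mu>" using setsN[OF \<omega>] by (rule sets_eq_imp_space_eq)
    have "simple_function (N \<omega>) h"
      using h setsN[OF \<omega>] sp by (simp add: simple_function_def)
    from nn_integral_simple_compose[OF this, of "\<lambda>y. y"] show ?thesis
      by (simp add: exp_neg_sum sp)
  qed
  have "(\<lambda>\<omega>. \<Prod>y\<in>?H. exp_neg (y * emeasure (N \<omega>) (?A y))) \<in> borel_measurable M"
    using meas[OF A] by measurable
  then show "(\<lambda>\<omega>. exp_neg (\<integral>\<^sup>+x. h x \<partial>N \<omega>)) \<in> borel_measurable M"
    by (subst measurable_cong[OF int])
  \<comment> \<open>The level sets are numbered because \<open>poisson_pp\<close> states
    independence for initial segments of the natural numbers.\<close>
  obtain e where e: "bij_betw e {..<card ?H} ?H"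
    using ex_bij_betw_nat_finite[OF finH] by (auto simp: atLeast0LessThan)
  let ?n = "card ?H"
  have "indep_vars (\<lambda>_. borel) (\<lambda>i \<omega>. emeasure (N \<omega>) (?A (e i))) {..<?n}"
  proof -
    have "disjoint_family_on (\<lambda>i. ?A (e i)) {..<?n}"
      using e by (auto simp: disjoint_family_on_def bij_betw_def inj_on_def)
    moreover have "(\<lambda>i. ?A (e i)) ` {..<?n} \<subseteq> sets \<mu>" using A by auto
    moreover have "\<forall>(n::nat) A. A ` {..<n} \<subseteq> sets \<mu> \<and> disjoint_family_on A {..<n} \<longrightarrow>
        indep_vars (\<lambda>_. borel) (\<lambda>i \<omega>. emeasure (N \<omega>) (A i)) {..<n}"
      using pp unfolding poisson_pp_def by (elim conjE)
    ultimately show ?thesis by blast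
  qed
  then have ind: "indep_vars (\<lambda>_. borel) (\<lambda>i \<omega>. exp_neg (e i * emeasure (N \<omega>) (?A (e i)))) {..<?n}"
    by (rule indep_vars_compose2) simp
  have "(\<integral>\<^sup>+\<omega>. exp_neg (\<integral>\<^sup>+x. h x \<partial>N \<omega>) \<partial>M)
      = (\<integral>\<^sup>+\<omega>. (\<Prod>i<?n. exp_neg (e i * emeasure (N \<omega>) (?A (e i)))) \<partial>M)"
    by (intro nn_integral_cong, subst int, assumption, subst prod.reindex_bij_betw[OF e, symmetric]) simp
  also have "\<dots> = (\<Prod>i<?n. \<integral>\<^sup>+\<omega>. exp_neg (e i * emeasure (N \<omega>) (?A (e i))) \<partial>M)"
    by (rule indep_vars_nn_integral[OF _ ind]) auto
  also have "\<dots> = (\<Prod>i<?n. exp_neg ((1 - exp_neg (e i)) * emeasure \<mu> (?A (e i))))"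
  proof (rule prod.cong[OF refl])
    fix i assume "i \<in> {..<?n}"
    then have "e i \<in> ?H" using e by (auto simp: bij_betw_def)
    then have "e i \<noteq> \<top>" using fin by (auto simp: less_top)
    with A nat show "(\<integral>\<^sup>+\<omega>. exp_neg (e i * emeasure (N \<omega>) (?A (e i))) \<partial>M) = exp_neg ((1 - exp_neg (e i)) * emeasure \<mu> (?A (e i)))"
      by (intro poisson_pp_laplace_count[OF pp]) auto
  qed
  also have "\<dots> = (\<Prod>y\<in>?H. exp_neg ((1 - exp_neg y) * emeasure \<mu> (?A y)))"
    by (rule prod.reindex_bij_betw[OF e])
  also have "\<dots> = exp_neg (\<integral>\<^sup>+x. 1 - exp_neg (h x) \<partial>\<mu>)"
    unfolding nn_integral_simple_compose[OF h, of "\<lambda>y. 1 - exp_neg y"] exp_neg_sum ..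
  finally show "(\<integral>\<^sup>+\<omega>. exp_neg (\<integral>\<^sup>+x. h x \<partial>N \<omega>) \<partial>M) = exp_neg (\<integral>\<^sup>+x. 1 - exp_neg (h x) \<partial>\<mu>)" .
qed

text \<open>Simple functions increase to \<open>h\<close>, so the left integrands decrease and the
  exponent on the right increases. The decreasing limit is legitimate because all integrands are at
  most 1 on a probability space, and both limits are kept by \<open>exp_neg_SUP\<close> even if they
  are infinite.\<close>

lemma poisson_pp_laplace:
  assumes pp: "poisson_pp M \<mu> N"
    and nat: "\<And>A \<omega>. A \<in> sets \<mu> \<Longrightarrow> \<omega> \<in> space M \<Longrightarrow> nat_valued (emeasure (N \<omega>) A)"
    and h: "h \<in> borel_measurable \<mu>"
  shows "(\<integral>\<^sup>+\<omega>. exp_neg (\<integral>\<^sup>+x. h x \<partial>N \<omega>) \<partial>M) = exp_neg (\<integral>\<^sup>+x. 1 - exp_neg (h x) \<partial>\<mu>)"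
proof -
  from h obtain f where f: "\<And>i. simple_function \<mu> (f i)" "incseq f" "\<And>i x. f i x < \<top>"
    and hf: "\<And>x. (SUP i. f i x) = h x"
    by (rule borel_measurable_implies_simple_function_sequence') blast
  have fi: "incseq (\<lambda>i. f i x)" for x using f(2) by (auto simp: incseq_def le_fun_def)
  have fm: "f i \<in> borel_measurable \<mu>" for i using f(1) by (rule borel_measurable_simple_function)
  have "(\<integral>\<^sup>+\<omega>. exp_neg (\<integral>\<^sup>+x. h x \<partial>N \<omega>) \<partial>M) = (\<integral>\<^sup>+\<omega>. (INF i. exp_neg (\<integral>\<^sup>+x. f i x \<partial>N \<omega>)) \<partial>M)"
  proof (rule nn_integral_cong)
    fix \<omega> assume "\<omega> \<in> space M"
    then have "sets (N \<omega>) = sets \<mu>" using pp by (auto simp: poisson_pp_def)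
    then have fm': "f i \<in> borel_measurable (N \<omega>)" for i using fm[of i] by (simp cong: measurable_cong_sets)
    have "exp_neg (\<integral>\<^sup>+x. h x \<partial>N \<omega>) = exp_neg (SUP i. \<integral>\<^sup>+x. f i x \<partial>N \<omega>)"
      unfolding hf[symmetric] by (subst nn_integral_monotone_convergence_SUP[OF f(2) fm']) simp
    also have "\<dots> = (INF i. exp_neg (\<integral>\<^sup>+x. f i x \<partial>N \<omega>))"
      using f(2) by (intro exp_neg_SUP) (auto simp: incseq_def le_fun_def intro!: nn_integral_mono)
    finally show "exp_neg (\<integral>\<^sup>+x. h x \<partial>N \<omega>) = (INF i. exp_neg (\<integral>\<^sup>+x. f i x \<partial>N \<omega>))" .
  qed
  also have "\<dots> = (INF i. \<integral>\<^sup>+\<omega>. exp_neg (\<integral>\<^sup>+x. f i x \<partial>N \<omega>) \<partial>M)"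
  proof (rule nn_integral_monotone_convergence_INF_decseq)
    show "decseq (\<lambda>i \<omega>. exp_neg (\<integral>\<^sup>+x. f i x \<partial>N \<omega>))"
      unfolding decseq_def
      by (intro allI impI le_funI exp_neg_antimono nn_integral_mono incseqD[OF f(2), THEN le_funD])
    show "(\<lambda>\<omega>. exp_neg (\<integral>\<^sup>+x. f i x \<partial>N \<omega>)) \<in> borel_measurable M" for i
      by (rule poisson_pp_laplace_simple(2)[OF pp nat f(1,3)])
    have "(\<integral>\<^sup>+\<omega>. exp_neg (\<integral>\<^sup>+x. f 0 x \<partial>N \<omega>) \<partial>M) \<le> (\<integral>\<^sup>+\<omega>. 1 \<partial>M)"
      by (intro nn_integral_mono exp_neg_le_1)
    then show "(\<integral>\<^sup>+\<omega>. exp_neg (\<integral>\<^sup>+x. f 0 x \<partial>N \<omega>) \<partial>M) < \<infinity>"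
      by (auto simp: emeasure_space_1 intro: le_less_trans)
  qed
  also have "\<dots> = (INF i. exp_neg (\<integral>\<^sup>+x. 1 - exp_neg (f i x) \<partial>\<mu>))"
    by (subst poisson_pp_laplace_simple(1)[OF pp nat f(1,3)]) auto
  also have "\<dots> = exp_neg (SUP i. \<integral>\<^sup>+x. 1 - exp_neg (f i x) \<partial>\<mu>)"
    using f(2) by (intro exp_neg_SUP[symmetric])
      (auto simp: incseq_def le_fun_def intro!: nn_integral_mono ennreal_minus_mono exp_neg_antimono)
  also have "(SUP i. \<integral>\<^sup>+x. 1 - exp_neg (f i x) \<partial>\<mu>) = (\<integral>\<^sup>+x. (SUP i. 1 - exp_neg (f i x)) \<partial>\<mu>)"
    using f(2) fm by (intro nn_integral_monotone_convergence_SUP[symmetric])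
      (auto simp: incseq_def le_fun_def intro!: ennreal_minus_mono exp_neg_antimono)
  also have "\<dots> = (\<integral>\<^sup>+x. 1 - exp_neg (h x) \<partial>\<mu>)"
    by (simp add: SUP_const_minus_ennreal exp_neg_SUP[OF fi, symmetric] hf)
  finally show ?thesis .
qed

end

section \<open>Sums of Dirac measures at enumerated points\<close>

lemma nn_integral_dirac_sum:
  assumes X: "\<And>i. i \<in> I \<Longrightarrow> X i \<omega> \<in> space S" and h: "h \<in> borel_measurable S"
  shows "(\<integral>\<^sup>+x. h x \<partial>dirac_sum I S X \<omega>) = (\<integral>\<^sup>+i. h (X i \<omega>) \<partial>count_space I)"
  unfolding dirac_sum_def using X h by (subst nn_integral_distr) auto

lemma emeasure_dirac_sum:
  assumes X: "\<And>i. i \<in> I \<Longrightarrow> X i \<omega> \<in> space S" and A: "A \<in> sets S"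
  shows "emeasure (dirac_sum I S X \<omega>) A = (\<integral>\<^sup>+i. indicator A (X i \<omega>) \<partial>count_space I)"
  using nn_integral_dirac_sum[where X=X and \<omega>=\<omega> and h="indicator A", OF X] A
  by (simp add: dirac_sum_def)

lemma nat_valued_dirac_sum:
  assumes X: "\<And>i. i \<in> I \<Longrightarrow> X i \<omega> \<in> space S" and A: "A \<in> sets S"
  shows "nat_valued (emeasure (dirac_sum I S X \<omega>) A)"
proof -
  have "emeasure (dirac_sum I S X \<omega>) A = emeasure (count_space I) ((\<lambda>i. X i \<omega>) -` A \<inter> I)"
    unfolding dirac_sum_def using X A by (subst emeasure_distr) auto
  then show ?thesis by (auto simp: nat_valued_def emeasure_count_space)
qed

lemma sets_dirac_sum [simp]: "sets (dirac_sum I S X \<omega>) = sets S"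
  by (simp add: dirac_sum_def)

context prob_space
begin

lemma poisson_points_laplace:
  assumes pts: "poisson_points M I \<mu> X" and h: "h \<in> borel_measurable \<mu>"
  shows "(\<integral>\<^sup>+\<omega>. exp_neg (\<integral>\<^sup>+i. h (X i \<omega>) \<partial>count_space I) \<partial>M) = exp_neg (\<integral>\<^sup>+x. 1 - exp_neg (h x) \<partial>\<mu>)"
proof -
  have X: "X i \<omega> \<in> space \<mu>" if "i \<in> I" "\<omega> \<in> space M" for i \<omega>
    using pts that by (auto simp: poisson_points_def dest: measurable_space)
  have "(\<integral>\<^sup>+\<omega>. exp_neg (\<integral>\<^sup>+x. h x \<partial>dirac_sum I \<mu> X \<omega>) \<partial>M) = exp_neg (\<integral>\<^sup>+x. 1 - exp_neg (h x) \<partial>\<mu>)"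
    using pts X h by (intro poisson_pp_laplace nat_valued_dirac_sum) (auto simp: poisson_points_def)
  moreover have "(\<integral>\<^sup>+\<omega>. exp_neg (\<integral>\<^sup>+x. h x \<partial>dirac_sum I \<mu> X \<omega>) \<partial>M) = (\<integral>\<^sup>+\<omega>. exp_neg (\<integral>\<^sup>+i. h (X i \<omega>) \<partial>count_space I) \<partial>M)"
    using X h by (intro nn_integral_cong) (simp add: nn_integral_dirac_sum)
  ultimately show ?thesis by simp
qed

end

section \<open>Points with independent marks\<close>

lemma measurable_mono_domain:
  assumes f: "f \<in> G \<rightarrow>\<^sub>M S" and sp: "space G = space M" and sub: "sets G \<subseteq> sets M"
  shows "f \<in> M \<rightarrow>\<^sub>M S"
proof (rule measurableI)
  show "f x \<in> space S" if "x \<in> space M" for x using measurable_space[OF f] that sp by simp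
  show "f -` A \<inter> space M \<in> sets M" if "A \<in> sets S" for A
    using measurable_sets[OF f that] sub sp by auto
qed

context prob_space
begin

text \<open>The library notion of independence of two variables needs a common value type.\<close>
lemma indep_groups:
  assumes ind: "indep_sets F (I1 \<union> I2)" and disj: "I1 \<inter> I2 = {}"
    and st: "\<And>i. i \<in> I1 \<union> I2 \<Longrightarrow> Int_stable (F i)"
    and F: "\<And>i. i \<in> I1 \<union> I2 \<Longrightarrow> F i \<subseteq> Pow (space M)"
    and W: "W \<in> sigma (space M) (\<Union>i\<in>I1. F i) \<rightarrow>\<^sub>M S"
    and Y: "Y \<in> sigma (space M) (\<Union>i\<in>I2. F i) \<rightarrow>\<^sub>M T"
  shows "W \<in> M \<rightarrow>\<^sub>M S" "Y \<in> M \<rightarrow>\<^sub>M T"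
    "A \<in> sets S \<Longrightarrow> B \<in> sets T \<Longrightarrow> prob ((W -` A \<inter> space M) \<inter> (Y -` B \<inter> space M))
      = prob (W -` A \<inter> space M) * prob (Y -` B \<inter> space M)"
proof -
  have U: "(\<Union>b\<in>UNIV. case_bool I1 I2 b) = I1 \<union> I2" by (auto simp: UNIV_bool)
  have *: "indep_sets (\<lambda>b. sigma_sets (space M) (\<Union>i\<in>case_bool I1 I2 b. F i)) UNIV"
  proof (rule indep_sets_collect_sigma)
    show "indep_sets F (\<Union>b\<in>UNIV. case_bool I1 I2 b)" unfolding U by (rule ind)
    show "Int_stable (F i)" if "i \<in> case_bool I1 I2 b" for i b
      using that by (intro st) (cases b; simp)
    show "disjoint_family_on (case_bool I1 I2) UNIV"
      using disj by (auto simp: disjoint_family_on_def split: bool.splits)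
  qed
  have s1: "sets (sigma (space M) (\<Union>i\<in>I1. F i)) = sigma_sets (space M) (\<Union>i\<in>I1. F i)"
    and s2: "sets (sigma (space M) (\<Union>i\<in>I2. F i)) = sigma_sets (space M) (\<Union>i\<in>I2. F i)"
    using F by (auto intro!: sets_measure_of)
  have sub: "sigma_sets (space M) (\<Union>i\<in>I. F i) \<subseteq> events" if "I \<subseteq> I1 \<union> I2" for I
    using ind that by (intro sets.sigma_sets_subset) (auto simp: indep_sets_def)
  have sp: "space (sigma (space M) (\<Union>i\<in>I. F i)) = space M" if "I \<subseteq> I1 \<union> I2" for I
    using F that by (intro space_measure_of) auto
  show WM: "W \<in> M \<rightarrow>\<^sub>M S"
    by (rule measurable_mono_domain[OF W]) (use sp[of I1] s1 sub[of I1] in auto)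
  show YM: "Y \<in> M \<rightarrow>\<^sub>M T"
    by (rule measurable_mono_domain[OF Y]) (use sp[of I2] s2 sub[of I2] in auto)
  assume A: "A \<in> sets S" and B: "B \<in> sets T"
  have "W -` A \<inter> space M \<in> sigma_sets (space M) (\<Union>i\<in>I1. F i)"
    using measurable_sets[OF W A] unfolding s1 by (simp add: sp)
  moreover have "Y -` B \<inter> space M \<in> sigma_sets (space M) (\<Union>i\<in>I2. F i)"
    using measurable_sets[OF Y B] unfolding s2 by (simp add: sp)
  ultimately have "case_bool (W -` A \<inter> space M) (Y -` B \<inter> space M)
      \<in> Pi UNIV (\<lambda>b. sigma_sets (space M) (\<Union>i\<in>case_bool I1 I2 b. F i))"
    by (auto simp: Pi_iff split: bool.splits)
  then have "\<forall>b\<in>UNIV. case_bool (W -` A \<inter> space M) (Y -` B \<inter> space M) b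
      \<in> sigma_sets (space M) (\<Union>i\<in>case_bool I1 I2 b. F i)"
    by auto
  from indep_setsD[OF * subset_UNIV _ _ this]
  show "prob ((W -` A \<inter> space M) \<inter> (Y -` B \<inter> space M))
      = prob (W -` A \<inter> space M) * prob (Y -` B \<inter> space M)"
    by (simp add: UNIV_bool Int_commute mult.commute)
qed

text \<open>Independence makes the law of the pair a product, and Fubini then integrates
  \<open>Y\<close> out while \<open>W\<close> remains a random variable. In this form a mark is
  replaced by its average, given the points.\<close>

lemma nn_integral_indep_pair:
  assumes W [measurable]: "W \<in> M \<rightarrow>\<^sub>M S" and Y [measurable]: "Y \<in> M \<rightarrow>\<^sub>M T"
    and ind: "\<And>A B. A \<in> sets S \<Longrightarrow> B \<in> sets T \<Longrightarrow>
      prob ((W -` A \<inter> space M) \<inter> (Y -` B \<inter> space M))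
      = prob (W -` A \<inter> space M) * prob (Y -` B \<inter> space M)"
    and f: "f \<in> borel_measurable (S \<Otimes>\<^sub>M T)"
  shows "(\<integral>\<^sup>+\<omega>. f (W \<omega>, Y \<omega>) \<partial>M) = (\<integral>\<^sup>+\<omega>. (\<integral>\<^sup>+y. f (W \<omega>, y) \<partial>distr M T Y) \<partial>M)"
proof -
  interpret Y: prob_space "distr M T Y" by (rule prob_space_distr) simp
  interpret W: prob_space "distr M S W" by (rule prob_space_distr) simp
  have "sets (distr M S W \<Otimes>\<^sub>M distr M T Y) = sets (S \<Otimes>\<^sub>M T)"
    by (intro sets_pair_measure_cong) simp_all
  from measurable_cong_sets[OF this refl] f
  have f': "f \<in> borel_measurable (distr M S W \<Otimes>\<^sub>M distr M T Y)" by blast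
  have eq: "distr M S W \<Otimes>\<^sub>M distr M T Y = distr M (S \<Otimes>\<^sub>M T) (\<lambda>\<omega>. (W \<omega>, Y \<omega>))"
  proof (rule pair_measure_eqI)
    fix A B assume A: "A \<in> sets (distr M S W)" and B: "B \<in> sets (distr M T Y)"
    have "(\<lambda>\<omega>. (W \<omega>, Y \<omega>)) -` (A \<times> B) \<inter> space M = (W -` A \<inter> space M) \<inter> (Y -` B \<inter> space M)"
      by auto
    with ind[of A B] A B show "emeasure (distr M S W) A * emeasure (distr M T Y) B
        = emeasure (distr M (S \<Otimes>\<^sub>M T) (\<lambda>\<omega>. (W \<omega>, Y \<omega>))) (A \<times> B)"
      by (simp add: emeasure_distr emeasure_eq_measure ennreal_mult)
  qed (simp_all add: Y.sigma_finite_measure_axioms W.sigma_finite_measure_axioms)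
  have "(\<integral>\<^sup>+\<omega>. f (W \<omega>, Y \<omega>) \<partial>M) = (\<integral>\<^sup>+z. f z \<partial>distr M (S \<Otimes>\<^sub>M T) (\<lambda>\<omega>. (W \<omega>, Y \<omega>)))"
    using f by (subst nn_integral_distr) auto
  also have "\<dots> = (\<integral>\<^sup>+z. f z \<partial>(distr M S W \<Otimes>\<^sub>M distr M T Y))"
    by (simp only: eq)
  also have "\<dots> = (\<integral>\<^sup>+w. (\<integral>\<^sup>+y. f (w, y) \<partial>distr M T Y) \<partial>distr M S W)"
    by (rule Y.nn_integral_fst[OF f', symmetric])
  also have "\<dots> = (\<integral>\<^sup>+\<omega>. (\<integral>\<^sup>+y. f (W \<omega>, y) \<partial>distr M T Y) \<partial>M)"
    using Y.borel_measurable_nn_integral_fst[OF f'] by (subst nn_integral_distr) auto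
  finally show ?thesis .
qed

lemma measurable_points_sigma:
  assumes X: "\<And>i. i \<in> I \<Longrightarrow> X i \<in> M \<rightarrow>\<^sub>M \<mu>" and i: "i \<in> I"
    and sub: "points_sigma M I \<mu> X \<subseteq> sets G" and sp: "space G = space M"
  shows "X i \<in> G \<rightarrow>\<^sub>M \<mu>"
proof -
  let ?f = "\<lambda>\<omega>. \<lambda>i\<in>I. X i \<omega>"
  have "?f \<in> vimage_algebra (space M) ?f (PiM I (\<lambda>_. \<mu>)) \<rightarrow>\<^sub>M PiM I (\<lambda>_. \<mu>)"
    using measurable_space[OF X] by (intro measurable_vimage_algebra1) (auto simp: space_PiM)
  then have "(\<lambda>\<omega>. ?f \<omega> i) \<in> vimage_algebra (space M) ?f (PiM I (\<lambda>_. \<mu>)) \<rightarrow>\<^sub>M \<mu>"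
    by (rule measurable_compose[OF _ measurable_component_singleton[OF i]])
  then have "X i \<in> vimage_algebra (space M) ?f (PiM I (\<lambda>_. \<mu>)) \<rightarrow>\<^sub>M \<mu>" using i by simp
  then show ?thesis
    by (rule measurable_mono_domain) (use sub sp in \<open>auto simp: points_sigma_def generated_by_def\<close>)
qed

text \<open>Averaging over the mark of a point at \<open>x\<close> replaces its factor by
  \<open>\<phi> x\<close>. The points themselves are dependent, so the product of the
  \<open>\<phi> (X i \<omega>)\<close> does not factor; it is recognised instead as the Laplace
  functional of the unmarked process at \<open>neg_ln (\<phi> x)\<close>, which is known.\<close>

lemma marked_laplace:
  assumes pts: "poisson_points M UNIV \<mu> X"
    and \<nu>: "prob_space \<nu>"
    and Y: "\<And>i::nat. Y i \<in> M \<rightarrow>\<^sub>M \<nu>" and law: "\<And>i. distr M \<nu> (Y i) = \<nu>"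
    and ind: "indep_sets (\<lambda>k. case k of None \<Rightarrow> points_sigma M UNIV \<mu> X
        | Some i \<Rightarrow> {Y i -` A \<inter> space M |A. A \<in> sets \<nu>}) UNIV"
    and g [measurable]: "g \<in> borel_measurable (\<mu> \<Otimes>\<^sub>M \<nu>)"
  shows "(\<integral>\<^sup>+\<omega>. exp_neg (\<integral>\<^sup>+i. g (X i \<omega>, Y i \<omega>) \<partial>count_space UNIV) \<partial>M)
    = exp_neg (\<integral>\<^sup>+z. 1 - exp_neg (g z) \<partial>(\<mu> \<Otimes>\<^sub>M \<nu>))"
proof -
  interpret \<nu>: prob_space \<nu> by fact
  define F where "F = (\<lambda>k. case k of None \<Rightarrow> points_sigma M UNIV \<mu> X
        | Some i \<Rightarrow> {Y i -` A \<inter> space M |A. A \<in> sets \<nu>})"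
  have F_None: "F None = points_sigma M UNIV \<mu> X"
    and F_Some: "\<And>i. F (Some i) = {Y i -` A \<inter> space M |A. A \<in> sets \<nu>}"
    by (simp_all add: F_def)
  have indF: "indep_sets F UNIV" unfolding F_def by (rule ind)
  have X [measurable]: "X i \<in> M \<rightarrow>\<^sub>M \<mu>" for i using pts by (auto simp: poisson_points_def)
  note Y [measurable]
  define \<phi> where "\<phi> x = (\<integral>\<^sup>+y. exp_neg (g (x, y)) \<partial>\<nu>)" for x
  have \<phi>m [measurable]: "\<phi> \<in> borel_measurable \<mu>"
    unfolding \<phi>_def by measurable
  have \<phi>1: "\<phi> x \<le> 1" for x
  proof -
    have "\<phi> x \<le> (\<integral>\<^sup>+y. 1 \<partial>\<nu>)" unfolding \<phi>_def by (intro nn_integral_mono exp_neg_le_1)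
    then show ?thesis by (simp add: \<nu>.emeasure_space_1)
  qed
  \<comment> \<open>the mark \<open>Y k\<close> is independent of all points and of the earlier marks, so it can be integrated out\<close>
  have step: "(\<integral>\<^sup>+\<omega>. (\<Prod>i<k. exp_neg (g (X i \<omega>, Y i \<omega>))) * (\<Prod>i\<in>{k..<n}. \<phi> (X i \<omega>)) \<partial>M)
      = (\<integral>\<^sup>+\<omega>. (\<Prod>i<Suc k. exp_neg (g (X i \<omega>, Y i \<omega>))) * (\<Prod>i\<in>{Suc k..<n}. \<phi> (X i \<omega>)) \<partial>M)"
    if k: "k < n" for k n
  proof -
    let ?I = "insert None (Some ` {..<k})"
    let ?G = "sigma (space M) (\<Union>i\<in>?I. F i)" and ?G' = "sigma (space M) (\<Union>i\<in>{Some k}. F i)"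
    define Z where "Z \<omega> = (\<Prod>i<k. exp_neg (g (X i \<omega>, Y i \<omega>))) * (\<Prod>i\<in>{Suc k..<n}. \<phi> (X i \<omega>))" for \<omega>
    have Fev: "F i \<subseteq> events" for i
      using indF unfolding indep_sets_def by blast
    have Fsub: "F i \<subseteq> Pow (space M)" for i
      using Fev[of i] sets.space_closed[of M] by (rule subset_trans)
    have setsG: "sets (sigma (space M) (\<Union>i\<in>I. F i)) = sigma_sets (space M) (\<Union>i\<in>I. F i)"
      and spG: "space (sigma (space M) (\<Union>i\<in>I. F i)) = space M" for I
      using UN_least[of I F, OF Fsub] by (simp_all add: sets_measure_of space_measure_of)
    have sub: "F i \<subseteq> sets (sigma (space M) (\<Union>i\<in>I. F i))" if "i \<in> I" for i I
      using that unfolding setsG by (intro subsetI sigma_sets.Basic UN_I)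
    have XG [measurable]: "X i \<in> ?G \<rightarrow>\<^sub>M \<mu>" for i
      by (rule measurable_points_sigma[where I=UNIV and X=X and \<mu>=\<mu>])
        (use X sub[of None ?I] spG[of ?I] F_None in simp_all)
    have YI: "Y i \<in> sigma (space M) (\<Union>i\<in>I. F i) \<rightarrow>\<^sub>M \<nu>" if "Some i \<in> I" for i I
    proof (rule measurableI)
      show "Y i -` A \<inter> space (sigma (space M) (\<Union>i\<in>I. F i)) \<in> sets (sigma (space M) (\<Union>i\<in>I. F i))"
        if "A \<in> sets \<nu>" for A
        using sub[OF \<open>Some i \<in> I\<close>] that unfolding F_Some spG by blast
    qed (use spG measurable_space[OF Y] in simp)
    have YG [measurable]: "Y i \<in> ?G \<rightarrow>\<^sub>M \<nu>" if "i \<in> {..<k}" for i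
      using that by (intro YI) auto
    have Zm: "Z \<in> borel_measurable ?G"
      unfolding Z_def by measurable
    have g1: "indep_sets F (?I \<union> {Some k})" by (rule indep_sets_mono_index[OF _ indF]) auto
    have g2: "Int_stable (F i)" for i
      proof (cases i)
        case None
        then show ?thesis by (simp add: F_None points_sigma_def generated_by_def sets.Int_stable)
      next
        case (Some j)
        have "\<exists>C. (Y j -` A \<inter> space M) \<inter> (Y j -` B \<inter> space M) = Y j -` C \<inter> space M \<and> C \<in> sets \<nu>"
          if "A \<in> sets \<nu>" "B \<in> sets \<nu>" for A B
          using that by (intro exI[of _ "A \<inter> B"]) auto
        with Some show ?thesis by (auto simp: Int_stable_def F_Some)
      qed
    have g3: "(\<lambda>\<omega>. (X k \<omega>, Z \<omega>)) \<in> ?G \<rightarrow>\<^sub>M \<mu> \<Otimes>\<^sub>M borel" using Zm XG by measurable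
    have g4: "Y k \<in> ?G' \<rightarrow>\<^sub>M \<nu>" by (rule YI) simp
    have g0: "?I \<inter> {Some k} = {}" by auto
    note ind_XZ = indep_groups[OF g1 g0 g2 Fsub g3 g4]
    have h: "(\<lambda>p. snd (fst p) * exp_neg (g (fst (fst p), snd p))) \<in> borel_measurable ((\<mu> \<Otimes>\<^sub>M borel) \<Otimes>\<^sub>M \<nu>)"
      by measurable
    from nn_integral_indep_pair[where W="\<lambda>\<omega>. (X k \<omega>, Z \<omega>)" and Y="Y k" and S="\<mu> \<Otimes>\<^sub>M borel" and T=\<nu>
        and f="\<lambda>p. snd (fst p) * exp_neg (g (fst (fst p), snd p))", OF ind_XZ(1) ind_XZ(2) ind_XZ(3) h]
    have "(\<integral>\<^sup>+\<omega>. Z \<omega> * exp_neg (g (X k \<omega>, Y k \<omega>)) \<partial>M) = (\<integral>\<^sup>+\<omega>. (\<integral>\<^sup>+y. Z \<omega> * exp_neg (g (X k \<omega>, y)) \<partial>\<nu>) \<partial>M)"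
      by (simp only: law fst_conv snd_conv)
    also have "\<dots> = (\<integral>\<^sup>+\<omega>. Z \<omega> * \<phi> (X k \<omega>) \<partial>M)"
    proof (rule nn_integral_cong)
      fix \<omega> assume "\<omega> \<in> space M"
      then have [measurable]: "X k \<omega> \<in> space \<mu>" using X by (rule measurable_space[rotated])
      show "(\<integral>\<^sup>+y. Z \<omega> * exp_neg (g (X k \<omega>, y)) \<partial>\<nu>) = Z \<omega> * \<phi> (X k \<omega>)"
        unfolding \<phi>_def by (rule nn_integral_cmult) measurable
    qed
    finally have "(\<integral>\<^sup>+\<omega>. Z \<omega> * \<phi> (X k \<omega>) \<partial>M) = (\<integral>\<^sup>+\<omega>. Z \<omega> * exp_neg (g (X k \<omega>, Y k \<omega>)) \<partial>M)" ..
    moreover have "{k..<n} = insert k {Suc k..<n}" using k by auto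
    ultimately show ?thesis
      by (simp add: Z_def mult_ac lessThan_Suc)
  qed
  \<comment> \<open>Exchanging one mark at a time joins the product with all marks averaged,
    \<open>k = 0\<close>, to the product with all marks present, \<open>k = n\<close>.\<close>
  have hyb: "(\<integral>\<^sup>+\<omega>. (\<Prod>i<n. \<phi> (X i \<omega>)) \<partial>M) = (\<integral>\<^sup>+\<omega>. (\<Prod>i<n. exp_neg (g (X i \<omega>, Y i \<omega>))) \<partial>M)" for n
  proof -
    have "(\<integral>\<^sup>+\<omega>. (\<Prod>i<n. \<phi> (X i \<omega>)) \<partial>M)
        = (\<integral>\<^sup>+\<omega>. (\<Prod>i<k. exp_neg (g (X i \<omega>, Y i \<omega>))) * (\<Prod>i\<in>{k..<n}. \<phi> (X i \<omega>)) \<partial>M)" if "k \<le> n" for k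
      using that
    proof (induction k)
      case 0 then show ?case by (simp add: atLeast0LessThan)
    next
      case (Suc k) then show ?case using step[of k n] by simp
    qed
    from this[of n] show ?thesis by simp
  qed
  \<comment> \<open>Factors at most 1 make the partial products decrease from 1, so an infinite
    product may be integrated as the infimum of finite ones.\<close>
  have lim: "(\<integral>\<^sup>+\<omega>. (INF n. \<Prod>i<n. f i \<omega>) \<partial>M) = (INF n. \<integral>\<^sup>+\<omega>. (\<Prod>i<n. f i \<omega>) \<partial>M)"
    if f: "\<And>i. f i \<in> borel_measurable M" and f1: "\<And>i \<omega>. f i \<omega> \<le> 1" for f :: "nat \<Rightarrow> 'a \<Rightarrow> ennreal"
  proof (rule nn_integral_monotone_convergence_INF_decseq)
    have "(\<Prod>i<Suc n. f i \<omega>) \<le> (\<Prod>i<n. f i \<omega>)" for n \<omega>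
      using mult_right_mono[OF f1[of n \<omega>], of "\<Prod>i<n. f i \<omega>"] by (simp add: mult.commute)
    then show "decseq (\<lambda>n \<omega>. \<Prod>i<n. f i \<omega>)"
      by (intro decseq_SucI le_funI)
    show "(\<integral>\<^sup>+\<omega>. (\<Prod>i<0. f i \<omega>) \<partial>M) < \<infinity>" by (simp add: emeasure_space_1)
  qed (use f in measurable)
  have "(\<integral>\<^sup>+\<omega>. exp_neg (\<integral>\<^sup>+i. g (X i \<omega>, Y i \<omega>) \<partial>count_space UNIV) \<partial>M)
      = (\<integral>\<^sup>+\<omega>. (INF n. \<Prod>i<n. exp_neg (g (X i \<omega>, Y i \<omega>))) \<partial>M)"
    by (simp add: nn_integral_count_space_nat exp_neg_suminf)
  also have "\<dots> = (INF n. \<integral>\<^sup>+\<omega>. (\<Prod>i<n. \<phi> (X i \<omega>)) \<partial>M)"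
    unfolding hyb by (rule lim) (auto simp: exp_neg_le_1)
  \<comment> \<open>In this form the infinite product over the points is again
    \<open>exp_neg\<close> of a sum.\<close>
  also have "\<dots> = (\<integral>\<^sup>+\<omega>. (INF n. \<Prod>i<n. exp_neg (neg_ln (\<phi> (X i \<omega>)))) \<partial>M)"
    unfolding exp_neg_neg_ln[OF \<phi>1] by (rule lim[symmetric]) (auto simp: \<phi>1)
  also have "\<dots> = (\<integral>\<^sup>+\<omega>. exp_neg (\<integral>\<^sup>+i. neg_ln (\<phi> (X i \<omega>)) \<partial>count_space UNIV) \<partial>M)"
    by (simp add: nn_integral_count_space_nat exp_neg_suminf)
  also have "\<dots> = exp_neg (\<integral>\<^sup>+x. 1 - \<phi> x \<partial>\<mu>)"
    by (subst poisson_points_laplace[OF pts]) (auto simp: exp_neg_neg_ln[OF \<phi>1])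
  also have "(\<integral>\<^sup>+x. 1 - \<phi> x \<partial>\<mu>) = (\<integral>\<^sup>+x. (\<integral>\<^sup>+y. 1 - exp_neg (g (x, y)) \<partial>\<nu>) \<partial>\<mu>)"
  proof (rule nn_integral_cong)
    fix x assume [measurable]: "x \<in> space \<mu>"
    have "(\<integral>\<^sup>+y. 1 - exp_neg (g (x, y)) \<partial>\<nu>) = (\<integral>\<^sup>+y. 1 \<partial>\<nu>) - (\<integral>\<^sup>+y. exp_neg (g (x, y)) \<partial>\<nu>)"
      using \<phi>1[of x] by (intro nn_integral_diff) (auto simp: exp_neg_le_1 \<phi>_def top_unique)
    then show "1 - \<phi> x = (\<integral>\<^sup>+y. 1 - exp_neg (g (x, y)) \<partial>\<nu>)"
      by (simp add: \<phi>_def \<nu>.emeasure_space_1)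
  qed
  also have "\<dots> = (\<integral>\<^sup>+z. 1 - exp_neg (g z) \<partial>(\<mu> \<Otimes>\<^sub>M \<nu>))"
    by (rule \<nu>.nn_integral_fst) measurable
  finally show ?thesis .
qed

end

section \<open>Measurability of the path maps\<close>

text \<open>
  Evaluation at a random time is measurable only on regular paths, so the marks are taken in these
  subspaces of the product space.
\<close>
definition cadlag_paths :: "(real \<Rightarrow> ereal) measure" where
  "cadlag_paths = restrict_space (path_space {0..}) {f. cadlag_on {0..} f}"

definition caglad_paths :: "(real \<Rightarrow> ereal) measure" where
  "caglad_paths = restrict_space (path_space {0..}) {f. caglad_on {0..} f}"

section \<open>Regularity of born, dying and shifted paths\<close>

lemma interior_nonneg: "interior {0::real..} = {0<..}"
  by (rule interior_real_atLeast)

lemma cadlag_onD: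
  assumes "cadlag_on T f"
  shows "t \<in> T \<Longrightarrow> f t \<noteq> \<infinity>" "t \<in> T \<Longrightarrow> (f \<longlongrightarrow> f t) (at_right t)"
    "t \<in> interior T \<Longrightarrow> \<exists>l. l \<noteq> \<infinity> \<and> (f \<longlongrightarrow> l) (at_left t)"
  using assms by (auto simp: cadlag_on_def)

lemma caglad_onD:
  assumes "caglad_on T f"
  shows "t \<in> T \<Longrightarrow> f t \<noteq> \<infinity>" "t \<in> interior T \<Longrightarrow> (f \<longlongrightarrow> f t) (at_left t)"
    "t \<in> T \<Longrightarrow> \<exists>l. l \<noteq> \<infinity> \<and> (f \<longlongrightarrow> l) (at_right t)"
  using assms by (auto simp: caglad_on_def)

lemma eventually_restrict_at_right: "0 \<le> (t::real) \<Longrightarrow> \<forall>\<^sub>F x in at_right t. restrict f {0..} x = f x"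
  by (auto simp: eventually_at_filter)

lemma eventually_restrict_at_left: "0 < (t::real) \<Longrightarrow> \<forall>\<^sub>F x in at_left t. restrict f {0..} x = f x"
  using eventually_at_left_real[of 0 t] by (auto elim: eventually_mono)

lemma cadlag_on_restrict: "cadlag_on {0..} f \<Longrightarrow> cadlag_on {0..} (restrict f {0..})"
  unfolding cadlag_on_def interior_nonneg
  by (auto simp: tendsto_cong[OF eventually_restrict_at_right] tendsto_cong[OF eventually_restrict_at_left])

lemma caglad_on_restrict: "caglad_on {0..} f \<Longrightarrow> caglad_on {0..} (restrict f {0..})"
  unfolding caglad_on_def interior_nonneg
  by (auto simp: tendsto_cong[OF eventually_restrict_at_right] tendsto_cong[OF eventually_restrict_at_left])

lemma tendsto_ereal_add_left:
  fixes g :: "real \<Rightarrow> ereal"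
  shows "(g \<longlongrightarrow> l) F \<Longrightarrow> ((\<lambda>x. ereal c + g x) \<longlongrightarrow> ereal c + l) F"
  by (rule tendsto_add_ereal_general2) auto

lemma filterlim_shift_right: "filterlim (\<lambda>x. x - s) (at_right (t - s)) (at_right (t::real))"
  unfolding filterlim_at by (auto simp: eventually_at_filter intro!: tendsto_intros)

lemma filterlim_shift_left: "filterlim (\<lambda>x. x - s) (at_left (t - s)) (at_left (t::real))"
  unfolding filterlim_at by (auto simp: eventually_at_filter intro!: tendsto_intros)

lemma filterlim_reflect_right: "filterlim (\<lambda>x. s - x) (at_left (s - t)) (at_right (t::real))"
  unfolding filterlim_at by (auto simp: eventually_at_filter intro!: tendsto_intros)

lemma filterlim_reflect_left: "filterlim (\<lambda>x. s - x) (at_right (s - t)) (at_left (t::real))"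
  unfolding filterlim_at by (auto simp: eventually_at_filter intro!: tendsto_intros)

text \<open>The only new time is the birth: the left limit there is \<open>- \<infinity>\<close>,
  and right-continuity comes from that of \<open>f\<close> at 0.\<close>

lemma cadlag_birth_path:
  assumes f: "cadlag_on {0..} f"
  shows "cadlag_on UNIV (birth_path p f)"
proof -
  let ?s = "fst p" and ?v = "snd p"
  have "birth_path p f t \<noteq> \<infinity>" for t
    using cadlag_onD(1)[OF f, of "t - ?s"] by (auto simp: birth_path_def)
  moreover have "(birth_path p f \<longlongrightarrow> birth_path p f t) (at_right t)" for t
  proof (cases "t < ?s")
    case True
    have "\<forall>\<^sub>F x in at_right t. birth_path p f x = -\<infinity>"
      using eventually_at_right_real[OF True] by eventually_elim (auto simp: birth_path_def)
    then show ?thesis using True by (simp add: tendsto_eventually birth_path_def)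
  next
    case False
    then have "(f \<longlongrightarrow> f (t - ?s)) (at_right (t - ?s))" using cadlag_onD(2)[OF f] by simp
    then have "((\<lambda>x. ereal ?v + f (x - ?s)) \<longlongrightarrow> ereal ?v + f (t - ?s)) (at_right t)"
      by (intro tendsto_ereal_add_left filterlim_compose[OF _ filterlim_shift_right])
    moreover have "\<forall>\<^sub>F x in at_right t. ereal ?v + f (x - ?s) = birth_path p f x"
      using False by (auto simp: birth_path_def eventually_at_filter)
    ultimately have "(birth_path p f \<longlongrightarrow> ereal ?v + f (t - ?s)) (at_right t)"
      by (rule Lim_transform_eventually)
    then show ?thesis using False by (simp add: birth_path_def)
  qed
  moreover have "\<exists>l. l \<noteq> \<infinity> \<and> (birth_path p f \<longlongrightarrow> l) (at_left t)" for t
  proof (cases "t \<le> ?s")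
    case True
    then have "\<forall>\<^sub>F x in at_left t. birth_path p f x = -\<infinity>"
      by (auto simp: birth_path_def eventually_at_filter)
    then show ?thesis by (intro exI[of _ "-\<infinity>"]) (simp add: tendsto_eventually)
  next
    case False
    then obtain l where l: "l \<noteq> \<infinity>" "(f \<longlongrightarrow> l) (at_left (t - ?s))"
      using cadlag_onD(3)[OF f, of "t - ?s"] by (auto simp: interior_nonneg)
    then have "((\<lambda>x. ereal ?v + f (x - ?s)) \<longlongrightarrow> ereal ?v + l) (at_left t)"
      by (intro tendsto_ereal_add_left filterlim_compose[OF _ filterlim_shift_left])
    moreover have "\<forall>\<^sub>F x in at_left t. ereal ?v + f (x - ?s) = birth_path p f x"
      using eventually_at_left_real[of ?s t] False
      by (auto elim!: eventually_mono simp: birth_path_def)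
    ultimately have "(birth_path p f \<longlongrightarrow> ereal ?v + l) (at_left t)"
      by (rule Lim_transform_eventually)
    then show ?thesis using l(1) by (intro exI[of _ "ereal ?v + l"]) (cases l; simp)
  qed
  ultimately show ?thesis by (simp add: cadlag_on_def)
qed

text \<open>Time reversal exchanges the two one-sided limits, which is why the backward paths are
  left-continuous with right limits. A dying path reads \<open>f\<close> at positive times only,
  where left-continuity is meaningful; the right limit of \<open>f\<close> at 0 becomes the left
  limit at the death time.\<close>

lemma cadlag_death_path:
  assumes f: "caglad_on {0..} f"
  shows "cadlag_on UNIV (death_path p f)"
proof -
  let ?s = "fst p" and ?v = "snd p"
  have "death_path p f t \<noteq> \<infinity>" for t
    using caglad_onD(1)[OF f, of "?s - t"] by (auto simp: death_path_def)
  moreover have "(death_path p f \<longlongrightarrow> death_path p f t) (at_right t)" for t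
  proof (cases "t < ?s")
    case False
    then have "\<forall>\<^sub>F x in at_right t. death_path p f x = -\<infinity>"
      by (auto simp: death_path_def eventually_at_filter)
    then show ?thesis using False by (simp add: tendsto_eventually death_path_def)
  next
    case True
    then have "(f \<longlongrightarrow> f (?s - t)) (at_left (?s - t))"
      using caglad_onD(2)[OF f] by (simp add: interior_nonneg)
    then have "((\<lambda>x. ereal ?v + f (?s - x)) \<longlongrightarrow> ereal ?v + f (?s - t)) (at_right t)"
      by (intro tendsto_ereal_add_left filterlim_compose[OF _ filterlim_reflect_right])
    moreover have "\<forall>\<^sub>F x in at_right t. ereal ?v + f (?s - x) = death_path p f x"
      using eventually_at_right_real[OF True] by eventually_elim (auto simp: death_path_def)
    ultimately have "(death_path p f \<longlongrightarrow> ereal ?v + f (?s - t)) (at_right t)"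
      by (rule Lim_transform_eventually)
    then show ?thesis using True by (simp add: death_path_def)
  qed
  moreover have "\<exists>l. l \<noteq> \<infinity> \<and> (death_path p f \<longlongrightarrow> l) (at_left t)" for t
  proof (cases "t \<le> ?s")
    case False
    then have "?s < t" by simp
    have "\<forall>\<^sub>F x in at_left t. death_path p f x = -\<infinity>"
      using eventually_at_left_real[OF \<open>?s < t\<close>] by eventually_elim (auto simp: death_path_def)
    then show ?thesis by (intro exI[of _ "-\<infinity>"]) (simp add: tendsto_eventually)
  next
    case True
    then obtain l where l: "l \<noteq> \<infinity>" "(f \<longlongrightarrow> l) (at_right (?s - t))"
      using caglad_onD(3)[OF f, of "?s - t"] by auto
    then have "((\<lambda>x. ereal ?v + f (?s - x)) \<longlongrightarrow> ereal ?v + l) (at_left t)"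
      by (intro tendsto_ereal_add_left filterlim_compose[OF _ filterlim_reflect_left])
    moreover have "\<forall>\<^sub>F x in at_left t. ereal ?v + f (?s - x) = death_path p f x"
      using True by (auto simp: death_path_def eventually_at_filter)
    ultimately have "(death_path p f \<longlongrightarrow> ereal ?v + l) (at_left t)"
      by (rule Lim_transform_eventually)
    then show ?thesis using l(1) by (intro exI[of _ "ereal ?v + l"]) (cases l; simp)
  qed
  ultimately show ?thesis by (simp add: cadlag_on_def)
qed

lemma cadlag_shift_path:
  assumes f: "cadlag_on UNIV f"
  shows "cadlag_on UNIV (shift_path u f)"
  unfolding cadlag_on_def interior_UNIV shift_path_def
proof (intro conjI ballI)
  fix t
  show "ereal u + f t \<noteq> \<infinity>" using cadlag_onD(1)[OF f, of t] by auto
  show "((\<lambda>t. ereal u + f t) \<longlongrightarrow> ereal u + f t) (at_right t)"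
    by (intro tendsto_ereal_add_left cadlag_onD(2)[OF f]) simp
  obtain l where l: "l \<noteq> \<infinity>" "(f \<longlongrightarrow> l) (at_left t)"
    using cadlag_onD(3)[OF f, of t] by auto
  then show "\<exists>l. l \<noteq> \<infinity> \<and> ((\<lambda>t. ereal u + f t) \<longlongrightarrow> l) (at_left t)"
    by (intro exI[of _ "ereal u + l"] conjI tendsto_ereal_add_left) (cases l; simp)
qed

section \<open>Evaluation of regular paths at random times\<close>

lemma measurable_eval_restrict:
  "t \<in> T \<Longrightarrow> (\<lambda>f. f t) \<in> borel_measurable (restrict_space (path_space T) \<Omega>)"
  by (intro measurable_restrict_space1 measurable_component_singleton) auto

text \<open>The floor plus 1, rather than the ceiling, keeps the grid point strictly to the right of
  \<open>s\<close>, as \<open>at_right\<close> demands even when \<open>s\<close> lies on the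
  grid.\<close>

lemma tendsto_floor_right:
  fixes s :: real
  shows "filterlim (\<lambda>n. (of_int \<lfloor>real (Suc n) * s\<rfloor> + 1) / real (Suc n)) (at_right s) sequentially"
proof -
  let ?r = "\<lambda>n. (of_int \<lfloor>real (Suc n) * s\<rfloor> + 1) / real (Suc n)"
  have lo: "s < ?r n" for n
    using floor_less_iff real_of_int_floor_add_one_gt[of "real (Suc n) * s"]
    by (simp add: pos_less_divide_eq mult.commute)
  have up: "?r n \<le> s + inverse (real (Suc n))" for n
    using of_int_floor_le[of "real (Suc n) * s"] by (simp add: field_simps del: of_nat_Suc)
  have "?r \<longlonglongrightarrow> s"
  proof (rule real_tendsto_sandwich[where f="\<lambda>_. s" and h="\<lambda>n. s + inverse (real (Suc n))"])
    show "(\<lambda>n. s + inverse (real (Suc n))) \<longlonglongrightarrow> s"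
      by (rule LIMSEQ_inverse_real_of_nat_add)
    show "\<forall>\<^sub>F n in sequentially. s \<le> ?r n" by (intro always_eventually allI less_imp_le lo)
    show "\<forall>\<^sub>F n in sequentially. ?r n \<le> s + inverse (real (Suc n))" by (intro always_eventually allI up)
  qed simp
  moreover have "?r n \<in> {s<..} \<and> ?r n \<noteq> s" for n using lo[of n] by (simp del: of_nat_Suc)
  ultimately show ?thesis
    by (simp only: filterlim_at eventually_True simp_thms)
qed

lemma tendsto_ceiling_left:
  fixes s :: real
  shows "filterlim (\<lambda>n. (of_int \<lceil>real (Suc n) * s\<rceil> - 1) / real (Suc n)) (at_left s) sequentially"
proof -
  have "filterlim (\<lambda>n. - ((of_int \<lfloor>real (Suc n) * - s\<rfloor> + 1) / real (Suc n))) (at_left s) sequentially"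
    by (rule filterlim_compose[OF _ tendsto_floor_right]) (simp add: filterlim_def at_left_minus)
  moreover have "- ((of_int \<lfloor>real (Suc n) * - s\<rfloor> + 1) / real (Suc n))
      = (of_int \<lceil>real (Suc n) * s\<rceil> - 1) / real (Suc n)" for n
    by (simp add: ceiling_def minus_divide_left del: of_nat_Suc)
  ultimately show ?thesis by simp
qed

text \<open>By right-continuity the value at \<open>s\<close> is the limit of the values at grid
  times to its right, and at each stage the time takes countably many values. The maximum with 0
  keeps all times in the domain of the paths.\<close>

lemma measurable_eval_cadlag:
  "(\<lambda>(s, f). f (max 0 s)) \<in> borel_measurable (borel \<Otimes>\<^sub>M cadlag_paths)"
proof (rule borel_measurable_LIMSEQ_order)
  let ?r = "\<lambda>n s. (of_int \<lfloor>real (Suc n) * max 0 s\<rfloor> + 1) / real (Suc n)"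
  fix n
  show "(\<lambda>(s, f). f (max 0 (?r n s))) \<in> borel_measurable (borel \<Otimes>\<^sub>M cadlag_paths)"
  proof -
    have "(\<lambda>x. snd x (max 0 ((of_int i + 1) / real (Suc n)))) \<in> borel_measurable (borel \<Otimes>\<^sub>M cadlag_paths)" for i :: int
      unfolding cadlag_paths_def
      by (intro measurable_compose[OF measurable_snd measurable_eval_restrict]) simp
    from measurable_compose_countable[where f="\<lambda>i x. snd x (max 0 ((of_int i + 1) / real (Suc n)))"
        and g="\<lambda>x. \<lfloor>real (Suc n) * max 0 (fst x)\<rfloor>", OF this]
    show ?thesis by (simp add: split_beta')
  qed
next
  fix x :: "real \<times> (real \<Rightarrow> ereal)" assume "x \<in> space (borel \<Otimes>\<^sub>M cadlag_paths)"
  then obtain s f where x: "x = (s, f)" and f: "cadlag_on {0..} f"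
    by (auto simp: space_pair_measure cadlag_paths_def space_restrict_space)
  let ?r = "\<lambda>n. (of_int \<lfloor>real (Suc n) * max 0 s\<rfloor> + 1) / real (Suc n)"
  have "(f \<longlongrightarrow> f (max 0 s)) (at_right (max 0 s))" using cadlag_onD(2)[OF f] by simp
  from filterlim_compose[OF this tendsto_floor_right]
  have "(\<lambda>n. f (?r n)) \<longlonglongrightarrow> f (max 0 s)" by simp
  moreover have "max 0 (?r n) = ?r n" for n by (intro max_absorb2 divide_nonneg_nonneg) auto
  ultimately show "(\<lambda>n. case x of (s, f) \<Rightarrow> f (max 0 ((of_int \<lfloor>real (Suc n) * max 0 s\<rfloor> + 1) / real (Suc n))))
      \<longlonglongrightarrow> (case x of (s, f) \<Rightarrow> f (max 0 s))"
    by (simp add: x)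
qed

text \<open>The same approximation from the left. At 0 there is nothing to the left, so only
  positive times are evaluated; \<open>death_path\<close> needs no others, and the default
  \<open>- \<infinity>\<close> is its value after the death.\<close>

lemma measurable_eval_caglad:
  "(\<lambda>(s, f). if 0 < s then f s else -\<infinity>) \<in> borel_measurable (borel \<Otimes>\<^sub>M caglad_paths)"
proof (rule borel_measurable_LIMSEQ_order)
  let ?r = "\<lambda>n s. (of_int \<lceil>real (Suc n) * s\<rceil> - 1) / real (Suc n)"
  fix n
  show "(\<lambda>(s, f). if 0 < s then f (max 0 (?r n s)) else -\<infinity>) \<in> borel_measurable (borel \<Otimes>\<^sub>M caglad_paths)"
  proof -
    have "(\<lambda>x. snd x (max 0 ((of_int i - 1) / real (Suc n)))) \<in> borel_measurable (borel \<Otimes>\<^sub>M caglad_paths)" for i :: int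
      unfolding caglad_paths_def
      by (intro measurable_compose[OF measurable_snd measurable_eval_restrict]) simp
    from measurable_compose_countable[where f="\<lambda>i x. snd x (max 0 ((of_int i - 1) / real (Suc n)))"
        and g="\<lambda>x. \<lceil>real (Suc n) * fst x\<rceil>", OF this]
    have [measurable]: "(\<lambda>x. snd x (max 0 (?r n (fst x)))) \<in> borel_measurable (borel \<Otimes>\<^sub>M caglad_paths)"
      by simp
    show ?thesis unfolding split_beta' by measurable
  qed
next
  fix x :: "real \<times> (real \<Rightarrow> ereal)" assume "x \<in> space (borel \<Otimes>\<^sub>M caglad_paths)"
  then obtain s f where x: "x = (s, f)" and f: "caglad_on {0..} f"
    by (auto simp: space_pair_measure caglad_paths_def space_restrict_space)
  let ?r = "\<lambda>n. (of_int \<lceil>real (Suc n) * s\<rceil> - 1) / real (Suc n)"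
  show "(\<lambda>n. case x of (s, f) \<Rightarrow> if 0 < s then f (max 0 ((of_int \<lceil>real (Suc n) * s\<rceil> - 1) / real (Suc n))) else -\<infinity>)
      \<longlonglongrightarrow> (case x of (s, f) \<Rightarrow> if 0 < s then f s else -\<infinity>)"
  proof (cases "0 < s")
    case True
    have "(f \<longlongrightarrow> f s) (at_left s)" using caglad_onD(2)[OF f] True by (simp add: interior_nonneg)
    from filterlim_compose[OF this tendsto_ceiling_left]
    have "(\<lambda>n. f (?r n)) \<longlonglongrightarrow> f s" by simp
    moreover have "max 0 (?r n) = ?r n" for n
    proof -
      have "0 < real (Suc n) * s" using True by simp
      \<comment> \<open>For positive \<open>s\<close> the ceiling is at least 1, so subtracting 1
        does not lead to negative times.\<close>
      then have "1 \<le> \<lceil>real (Suc n) * s\<rceil>" by linarith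
      then have "0 \<le> of_int \<lceil>real (Suc n) * s\<rceil> - (1::real)" by linarith
      then show ?thesis by (intro max_absorb2 divide_nonneg_nonneg) auto
    qed
    ultimately show ?thesis using True by (simp add: x)
  qed (simp add: x)
qed

lemma measurable_into_Dbar:
  assumes "\<And>t. (\<lambda>x. F x t) \<in> borel_measurable N" and "\<And>x. x \<in> space N \<Longrightarrow> cadlag_on UNIV (F x)"
  shows "F \<in> N \<rightarrow>\<^sub>M Dbar"
proof -
  have "(\<lambda>x t. F x t) \<in> N \<rightarrow>\<^sub>M path_space UNIV"
    by (rule measurable_PiM_single') (use assms in auto)
  with assms(2) show ?thesis unfolding Dbar_def by (intro measurable_restrict_space2) auto
qed

lemma measurable_birth_path:
  "(\<lambda>(p, f). birth_path p f) \<in> (borel \<Otimes>\<^sub>M borel) \<Otimes>\<^sub>M cadlag_paths \<rightarrow>\<^sub>M Dbar"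
proof (rule measurable_into_Dbar)
  fix t
  let ?N = "((borel :: real measure) \<Otimes>\<^sub>M (borel :: real measure)) \<Otimes>\<^sub>M cadlag_paths"
  have "(\<lambda>x. (t - fst (fst x), snd x)) \<in> ?N \<rightarrow>\<^sub>M borel \<Otimes>\<^sub>M cadlag_paths" by measurable
  from measurable_compose[OF this measurable_eval_cadlag]
  have [measurable]: "(\<lambda>x. snd x (max 0 (t - fst (fst x)))) \<in> borel_measurable ?N" by simp
  have "(\<lambda>x. if t < fst (fst x) then -\<infinity> else ereal (snd (fst x)) + snd x (max 0 (t - fst (fst x))))
      \<in> borel_measurable ?N"
    by measurable
  also have "(\<lambda>x. if t < fst (fst x) then -\<infinity> else ereal (snd (fst x)) + snd x (max 0 (t - fst (fst x))))
     = (\<lambda>x. (case x of (p, f) \<Rightarrow> birth_path p f) t)"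
    by (auto simp: birth_path_def fun_eq_iff max_def)
  finally show "(\<lambda>x. (case x of (p, f) \<Rightarrow> birth_path p f) t) \<in> borel_measurable ?N" .
qed (auto simp: space_pair_measure cadlag_paths_def space_restrict_space intro: cadlag_birth_path)

lemma measurable_death_path:
  "(\<lambda>(p, f). death_path p f) \<in> (borel \<Otimes>\<^sub>M borel) \<Otimes>\<^sub>M caglad_paths \<rightarrow>\<^sub>M Dbar"
proof (rule measurable_into_Dbar)
  fix t
  let ?N = "((borel :: real measure) \<Otimes>\<^sub>M (borel :: real measure)) \<Otimes>\<^sub>M caglad_paths"
  have "(\<lambda>x. (fst (fst x) - t, snd x)) \<in> ?N \<rightarrow>\<^sub>M borel \<Otimes>\<^sub>M caglad_paths" by measurable
  from measurable_compose[OF this measurable_eval_caglad]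
  have [measurable]: "(\<lambda>x. if t < fst (fst x) then snd x (fst (fst x) - t) else -\<infinity>) \<in> borel_measurable ?N"
    by simp
  have "(\<lambda>x. ereal (snd (fst x)) + (if t < fst (fst x) then snd x (fst (fst x) - t) else -\<infinity>))
      \<in> borel_measurable ?N"
    by measurable
  also have "(\<lambda>x. ereal (snd (fst x)) + (if t < fst (fst x) then snd x (fst (fst x) - t) else -\<infinity>))
     = (\<lambda>x. (case x of (p, f) \<Rightarrow> death_path p f) t)"
    by (auto simp: death_path_def fun_eq_iff)
  finally show "(\<lambda>x. (case x of (p, f) \<Rightarrow> death_path p f) t) \<in> borel_measurable ?N" .
qed (auto simp: space_pair_measure caglad_paths_def space_restrict_space intro: cadlag_death_path)

lemma measurable_eval_Dbar [measurable]: "(\<lambda>f. f t) \<in> borel_measurable Dbar"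
  unfolding Dbar_def by (rule measurable_eval_restrict) simp

lemma measurable_shift_path: "(\<lambda>(u, f). shift_path u f) \<in> borel \<Otimes>\<^sub>M Dbar \<rightarrow>\<^sub>M Dbar"
proof (rule measurable_into_Dbar)
  fix t
  have "(\<lambda>x. ereal (fst x) + snd x t) \<in> borel_measurable ((borel :: real measure) \<Otimes>\<^sub>M Dbar)"
    by measurable
  then show "(\<lambda>x. (case x of (u, f) \<Rightarrow> shift_path u f) t) \<in> borel_measurable ((borel :: real measure) \<Otimes>\<^sub>M Dbar)"
    by (simp add: split_beta' shift_path_def)
qed (auto simp: space_pair_measure Dbar_def space_restrict_space intro: cadlag_shift_path)

lemma birth_path_restrict: "birth_path p (restrict f {0..}) = birth_path p f"
  by (auto simp: birth_path_def fun_eq_iff)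

lemma death_path_restrict: "death_path p (restrict f {0..}) = death_path p f"
  by (auto simp: death_path_def fun_eq_iff)

section \<open>Finite-dimensional distributions of killed Levy processes\<close>

text \<open>The sub-Markov semigroup of the killed process applied to \<open>g\<close>, that is, the
  integral of \<open>g\<close> against \<open>killed_kernel\<close>. Acting on functions, its steps
  can be composed along a list of times.\<close>

definition killed_op :: "'w measure \<Rightarrow> (real \<Rightarrow> 'w \<Rightarrow> real) \<Rightarrow> real \<Rightarrow> real \<Rightarrow> (real \<Rightarrow> ennreal) \<Rightarrow> real \<Rightarrow> ennreal" where
  "killed_op P X \<theta> d g x = ennreal (exp (- \<theta> * d)) * (\<integral>\<^sup>+\<omega>. g (x + X d \<omega>) \<partial>P)"

text \<open>
  The weight of visiting \<open>B t\<close> at the successive times \<open>t\<close> of the list, from \<open>y\<close> at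
  time \<open>s\<close>. The absolute value lets the list run forwards or backwards in time.
\<close>
primrec iter_op :: "(real \<Rightarrow> (real \<Rightarrow> ennreal) \<Rightarrow> real \<Rightarrow> ennreal) \<Rightarrow> (real \<Rightarrow> real set) \<Rightarrow> real \<Rightarrow> real list \<Rightarrow> real \<Rightarrow> ennreal" where
  "iter_op Q B s [] y = 1"
| "iter_op Q B s (t # ts) y = Q \<bar>t - s\<bar> (\<lambda>z. indicator (B t) z * iter_op Q B t ts z) y"

lemma levy_processD:
  assumes "levy_process P X"
  shows "prob_space P" "\<And>t. 0 \<le> t \<Longrightarrow> X t \<in> borel_measurable P" "AE \<omega> in P. X 0 \<omega> = 0"
    "\<And>(n::nat) t. 0 \<le> t 0 \<Longrightarrow> mono t \<Longrightarrow>
        prob_space.indep_vars P (\<lambda>_. borel) (\<lambda>k \<omega>. X (t (Suc k)) \<omega> - X (t k) \<omega>) {..<n}"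
    "\<And>s t. 0 \<le> s \<Longrightarrow> 0 \<le> t \<Longrightarrow> distr P borel (\<lambda>\<omega>. X (s + t) \<omega> - X s \<omega>) = distr P borel (X t)"
  using assms unfolding levy_process_def by auto

lemma nn_integral_killed_kernel:
  assumes "levy_process P X" "0 \<le> d" and [measurable]: "g \<in> borel_measurable borel"
  shows "(\<integral>\<^sup>+y. g y \<partial>killed_kernel P X \<theta> d x) = killed_op P X \<theta> d g x"
proof -
  have [measurable]: "X d \<in> borel_measurable P" by (rule levy_processD(2)[OF assms(1,2)])
  show ?thesis
    unfolding killed_kernel_def killed_op_def
    by (subst nn_integral_scale_measure) (simp_all add: nn_integral_distr)
qed

lemma emeasure_killed_kernel:
  assumes "levy_process P X" "0 \<le> d" and A: "A \<in> sets borel"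
  shows "emeasure (killed_kernel P X \<theta> d x) A = killed_op P X \<theta> d (indicator A) x"
proof -
  have "emeasure (killed_kernel P X \<theta> d x) A = (\<integral>\<^sup>+y. indicator A y \<partial>killed_kernel P X \<theta> d x)"
    using A by (subst nn_integral_indicator) (auto simp: killed_kernel_def)
  then show ?thesis using nn_integral_killed_kernel[OF assms(1,2), of "indicator A"] A by simp
qed

context
  fixes P :: "'w measure" and X :: "real \<Rightarrow> 'w \<Rightarrow> real" and \<theta> :: real
  assumes X: "levy_process P X"
begin

interpretation P: prob_space P by (rule levy_processD(1)[OF X])

lemma measurable_killed_op [measurable]:
  assumes [measurable]: "g \<in> borel_measurable borel" and d: "0 \<le> d"
  shows "killed_op P X \<theta> d g \<in> borel_measurable borel"
proof -
  have [measurable]: "X d \<in> borel_measurable P" by (rule levy_processD(2)[OF X d])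
  show ?thesis unfolding killed_op_def by measurable
qed

lemma killed_op_cmult:
  assumes [measurable]: "g \<in> borel_measurable borel" and d: "0 \<le> d"
  shows "killed_op P X \<theta> d (\<lambda>x. c * g x) x = c * killed_op P X \<theta> d g x"
proof -
  have [measurable]: "X d \<in> borel_measurable P" by (rule levy_processD(2)[OF X d])
  show ?thesis unfolding killed_op_def by (simp add: nn_integral_cmult mult_ac)
qed

lemma killed_op_add:
  assumes [measurable]: "g \<in> borel_measurable borel" "h \<in> borel_measurable borel" and d: "0 \<le> d"
  shows "killed_op P X \<theta> d (\<lambda>x. g x + h x) x = killed_op P X \<theta> d g x + killed_op P X \<theta> d h x"
proof -
  have [measurable]: "X d \<in> borel_measurable P" by (rule levy_processD(2)[OF X d])
  show ?thesis unfolding killed_op_def by (simp add: nn_integral_add distrib_left)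
qed

lemma killed_op_SUP:
  fixes g :: "nat \<Rightarrow> real \<Rightarrow> ennreal"
  assumes g: "\<And>i. g i \<in> borel_measurable borel" "incseq g" and d: "0 \<le> d"
  shows "killed_op P X \<theta> d (\<lambda>x. SUP i. g i x) x = (SUP i. killed_op P X \<theta> d (g i) x)"
proof -
  note [measurable] = g(1)
  have [measurable]: "X d \<in> borel_measurable P" by (rule levy_processD(2)[OF X d])
  have "incseq (\<lambda>i \<omega>. g i (x + X d \<omega>))" using g(2) by (auto simp: incseq_def le_fun_def)
  then show ?thesis
    unfolding killed_op_def by (subst nn_integral_monotone_convergence_SUP) (auto simp: SUP_mult_left_ennreal)
qed

lemma killed_op_mono: "(\<And>x. g x \<le> h x) \<Longrightarrow> killed_op P X \<theta> d g x \<le> killed_op P X \<theta> d h x"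
  unfolding killed_op_def by (intro mult_left_mono nn_integral_mono) auto

lemma killed_op_one: "killed_op P X \<theta> d (\<lambda>_. 1) x = ennreal (exp (- \<theta> * d))"
  unfolding killed_op_def by (simp add: P.emeasure_space_1)

lemma measurable_iter_op [measurable]:
  assumes [measurable]: "\<And>t. B t \<in> sets borel"
  shows "iter_op (killed_op P X \<theta>) B s ts \<in> borel_measurable borel"
proof (induction ts arbitrary: s)
  case Nil
  then show ?case by (simp add: fun_eq_iff[symmetric])
next
  case (Cons t ts)
  have [measurable]: "iter_op (killed_op P X \<theta>) B t ts \<in> borel_measurable borel" by (rule Cons.IH)
  have "killed_op P X \<theta> \<bar>t - s\<bar> (\<lambda>z. indicator (B t) z * iter_op (killed_op P X \<theta>) B t ts z) \<in> borel_measurable borel"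
    by (rule measurable_killed_op) auto
  then show ?case by (simp add: fun_eq_iff[symmetric])
qed

text \<open>The Chapman-Kolmogorov equation, from independent and stationary increments over the two
  periods. It is needed where a two-sided path is observed on both sides of 0 but perhaps not at
  0.\<close>

lemma killed_op_killed_op:
  assumes [measurable]: "g \<in> borel_measurable borel" and d: "0 \<le> d" "0 \<le> e"
  shows "killed_op P X \<theta> d (killed_op P X \<theta> e g) x = killed_op P X \<theta> (d + e) g x"
proof -
  have [measurable]: "X d \<in> borel_measurable P" "X e \<in> borel_measurable P" "X (d + e) \<in> borel_measurable P"
      "X 0 \<in> borel_measurable P"
    using d by (auto intro: levy_processD(2)[OF X])
  \<comment> \<open>Independence of increments is stated along monotone sequences of times, so 0,
    \<open>d\<close>, \<open>d + e\<close> are continued by a constant.\<close>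
  define \<tau> where "\<tau> i = (if i = 0 then 0 else if i = Suc 0 then d else d + e)" for i :: nat
  have "mono \<tau>" using d by (auto simp: mono_def \<tau>_def)
  have \<tau>: "\<tau> 0 = 0" "\<tau> (Suc 0) = d" "\<tau> (Suc (Suc 0)) = d + e" by (auto simp: \<tau>_def)
  have iv: "P.indep_vars (\<lambda>_. borel) (\<lambda>k \<omega>. X (\<tau> (Suc k)) \<omega> - X (\<tau> k) \<omega>) {..<Suc (Suc 0)}"
    by (rule levy_processD(4)[OF X _ \<open>mono \<tau>\<close>]) (simp add: \<tau>(1))
  have "(\<integral>\<^sup>+\<omega>. g (x + X (d + e) \<omega>) \<partial>P) = (\<integral>\<^sup>+\<omega>. g (x + (X d \<omega> - X 0 \<omega>) + (X (d + e) \<omega> - X d \<omega>)) \<partial>P)"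
    using levy_processD(3)[OF X] by (intro nn_integral_cong_AE) (auto simp: algebra_simps)
  also have "\<dots> = (\<integral>\<^sup>+\<omega>. (\<integral>\<^sup>+y. g (x + (X d \<omega> - X 0 \<omega>) + y) \<partial>distr P borel (\<lambda>\<omega>. X (d + e) \<omega> - X d \<omega>)) \<partial>P)"
  proof -
    have "P.prob (((\<lambda>\<omega>. X d \<omega> - X 0 \<omega>) -` A \<inter> space P) \<inter> ((\<lambda>\<omega>. X (d + e) \<omega> - X d \<omega>) -` B \<inter> space P))
      = P.prob ((\<lambda>\<omega>. X d \<omega> - X 0 \<omega>) -` A \<inter> space P) * P.prob ((\<lambda>\<omega>. X (d + e) \<omega> - X d \<omega>) -` B \<inter> space P)"
      if "A \<in> sets borel" "B \<in> sets borel" for A B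
      using P.indep_varsD_finite[OF iv, of "\<lambda>i. if i = 0 then A else B"] that
      by (simp add: lessThan_Suc lessThan_empty_iff \<tau> Int_commute mult.commute)
    note ind = this
    have 1: "(\<lambda>\<omega>. X d \<omega> - X 0 \<omega>) \<in> borel_measurable P" and 2: "(\<lambda>\<omega>. X (d + e) \<omega> - X d \<omega>) \<in> borel_measurable P"
      and 3: "(\<lambda>p. g (x + fst p + snd p)) \<in> borel_measurable (borel \<Otimes>\<^sub>M borel)"
      by measurable
    from P.nn_integral_indep_pair[where f="\<lambda>p. g (x + fst p + snd p)" and S=borel and T=borel
        and W="\<lambda>\<omega>. X d \<omega> - X 0 \<omega>" and Y="\<lambda>\<omega>. X (d + e) \<omega> - X d \<omega>", OF 1 2 ind 3]
    show ?thesis by (simp only: fst_conv snd_conv)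
  qed
  also have "\<dots> = (\<integral>\<^sup>+\<omega>. (\<integral>\<^sup>+\<omega>'. g (x + (X d \<omega> - X 0 \<omega>) + X e \<omega>') \<partial>P) \<partial>P)"
    unfolding levy_processD(5)[OF X d] by (simp add: nn_integral_distr)
  also have "\<dots> = (\<integral>\<^sup>+\<omega>. (\<integral>\<^sup>+\<omega>'. g (x + X d \<omega> + X e \<omega>') \<partial>P) \<partial>P)"
    using levy_processD(3)[OF X] by (intro nn_integral_cong_AE) auto
  finally have *: "(\<integral>\<^sup>+\<omega>. g (x + X (d + e) \<omega>) \<partial>P) = (\<integral>\<^sup>+\<omega>. (\<integral>\<^sup>+\<omega>'. g (x + X d \<omega> + X e \<omega>') \<partial>P) \<partial>P)" .
  show ?thesis
    unfolding killed_op_def * by (simp add: nn_integral_cmult mult.assoc[symmetric] ennreal_mult[symmetric]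
        exp_add[symmetric] distrib_left)
qed

end

text \<open>The first increment is independent of the block of later ones, and given it the rest is
  the same problem with a new start. Both the starting index \<open>m\<close> and the position
  \<open>u\<close> move in the induction, hence the general form.\<close>

lemma fdd_increments:
  assumes X: "levy_process P X"
    and B [measurable]: "\<And>t. B t \<in> sets borel" and \<tau>: "mono \<tau>" "0 \<le> \<tau> 0"
  shows "(\<integral>\<^sup>+\<omega>. (\<Prod>j<n. indicator (B (\<tau> (Suc m + j))) (u + (X (\<tau> (Suc m + j)) \<omega> - X (\<tau> m) \<omega>))) \<partial>P)
    = iter_op (killed_op P X 0) B (\<tau> m) (map (\<lambda>j. \<tau> (Suc m + j)) [0..<n]) u"
proof (induction n arbitrary: m u)
  case 0
  then show ?case using levy_processD(1)[OF X] by (simp add: prob_space.emeasure_space_1)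
next
  case (Suc n)
  interpret P: prob_space P by (rule levy_processD(1)[OF X])
  have pos: "0 \<le> \<tau> i" for i using \<tau> monoD[OF \<tau>(1), of 0 i] by auto
  have Xm [measurable]: "X (\<tau> i) \<in> borel_measurable P" for i by (rule levy_processD(2)[OF X pos])
  define D where "D k \<omega> = X (\<tau> (Suc k)) \<omega> - X (\<tau> k) \<omega>" for k \<omega>
  have Dm [measurable]: "D k \<in> borel_measurable P" for k unfolding D_def by measurable
  let ?J = "{Suc m..<Suc m + n}"
  let ?W = "\<lambda>\<omega>. restrict (\<lambda>i. D i \<omega>) {m}" and ?Y = "\<lambda>\<omega>. restrict (\<lambda>i. D i \<omega>) ?J"
  let ?S = "PiM {m} (\<lambda>_. borel :: real measure)" and ?T = "PiM ?J (\<lambda>_. borel :: real measure)"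
  have iv: "P.indep_vars (\<lambda>_. borel) D {..<Suc m + n}"
    unfolding D_def by (rule levy_processD(4)[OF X]) (use \<tau> in auto)
  have iv2: "P.indep_var ?S ?W ?T ?Y"
    by (rule P.indep_var_restrict[OF iv]) auto
  have tele: "X (\<tau> (Suc m + j)) \<omega> - X (\<tau> (Suc m)) \<omega> = (\<Sum>i\<in>{Suc m..<Suc m + j}. D i \<omega>)" for j \<omega>
    unfolding D_def by (rule sum_Suc_diff'[symmetric]) simp
  let ?z = "\<lambda>\<omega>. u + D m \<omega>"
  let ?t = "\<tau> (Suc m)"
  \<comment> \<open>The product as a function of the first increment and the vector of later
    increments; later positions are recovered as partial sums.\<close>
  let ?f = "\<lambda>p. indicator (B ?t) (u + fst p m) *
      (\<Prod>j<n. indicator (B (\<tau> (Suc (Suc m) + j))) (u + fst p m + (\<Sum>i\<in>{Suc m..<Suc m + Suc j}. snd p i))) :: ennreal"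
  have f: "?f \<in> borel_measurable (?S \<Otimes>\<^sub>M ?T)"
  proof -
    have [measurable]: "(\<lambda>p. fst p m) \<in> borel_measurable (?S \<Otimes>\<^sub>M ?T)"
      by (intro measurable_compose[OF measurable_fst measurable_component_singleton]) simp
    have [measurable]: "(\<lambda>p. snd p i) \<in> borel_measurable (?S \<Otimes>\<^sub>M ?T)" if "i \<in> ?J" for i
      by (intro measurable_compose[OF measurable_snd measurable_component_singleton] that)
    have [measurable]: "(\<lambda>p. \<Sum>i\<in>{Suc m..<Suc m + Suc j}. snd p i) \<in> borel_measurable (?S \<Otimes>\<^sub>M ?T)" if "j < n" for j
      using that by (intro borel_measurable_sum) auto
    show ?thesis by measurable
  qed
  have WY: "?W \<in> P \<rightarrow>\<^sub>M ?S" "?Y \<in> P \<rightarrow>\<^sub>M ?T"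
    using P.indep_var_rv1[OF iv2] P.indep_var_rv2[OF iv2] .
  have ind: "P.prob ((?W -` A \<inter> space P) \<inter> (?Y -` C \<inter> space P)) = P.prob (?W -` A \<inter> space P) * P.prob (?Y -` C \<inter> space P)"
    if "A \<in> sets ?S" "C \<in> sets ?T" for A C
    using P.indep_varD[OF iv2 that] by (simp add: vimage_def Int_def conj_ac)
  have prod_Suc: "(\<Prod>j<Suc n. g j) = g 0 * (\<Prod>j<n. g (Suc j))" for g :: "nat \<Rightarrow> ennreal"
    by (rule prod.lessThan_Suc_shift)
  have step1: "(\<Prod>j<Suc n. indicator (B (\<tau> (Suc m + j))) (u + (X (\<tau> (Suc m + j)) \<omega> - X (\<tau> m) \<omega>)))
      = ?f (?W \<omega>, ?Y \<omega>)" for \<omega>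
  proof -
    have "(\<Prod>j<n. indicator (B (\<tau> (Suc m + Suc j))) (u + (X (\<tau> (Suc m + Suc j)) \<omega> - X (\<tau> m) \<omega>)))
       = (\<Prod>j<n. indicator (B (\<tau> (Suc (Suc m) + j))) (u + D m \<omega> + (\<Sum>i\<in>{Suc m..<Suc m + Suc j}. ?Y \<omega> i)) :: ennreal)"
    proof (rule prod.cong[OF refl])
      fix j assume "j \<in> {..<n}"
      then have "(\<Sum>i\<in>{Suc m..<Suc m + Suc j}. ?Y \<omega> i) = (\<Sum>i\<in>{Suc m..<Suc m + Suc j}. D i \<omega>)"
        by (intro sum.cong) auto
      also have "\<dots> = X (\<tau> (Suc m + Suc j)) \<omega> - X (\<tau> (Suc m)) \<omega>" by (rule tele[symmetric])
      finally have "(\<Sum>i\<in>{Suc m..<Suc m + Suc j}. ?Y \<omega> i) = X (\<tau> (Suc m + Suc j)) \<omega> - X (\<tau> (Suc m)) \<omega>" .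
      then show "indicator (B (\<tau> (Suc m + Suc j))) (u + (X (\<tau> (Suc m + Suc j)) \<omega> - X (\<tau> m) \<omega>))
        = (indicator (B (\<tau> (Suc (Suc m) + j))) (u + D m \<omega> + (\<Sum>i\<in>{Suc m..<Suc m + Suc j}. ?Y \<omega> i)) :: ennreal)"
        by (simp only: D_def) (simp add: algebra_simps)
    qed
    then show ?thesis unfolding prod_Suc by (simp add: D_def)
  qed
  \<comment> \<open>With the first increment frozen, the partial sums telescope back to differences
    of \<open>X\<close>, and the induction hypothesis applies from the new position.\<close>
  have inner: "(\<integral>\<^sup>+y. ?f (?W \<omega>, y) \<partial>distr P ?T ?Y) = indicator (B ?t) (?z \<omega>) * iter_op (killed_op P X 0) B ?t (map (\<lambda>j. \<tau> (Suc (Suc m) + j)) [0..<n]) (?z \<omega>)"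
    if \<omega>: "\<omega> \<in> space P" for \<omega>
  proof -
    define h where "h = (\<lambda>y. ?f (?W \<omega>, y))"
    have h: "h \<in> borel_measurable ?T"
      unfolding h_def
      by (rule measurable_compose[OF _ f]) (use WY(1)[THEN measurable_space, OF \<omega>] in simp)
    have "(\<integral>\<^sup>+y. ?f (?W \<omega>, y) \<partial>distr P ?T ?Y) = (\<integral>\<^sup>+y. h y \<partial>distr P ?T ?Y)"
      by (simp only: h_def)
    also have "\<dots> = (\<integral>\<^sup>+\<omega>'. h (?Y \<omega>') \<partial>P)"
      by (rule nn_integral_distr[OF WY(2)]) (use h in simp)
    also have "\<dots> = (\<integral>\<^sup>+\<omega>'. ?f (?W \<omega>, ?Y \<omega>') \<partial>P)"
      by (simp only: h_def)
    also have "\<dots> = (\<integral>\<^sup>+\<omega>'. indicator (B ?t) (?z \<omega>) *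
        (\<Prod>j<n. indicator (B (\<tau> (Suc (Suc m) + j))) (?z \<omega> + (X (\<tau> (Suc (Suc m) + j)) \<omega>' - X (\<tau> (Suc m)) \<omega>'))) \<partial>P)"
    proof (rule nn_integral_cong)
      fix \<omega>'
      have "(\<Prod>j<n. indicator (B (\<tau> (Suc (Suc m) + j))) (?z \<omega> + (\<Sum>i\<in>{Suc m..<Suc m + Suc j}. ?Y \<omega>' i)))
        = (\<Prod>j<n. indicator (B (\<tau> (Suc (Suc m) + j))) (?z \<omega> + (X (\<tau> (Suc (Suc m) + j)) \<omega>' - X (\<tau> (Suc m)) \<omega>')) :: ennreal)"
      proof (rule prod.cong[OF refl])
        fix j assume "j \<in> {..<n}"
        then have "(\<Sum>i\<in>{Suc m..<Suc m + Suc j}. ?Y \<omega>' i) = (\<Sum>i\<in>{Suc m..<Suc m + Suc j}. D i \<omega>')"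
          by (intro sum.cong) auto
        also have "\<dots> = X (\<tau> (Suc m + Suc j)) \<omega>' - X (\<tau> (Suc m)) \<omega>'" by (rule tele[symmetric])
        finally show "indicator (B (\<tau> (Suc (Suc m) + j))) (?z \<omega> + (\<Sum>i\<in>{Suc m..<Suc m + Suc j}. ?Y \<omega>' i))
          = (indicator (B (\<tau> (Suc (Suc m) + j))) (?z \<omega> + (X (\<tau> (Suc (Suc m) + j)) \<omega>' - X (\<tau> (Suc m)) \<omega>')) :: ennreal)"
          by (simp only:) simp
      qed
      then show "?f (?W \<omega>, ?Y \<omega>') = indicator (B ?t) (?z \<omega>) *
        (\<Prod>j<n. indicator (B (\<tau> (Suc (Suc m) + j))) (?z \<omega> + (X (\<tau> (Suc (Suc m) + j)) \<omega>' - X (\<tau> (Suc m)) \<omega>')))"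
        by simp
    qed
    also have "\<dots> = indicator (B ?t) (?z \<omega>) * iter_op (killed_op P X 0) B ?t (map (\<lambda>j. \<tau> (Suc (Suc m) + j)) [0..<n]) (?z \<omega>)"
      by (subst nn_integral_cmult) (simp_all only: Suc.IH, measurable)
    finally show ?thesis .
  qed
  let ?g = "\<lambda>z. indicator (B ?t) z * iter_op (killed_op P X 0) B ?t (map (\<lambda>j. \<tau> (Suc (Suc m) + j)) [0..<n]) z"
  have g [measurable]: "?g \<in> borel_measurable borel"
    using measurable_iter_op[OF X B] by measurable
  have le: "\<tau> m \<le> ?t" using monoD[OF \<tau>(1), of m "Suc m"] by simp
  have "(\<integral>\<^sup>+\<omega>. (\<Prod>j<Suc n. indicator (B (\<tau> (Suc m + j))) (u + (X (\<tau> (Suc m + j)) \<omega> - X (\<tau> m) \<omega>))) \<partial>P)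
      = (\<integral>\<^sup>+\<omega>. ?f (?W \<omega>, ?Y \<omega>) \<partial>P)"
    by (simp only: step1)
  also have "\<dots> = (\<integral>\<^sup>+\<omega>. (\<integral>\<^sup>+y. ?f (?W \<omega>, y) \<partial>distr P ?T ?Y) \<partial>P)"
    by (rule P.nn_integral_indep_pair[where f="?f" and S="?S" and T="?T" and W="?W" and Y="?Y", OF WY ind f])
  also have "\<dots> = (\<integral>\<^sup>+\<omega>. ?g (u + D m \<omega>) \<partial>P)"
    by (intro nn_integral_cong inner)
  also have "\<dots> = (\<integral>\<^sup>+y. ?g (u + y) \<partial>distr P borel (D m))"
    by (subst nn_integral_distr) measurable
  also have "distr P borel (D m) = distr P borel (X (?t - \<tau> m))"
    using levy_processD(5)[OF X pos[of m], of "?t - \<tau> m"] le unfolding D_def by simp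
  also have "(\<integral>\<^sup>+y. ?g (u + y) \<partial>distr P borel (X (?t - \<tau> m))) = killed_op P X 0 \<bar>?t - \<tau> m\<bar> ?g u"
  proof -
    have gu: "(\<lambda>y. ?g (u + y)) \<in> borel_measurable borel" using g by measurable
    have "X (?t - \<tau> m) \<in> borel_measurable P" using le by (intro levy_processD(2)[OF X]) simp
    then have "(\<integral>\<^sup>+y. ?g (u + y) \<partial>distr P borel (X (?t - \<tau> m))) = (\<integral>\<^sup>+\<omega>. ?g (u + X (?t - \<tau> m) \<omega>) \<partial>P)"
      by (rule nn_integral_distr) (simp only: measurable_distr_eq1 gu)
    then show ?thesis using le by (simp only: killed_op_def) simp
  qed
  also have "\<dots> = iter_op (killed_op P X 0) B (\<tau> m) (map (\<lambda>j. \<tau> (Suc m + j)) [0..<Suc n]) u"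
  proof -
    have "map (\<lambda>j. \<tau> (Suc m + j)) [0..<Suc n] = ?t # map (\<lambda>j. \<tau> (Suc (Suc m) + j)) [0..<n]"
      by (subst upt_conv_Cons) (simp_all add: map_Suc_upt[symmetric] o_def del: upt_Suc)
    then show ?thesis by (simp only: iter_op.simps)
  qed
  finally show ?case .
qed

text \<open>Each step carries its own killing factor; along a sorted list the elapsed times add up,
  so the factors combine to survival until the last time.\<close>

lemma iter_op_zero_rate:
  assumes X: "levy_process P X" and B [measurable]: "\<And>t. B t \<in> sets borel" and "sorted (s # ts)"
  shows "iter_op (killed_op P X \<theta>) B s ts u = ennreal (exp (- \<theta> * (last (s # ts) - s))) * iter_op (killed_op P X 0) B s ts u"
  using assms(3)
proof (induction ts arbitrary: s u)
  case (Cons t ts)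
  let ?c = "ennreal (exp (- \<theta> * (last (t # ts) - t)))"
  have st: "s \<le> t" "sorted (t # ts)" using Cons.prems by auto
  have [measurable]: "iter_op (killed_op P X 0) B t ts \<in> borel_measurable borel" by (rule measurable_iter_op[OF X B])
  have "iter_op (killed_op P X \<theta>) B s (t # ts) u
      = killed_op P X \<theta> \<bar>t - s\<bar> (\<lambda>z. ?c * (indicator (B t) z * iter_op (killed_op P X 0) B t ts z)) u"
    by (simp only: iter_op.simps Cons.IH[OF st(2)] mult.left_commute)
  also have "\<dots> = ?c * killed_op P X \<theta> \<bar>t - s\<bar> (\<lambda>z. indicator (B t) z * iter_op (killed_op P X 0) B t ts z) u"
    by (rule killed_op_cmult[OF X]) auto
  also have "\<dots> = ?c * ennreal (exp (- \<theta> * (t - s))) * iter_op (killed_op P X 0) B s (t # ts) u"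
    using st by (simp add: killed_op_def mult_ac)
  also have "?c * ennreal (exp (- \<theta> * (t - s))) = ennreal (exp (- \<theta> * (last (s # t # ts) - s)))"
    by (subst ennreal_mult[symmetric]) (simp_all add: exp_add[symmetric] algebra_simps)
  finally show ?case .
qed simp

lemma fdd_levy:
  assumes X: "levy_process P X" and B [measurable]: "\<And>t. B t \<in> sets borel" and ts: "sorted (0 # ts)"
  shows "(\<integral>\<^sup>+\<omega>. (\<Prod>t\<leftarrow>ts. indicator (B t) (u + X t \<omega>)) \<partial>P) = iter_op (killed_op P X 0) B 0 ts u"
proof -
  \<comment> \<open>The list preceded by 0 and continued by its last entry, so that it becomes a
    monotone sequence of times.\<close>
  define \<tau> where "\<tau> i = (if i < length (0 # ts) then (0 # ts) ! i else last (0 # ts))" for i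
  have "\<tau> i \<le> \<tau> j" if "i \<le> j" for i j
  proof (cases "j < length (0 # ts)")
    case True
    then show ?thesis using sorted_nth_mono[OF ts that] that by (simp add: \<tau>_def)
  next
    case False
    have "\<tau> i \<le> last (0 # ts)"
    proof (cases "i < length (0 # ts)")
      case True
      then have "(0 # ts) ! i \<le> (0 # ts) ! (length (0 # ts) - 1)" by (intro sorted_nth_mono[OF ts]) auto
      moreover have "last (0 # ts) = (0 # ts) ! (length (0 # ts) - 1)" by (rule last_conv_nth) simp
      ultimately show ?thesis using True by (simp only: \<tau>_def if_True)
    qed (simp add: \<tau>_def)
    with False show ?thesis by (simp add: \<tau>_def)
  qed
  then have mono: "mono \<tau>" by (rule monoI)
  have \<tau>0: "\<tau> 0 = 0" by (simp add: \<tau>_def)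
  have \<tau>S: "\<tau> (Suc j) = ts ! j" if "j < length ts" for j using that by (simp add: \<tau>_def)
  have map: "map (\<lambda>j. \<tau> (Suc 0 + j)) [0..<length ts] = ts"
    by (rule nth_equalityI) (simp_all add: \<tau>S)
  have "(\<integral>\<^sup>+\<omega>. (\<Prod>t\<leftarrow>ts. indicator (B t) (u + X t \<omega>)) \<partial>P)
      = (\<integral>\<^sup>+\<omega>. (\<Prod>j<length ts. indicator (B (\<tau> (Suc 0 + j))) (u + (X (\<tau> (Suc 0 + j)) \<omega> - X (\<tau> 0) \<omega>))) \<partial>P)"
    using levy_processD(3)[OF X]
  proof (intro nn_integral_cong_AE, elim AE_mp, intro AE_I2 impI)
    fix \<omega> assume 0: "X 0 \<omega> = 0"
    show "(\<Prod>t\<leftarrow>ts. indicator (B t) (u + X t \<omega>))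
      = (\<Prod>j<length ts. indicator (B (\<tau> (Suc 0 + j))) (u + (X (\<tau> (Suc 0 + j)) \<omega> - X (\<tau> 0) \<omega>)) :: ennreal)"
      by (subst prod.list_conv_set_nth) (auto simp: \<tau>0 0 \<tau>S atLeast0LessThan intro!: prod.cong)
  qed
  also have "\<dots> = iter_op (killed_op P X 0) B (\<tau> 0) (map (\<lambda>j. \<tau> (Suc 0 + j)) [0..<length ts]) u"
    by (rule fdd_increments[OF X B mono]) (simp add: \<tau>0)
  finally show ?thesis by (simp only: map \<tau>0)
qed

section \<open>Killing at an independent time\<close>

lemma sets_killing_time [measurable_cong]: "sets (killing_time \<theta>) = sets borel"
  by (simp add: killing_time_def)

lemma prob_space_killing_time: "0 \<le> \<theta> \<Longrightarrow> prob_space (killing_time \<theta>)"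
  unfolding killing_time_def
  by (auto intro!: prob_space_return prob_space.prob_space_distr prob_space_exponential_density)

lemma emeasure_killing_time:
  assumes "0 \<le> \<theta>" "0 \<le> t"
  shows "emeasure (killing_time \<theta>) {e. ereal t < e} = ennreal (exp (- \<theta> * t))"
proof (cases "\<theta> = 0")
  case True
  then show ?thesis by (simp add: killing_time_def emeasure_return)
next
  case False
  then have \<theta>: "0 < \<theta>" using assms by simp
  let ?E = "density lborel (exponential_density \<theta>)"
  interpret E: prob_space ?E by (rule prob_space_exponential_density[OF \<theta>])
  have "distributed ?E lborel (\<lambda>x. x) (\<lambda>x. ennreal (exponential_density \<theta> x))"
    by (auto simp: distributed_def distr_id2 exponential_density_nonneg[OF \<theta>])
  from E.exponential_distributedD_gt[OF this assms(2) \<theta>]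
  have "E.prob {x. t < x} = exp (- t * \<theta>)" by simp
  then have "emeasure ?E {x. t < x} = ennreal (exp (- \<theta> * t))"
    by (simp add: E.emeasure_eq_measure mult.commute)
  moreover have "emeasure (killing_time \<theta>) {e. ereal t < e} = emeasure ?E {x. t < x}"
    using False unfolding killing_time_def by (subst if_not_P, simp, subst emeasure_distr) (auto simp: vimage_def)
  ultimately show ?thesis by simp
qed

lemma sets_ereal_image:
  assumes [measurable]: "B \<in> sets borel" shows "ereal ` B \<in> sets borel"
proof -
  have "ereal ` B = {x. \<bar>x\<bar> \<noteq> \<infinity> \<and> real_of_ereal x \<in> B}"
    by (auto simp: image_iff)
  also have "\<dots> \<in> sets borel" by measurable
  finally show ?thesis .
qed

text \<open>The image of \<open>B t\<close> under \<open>ereal\<close> contains no infinite value,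
  so membership forces the path to be alive at \<open>t\<close>, even for \<open>B t = UNIV\<close>.
  The offset \<open>u\<close> is the starting height, which is not part of the path.\<close>

definition alive_in :: "(real \<Rightarrow> real set) \<Rightarrow> real set \<Rightarrow> real \<Rightarrow> (real \<Rightarrow> ereal) \<Rightarrow> bool" where
  "alive_in B J u f \<longleftrightarrow> (\<forall>t\<in>J. ereal u + f t \<in> ereal ` B t)"

lemma sets_alive_in:
  assumes J: "finite J" and B: "\<And>t. B t \<in> sets borel"
    and N: "\<And>t. t \<in> J \<Longrightarrow> (\<lambda>f. f t) \<in> borel_measurable N"
  shows "{f \<in> space N. alive_in B J u f} \<in> sets N"
  unfolding alive_in_def
proof (rule sets.sets_Collect_finite_All)
  fix t assume "t \<in> J"
  then have "(\<lambda>f. ereal u + f t) \<in> borel_measurable N"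
    by (intro borel_measurable_ereal_add N) auto
  from measurable_sets[OF this sets_ereal_image[OF B]]
  show "{f \<in> space N. ereal u + f t \<in> ereal ` B t} \<in> sets N"
    by (simp add: vimage_def Int_def conj_commute)
qed (rule J)

lemma measurable_killed_path:
  assumes X: "levy_process P X"
  shows "(\<lambda>(\<omega>, e). \<lambda>t\<in>{0..}. if ereal t < e then ereal (X t \<omega>) else - \<infinity>)
    \<in> P \<Otimes>\<^sub>M killing_time \<theta> \<rightarrow>\<^sub>M path_space {0..}"
proof -
  have "(\<lambda>x. if ereal t < snd x then ereal (X t (fst x)) else - \<infinity>) \<in> borel_measurable (P \<Otimes>\<^sub>M killing_time \<theta>)"
    if "t \<in> {0..}" for t
  proof -
    have [measurable]: "X t \<in> borel_measurable P" using that by (intro levy_processD(2)[OF X]) simp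
    show ?thesis by measurable
  qed
  then have "(\<lambda>x. \<lambda>t\<in>{0..}. if ereal t < snd x then ereal (X t (fst x)) else - \<infinity>)
    \<in> P \<Otimes>\<^sub>M killing_time \<theta> \<rightarrow>\<^sub>M path_space {0..}"
    by (rule measurable_restrict)
  then show ?thesis by (simp add: split_beta')
qed

lemma prob_space_killed_law:
  assumes X: "levy_process P X" and \<theta>: "0 \<le> \<theta>"
  shows "prob_space (killed_law P X \<theta>)"
proof -
  interpret P: prob_space P by (rule levy_processD(1)[OF X])
  interpret k: prob_space "killing_time \<theta>" by (rule prob_space_killing_time[OF \<theta>])
  interpret pp: pair_prob_space P "killing_time \<theta>" ..
  show ?thesis unfolding killed_law_def by (rule pp.P.prob_space_distr[OF measurable_killed_path[OF X]])
qed

text \<open>A path is alive at all listed times exactly if it is alive at the last one. The event is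
  therefore a rectangle in the unkilled path and the killing time, and the survival probability is
  the factor of \<open>iter_op_zero_rate\<close>.\<close>

lemma fdd_killed_law:
  assumes X: "levy_process P X" and \<theta>: "0 \<le> \<theta>" and B [measurable]: "\<And>t. B t \<in> sets borel"
    and ts: "sorted (0 # ts)"
  shows "emeasure (killed_law P X \<theta>) {f \<in> space (path_space {0..}). alive_in B (set ts) u f}
    = iter_op (killed_op P X \<theta>) B 0 ts u"
proof -
  interpret P: prob_space P by (rule levy_processD(1)[OF X])
  interpret k: prob_space "killing_time \<theta>" by (rule prob_space_killing_time[OF \<theta>])
  let ?\<Phi> = "\<lambda>(\<omega>, e). \<lambda>t\<in>{0..}. if ereal t < e then ereal (X t \<omega>) else - \<infinity>"
  let ?C = "{f \<in> space (path_space {0..}). alive_in B (set ts) u f}"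
  let ?A = "{\<omega> \<in> space P. \<forall>t\<in>set ts. u + X t \<omega> \<in> B t}" and ?T = "last (0 # ts)"
  have nonneg: "0 \<le> t" if "t \<in> set ts" for t using ts that by auto
  have T: "0 \<le> ?T" "t \<in> set ts \<Longrightarrow> t \<le> ?T" for t
    using ts by (induction ts) auto
  have C: "?C \<in> sets (path_space {0..})"
    using nonneg B by (intro sets_alive_in measurable_component_singleton) auto
  have Xm: "X t \<in> borel_measurable P" if "t \<in> set ts" for t
    using nonneg[OF that] by (rule levy_processD(2)[OF X])
  have A: "?A \<in> sets P"
  proof (rule sets.sets_Collect_finite_All)
    fix t assume "t \<in> set ts"
    then have [measurable]: "X t \<in> borel_measurable P" by (rule Xm)
    show "{\<omega> \<in> space P. u + X t \<omega> \<in> B t} \<in> sets P" by measurable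
  qed simp
  have "(\<Prod>t\<leftarrow>ts'. indicator (B t) (u + X t \<omega>)) = (indicator {\<omega>. \<forall>t\<in>set ts'. u + X t \<omega> \<in> B t} \<omega> :: ennreal)"
    for ts' \<omega> by (induction ts') (auto simp: indicator_def)
  note pl = this
  have "emeasure P ?A = (\<integral>\<^sup>+\<omega>. indicator ?A \<omega> \<partial>P)" using A by simp
  also have "\<dots> = (\<integral>\<^sup>+\<omega>. (\<Prod>t\<leftarrow>ts. indicator (B t) (u + X t \<omega>)) \<partial>P)"
    unfolding pl by (intro nn_integral_cong) (simp add: indicator_def)
  also have "\<dots> = iter_op (killed_op P X 0) B 0 ts u" by (rule fdd_levy[OF X B ts])
  finally have PA: "emeasure P ?A = iter_op (killed_op P X 0) B 0 ts u" .
  show ?thesis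
  proof (cases "ts = []")
    case True
    interpret prob_space "killed_law P X \<theta>" by (rule prob_space_killed_law[OF X \<theta>])
    from True show ?thesis using emeasure_space_1 by (simp add: alive_in_def killed_law_def)
  next
    case False
    then have Tin: "?T \<in> set ts" by simp
    have "emeasure (killed_law P X \<theta>) ?C = emeasure (P \<Otimes>\<^sub>M killing_time \<theta>) (?\<Phi> -` ?C \<inter> space (P \<Otimes>\<^sub>M killing_time \<theta>))"
      unfolding killed_law_def by (rule emeasure_distr[OF measurable_killed_path[OF X] C])
    also have "?\<Phi> -` ?C \<inter> space (P \<Otimes>\<^sub>M killing_time \<theta>) = ?A \<times> {e. ereal ?T < e}"
    proof (intro set_eqI iffI)
      fix x assume "x \<in> ?\<Phi> -` ?C \<inter> space (P \<Otimes>\<^sub>M killing_time \<theta>)"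
      then obtain \<omega> e where x: "x = (\<omega>, e)" "\<omega> \<in> space P"
        and al: "\<And>t. t \<in> set ts \<Longrightarrow> ereal u + (if ereal t < e then ereal (X t \<omega>) else - \<infinity>) \<in> ereal ` B t"
        using nonneg by (auto simp: space_pair_measure alive_in_def)
      have "ereal t < e \<and> u + X t \<omega> \<in> B t" if "t \<in> set ts" for t
        using al[OF that] by (auto split: if_splits)
      with x Tin show "x \<in> ?A \<times> {e. ereal ?T < e}" by auto
    next
      fix x assume "x \<in> ?A \<times> {e. ereal ?T < e}"
      then obtain \<omega> e where x: "x = (\<omega>, e)" "\<omega> \<in> space P" "ereal ?T < e"
        and al: "\<And>t. t \<in> set ts \<Longrightarrow> u + X t \<omega> \<in> B t" by auto
      have "ereal t < e" if "t \<in> set ts" for t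
        using T(2)[OF that] x(3) by (metis ereal_less_eq(3) le_less_trans)
      with x al nonneg show "x \<in> ?\<Phi> -` ?C \<inter> space (P \<Otimes>\<^sub>M killing_time \<theta>)"
        by (auto simp: space_pair_measure alive_in_def space_PiM sets_eq_imp_space_eq[OF sets_killing_time])
    qed
    also have "emeasure (P \<Otimes>\<^sub>M killing_time \<theta>) (?A \<times> {e. ereal ?T < e}) = emeasure P ?A * emeasure (killing_time \<theta>) {e. ereal ?T < e}"
      by (rule k.emeasure_pair_measure_Times[OF A]) (simp add: sets_killing_time)
    also have "\<dots> = iter_op (killed_op P X \<theta>) B 0 ts u"
      unfolding PA emeasure_killing_time[OF \<theta> T(1)] iter_op_zero_rate[OF X B ts, of \<theta>] by (simp add: mult.commute)
    finally show ?thesis .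
  qed
qed

section \<open>Duality\<close>

text \<open>Monotone class argument in one function of the pairing: \<open>a\<close> is the other
  function and \<open>b\<close> is its image under the dual operator.\<close>

lemma killed_pairing_extend:
  assumes X: "levy_process P X" and d: "0 \<le> d"
    and a [measurable]: "a \<in> borel_measurable borel" and b [measurable]: "b \<in> borel_measurable borel"
    and sets: "\<And>B. B \<in> sets borel \<Longrightarrow> (\<integral>\<^sup>+x. ennreal (exp (- x)) * (a x * killed_op P X \<theta> d (indicator B) x) \<partial>lborel)
      = (\<integral>\<^sup>+y. ennreal (exp (- y)) * (indicator B y * b y) \<partial>lborel)"
    and h: "h \<in> borel_measurable borel"
  shows "(\<integral>\<^sup>+x. ennreal (exp (- x)) * (a x * killed_op P X \<theta> d h x) \<partial>lborel)
    = (\<integral>\<^sup>+y. ennreal (exp (- y)) * (h y * b y) \<partial>lborel)"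
  using h
proof (induction rule: borel_measurable_induct)
  case (cong f g)
  then have "f = g" by auto
  with cong show ?case by simp
next
  case (set B)
  then show ?case by (simp add: sets)
next
  case (mult u c)
  note [measurable] = mult.hyps(2) measurable_killed_op[OF X mult.hyps(2) d, of \<theta>]
  have "(\<integral>\<^sup>+x. ennreal (exp (- x)) * (a x * killed_op P X \<theta> d (\<lambda>x. c * u x) x) \<partial>lborel)
    = (\<integral>\<^sup>+x. c * (ennreal (exp (- x)) * (a x * killed_op P X \<theta> d u x)) \<partial>lborel)"
    by (simp add: killed_op_cmult[OF X _ d] mult_ac)
  also have "\<dots> = (\<integral>\<^sup>+y. c * (ennreal (exp (- y)) * (u y * b y)) \<partial>lborel)"
    by (simp add: nn_integral_cmult mult.IH)
  finally show ?case by (simp add: mult_ac)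
next
  case (add u v)
  note [measurable] = add.hyps(1,3) measurable_killed_op[OF X add.hyps(1) d, of \<theta>] measurable_killed_op[OF X add.hyps(3) d, of \<theta>]
  have "(\<integral>\<^sup>+x. ennreal (exp (- x)) * (a x * killed_op P X \<theta> d (\<lambda>x. v x + u x) x) \<partial>lborel)
    = (\<integral>\<^sup>+x. ennreal (exp (- x)) * (a x * killed_op P X \<theta> d v x) + ennreal (exp (- x)) * (a x * killed_op P X \<theta> d u x) \<partial>lborel)"
    by (simp add: killed_op_add[OF X _ _ d] distrib_left)
  also have "\<dots> = (\<integral>\<^sup>+y. ennreal (exp (- y)) * (v y * b y) + ennreal (exp (- y)) * (u y * b y) \<partial>lborel)"
    by (simp add: nn_integral_add add.IH)
  finally show ?case by (simp add: distrib_left distrib_right)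
next
  case (seq U)
  note [measurable] = seq.hyps(1) measurable_killed_op[OF X seq.hyps(1) d, of \<theta>]
  have inc: "incseq (\<lambda>i x. ennreal (exp (- x)) * (a x * killed_op P X \<theta> d (U i) x))"
    using seq.hyps(3) by (auto simp: incseq_def le_fun_def intro!: mult_left_mono killed_op_mono[OF X])
  have inc': "incseq (\<lambda>i y. ennreal (exp (- y)) * (U i y * b y))"
    using seq.hyps(3) by (auto simp: incseq_def le_fun_def intro!: mult_left_mono mult_right_mono)
  have U: "(SUP i. U i) = (\<lambda>x. SUP i. U i x)" by (rule ext) (simp only: SUP_apply)
  have "(\<integral>\<^sup>+x. ennreal (exp (- x)) * (a x * killed_op P X \<theta> d (SUP i. U i) x) \<partial>lborel)
    = (\<integral>\<^sup>+x. (SUP i. ennreal (exp (- x)) * (a x * killed_op P X \<theta> d (U i) x)) \<partial>lborel)"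
    unfolding U by (simp add: killed_op_SUP[OF X _ seq.hyps(3) d] SUP_mult_left_ennreal)
  also have "\<dots> = (SUP i. \<integral>\<^sup>+x. ennreal (exp (- x)) * (a x * killed_op P X \<theta> d (U i) x) \<partial>lborel)"
    by (rule nn_integral_monotone_convergence_SUP[OF inc]) measurable
  also have "\<dots> = (SUP i. \<integral>\<^sup>+y. ennreal (exp (- y)) * (U i y * b y) \<partial>lborel)"
    by (simp add: seq.IH)
  also have "\<dots> = (\<integral>\<^sup>+y. (SUP i. ennreal (exp (- y)) * (U i y * b y)) \<partial>lborel)"
    by (rule nn_integral_monotone_convergence_SUP[OF inc', symmetric]) measurable
  also have "\<dots> = (\<integral>\<^sup>+y. ennreal (exp (- y)) * ((SUP i. U i) y * b y) \<partial>lborel)"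
    unfolding U by (simp add: SUP_mult_left_ennreal SUP_mult_right_ennreal)
  finally show ?case .
qed

text \<open>The two semigroups are adjoint with respect to \<open>e\<^sup>-\<^sup>x dx\<close>.
  Duality is given on pairs of indicators; it is extended in \<open>h\<close> for a fixed set, then
  in \<open>g\<close> for a fixed \<open>h\<close>.\<close>

lemma dual_kernels_killed_op:
  assumes X: "levy_process P X" and Y: "levy_process P' Y"
    and dual: "dual_kernels (killed_kernel P' Y \<theta>') (killed_kernel P X \<theta>)" and d: "0 \<le> d"
    and g: "g \<in> borel_measurable borel" and h: "h \<in> borel_measurable borel"
  shows "(\<integral>\<^sup>+x. ennreal (exp (- x)) * (g x * killed_op P' Y \<theta>' d h x) \<partial>lborel)
    = (\<integral>\<^sup>+y. ennreal (exp (- y)) * (h y * killed_op P X \<theta> d g y) \<partial>lborel)"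
proof -
  have rect: "(\<integral>\<^sup>+x. ennreal (exp (- x)) * (indicator A x * killed_op P' Y \<theta>' d (indicator B) x) \<partial>lborel)
    = (\<integral>\<^sup>+y. ennreal (exp (- y)) * (indicator B y * killed_op P X \<theta> d (indicator A) y) \<partial>lborel)"
    if "A \<in> sets borel" "B \<in> sets borel" for A B
    using dual[unfolded dual_kernels_def, rule_format, OF d that]
    by (simp add: emeasure_killed_kernel[OF X d that(1)] emeasure_killed_kernel[OF Y d that(2)] mult_ac)
  have "(\<integral>\<^sup>+y. ennreal (exp (- y)) * (h y * killed_op P X \<theta> d g y) \<partial>lborel)
    = (\<integral>\<^sup>+x. ennreal (exp (- x)) * (g x * killed_op P' Y \<theta>' d h x) \<partial>lborel)"
  proof (rule killed_pairing_extend[OF X d h measurable_killed_op[OF Y h d] _ g])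
    fix A :: "real set" assume A: "A \<in> sets borel"
    have "indicator A \<in> borel_measurable borel" using A by simp
    from killed_pairing_extend[OF Y d this measurable_killed_op[OF X this d] rect[OF A] h]
    show "(\<integral>\<^sup>+y. ennreal (exp (- y)) * (h y * killed_op P X \<theta> d (indicator A) y) \<partial>lborel)
      = (\<integral>\<^sup>+x. ennreal (exp (- x)) * (indicator A x * killed_op P' Y \<theta>' d h x) \<partial>lborel)" by (rule sym)
  qed
  then show ?thesis by (rule sym)
qed

section \<open>Weights of observed paths started from the exponential measure\<close>

definition exp_integral :: "(real \<Rightarrow> ennreal) \<Rightarrow> ennreal" where
  "exp_integral g = (\<integral>\<^sup>+x. ennreal (exp (- x)) * g x \<partial>lborel)"

lemma nn_integral_exp_intensity:
  "g \<in> borel_measurable borel \<Longrightarrow> (\<integral>\<^sup>+x. g x \<partial>exp_intensity) = exp_integral g"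
  unfolding exp_intensity_def exp_integral_def by (subst nn_integral_density) auto

text \<open>The operators depend only on the distances of successive times, so the times may be
  moved by an isometry: a translation for births, a reflection for deaths and for negative
  times.\<close>

lemma iter_op_reindex:
  assumes "\<And>x y. \<bar>g x - g y\<bar> = \<bar>x - y\<bar>"
  shows "iter_op Q B (g s) (map g ts) y = iter_op Q (\<lambda>r. B (g r)) s ts y"
proof (induction ts arbitrary: s y)
  case (Cons t ts)
  have "iter_op Q B (g t) (map g ts) = iter_op Q (\<lambda>r. B (g r)) t ts" by (rule ext) (rule Cons.IH)
  then show ?case by (simp add: assms)
qed simp

locale dual_levy_pair =
  fixes P :: "'w measure" and \<xi> :: "real \<Rightarrow> 'w \<Rightarrow> real"
    and P' :: "'v measure" and \<eta> :: "real \<Rightarrow> 'v \<Rightarrow> real" and \<theta>p \<theta>m :: real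
  assumes xi: "levy_process P \<xi>" and eta: "levy_process P' \<eta>"
    and dual: "dual_kernels (killed_kernel P' \<eta> \<theta>p) (killed_kernel P \<xi> \<theta>m)"
    and rate_nonneg: "0 \<le> \<theta>p" "0 \<le> \<theta>m"
begin

abbreviation "Qp \<equiv> killed_op P \<xi> \<theta>m"
abbreviation "Qm \<equiv> killed_op P' \<eta> \<theta>p"

text \<open>
  The weight of visiting \<open>B\<close> when the path starts from \<open>e\<^sup>-\<^sup>x dx\<close> at time \<open>t\<close> and
  runs backwards through \<open>ls\<close> and forwards through \<open>us\<close>. It depends only on the combined
  list of times.
\<close>
definition glued_weight :: "(real \<Rightarrow> real set) \<Rightarrow> real list \<Rightarrow> real \<Rightarrow> real list \<Rightarrow> ennreal" where
  "glued_weight B ls t us = exp_integral (\<lambda>x. indicator (B t) x * iter_op Qp B t us x * iter_op Qm B t ls x)"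

text \<open>The normal form of the glued weight: start at the first time and run forwards only.
  Every other choice of the starting time reduces to it.\<close>

definition path_weight :: "(real \<Rightarrow> real set) \<Rightarrow> real list \<Rightarrow> ennreal" where
  "path_weight B ts = glued_weight B [] (hd ts) (tl ts)"

lemma exp_integral_dual:
  assumes "0 \<le> d" "g \<in> borel_measurable borel" "h \<in> borel_measurable borel"
  shows "exp_integral (\<lambda>x. g x * Qm d h x) = exp_integral (\<lambda>y. h y * Qp d g y)"
  unfolding exp_integral_def using dual_kernels_killed_op[OF xi eta dual assms] .

lemma exp_integral_cmult: "g \<in> borel_measurable borel \<Longrightarrow> exp_integral (\<lambda>x. c * g x) = c * exp_integral g"
  unfolding exp_integral_def by (subst nn_integral_cmult[symmetric]) (auto simp: mult_ac)

text \<open>Duality tested against the constant 1 leaves the survival probability of the dual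
  process. So the total weight decays at rate \<open>\<theta>p\<close> in the forward direction,
  although the forward process is killed at rate \<open>\<theta>m\<close>.\<close>

lemma exp_integral_Qp:
  assumes d: "0 \<le> d" and g: "g \<in> borel_measurable borel"
  shows "exp_integral (Qp d g) = ennreal (exp (- \<theta>p * d)) * exp_integral g"
proof -
  have "exp_integral (Qp d g) = exp_integral (\<lambda>y. 1 * Qp d g y)" by simp
  also have "\<dots> = exp_integral (\<lambda>x. g x * Qm d (\<lambda>_. 1) x)" by (rule exp_integral_dual[OF d g, symmetric]) simp
  also have "\<dots> = exp_integral (\<lambda>x. ennreal (exp (- \<theta>p * d)) * g x)" by (simp only: killed_op_one[OF eta] mult.commute)
  finally show ?thesis by (simp only: exp_integral_cmult[OF g])
qed

lemma exp_integral_Qm: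
  assumes d: "0 \<le> d" and h: "h \<in> borel_measurable borel"
  shows "exp_integral (Qm d h) = ennreal (exp (- \<theta>m * d)) * exp_integral h"
proof -
  have "exp_integral (Qm d h) = exp_integral (\<lambda>y. 1 * Qm d h y)" by simp
  also have "\<dots> = exp_integral (\<lambda>x. h x * Qp d (\<lambda>_. 1) x)" by (rule exp_integral_dual[OF d _ h]) simp
  also have "\<dots> = exp_integral (\<lambda>x. ennreal (exp (- \<theta>m * d)) * h x)" by (simp only: killed_op_one[OF xi] mult.commute)
  finally show ?thesis by (simp only: exp_integral_cmult[OF h])
qed

context
  fixes B :: "real \<Rightarrow> real set"
  assumes B [measurable]: "\<And>t. B t \<in> sets borel"
begin

lemma iter_op_measurable [measurable]:
  "iter_op Qp B s ts \<in> borel_measurable borel" "iter_op Qm B s ts \<in> borel_measurable borel"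
  by (rule measurable_iter_op[OF xi B], rule measurable_iter_op[OF eta B])

text \<open>One use of duality: the backward step from \<open>t\<close> to \<open>l\<close> becomes
  a forward step from \<open>l\<close> to \<open>t\<close>, and the starting point moves to
  \<open>l\<close>.\<close>

lemma glued_weight_zip: "glued_weight B (l # ls) t us = glued_weight B ls l (t # us)"
proof -
  have "glued_weight B (l # ls) t us = exp_integral (\<lambda>x. (indicator (B t) x * iter_op Qp B t us x) * Qm \<bar>l - t\<bar> (\<lambda>x. indicator (B l) x * iter_op Qm B l ls x) x)"
    by (simp add: glued_weight_def)
  also have "\<dots> = exp_integral (\<lambda>y. (indicator (B l) y * iter_op Qm B l ls y) * Qp \<bar>l - t\<bar> (\<lambda>x. indicator (B t) x * iter_op Qp B t us x) y)"
    by (rule exp_integral_dual) auto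
  also have "\<dots> = glued_weight B ls l (t # us)"
    by (simp add: glued_weight_def mult_ac abs_minus_commute)
  finally show ?thesis .
qed

lemma glued_weight_eq_path_weight: "glued_weight B ls t us = path_weight B (rev (t # ls) @ us)"
proof (induction ls arbitrary: t us)
  case (Cons l ls)
  have "rev (l # ls) \<noteq> []" by simp
  then show ?case using Cons.IH[of l "t # us"] by (simp add: glued_weight_zip)
qed (simp add: path_weight_def)

text \<open>The time between the birth and the first observation is unconstrained; it costs only the
  decay of the total weight under \<open>Qp\<close>.\<close>

lemma exp_integral_birth:
  assumes "ts \<noteq> []" "s \<le> hd ts"
  shows "exp_integral (iter_op Qp B s ts) = ennreal (exp (- \<theta>p * (hd ts - s))) * path_weight B ts"
proof -
  obtain t us where ts: "ts = t # us" using assms(1) by (cases ts) auto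
  have "iter_op Qp B s (t # us) = Qp (t - s) (\<lambda>x. indicator (B t) x * iter_op Qp B t us x)"
    using ts assms(2) by (intro ext) simp
  with ts assms(2) show ?thesis
    using exp_integral_Qp[of "t - s" "\<lambda>x. indicator (B t) x * iter_op Qp B t us x"]
    by (simp add: path_weight_def glued_weight_def)
qed

text \<open>A dying path is read backwards from its death, so the weight is first brought to the
  form that starts at the last time; the unobserved time before the death then costs the decay under
  \<open>Qm\<close>.\<close>

lemma exp_integral_death:
  assumes "ts \<noteq> []" "last ts \<le> s"
  shows "exp_integral (iter_op Qm B s (rev ts)) = ennreal (exp (- \<theta>m * (s - last ts))) * path_weight B ts"
proof -
  obtain t ls where ts: "rev ts = t # ls" using assms(1) by (cases "rev ts") auto
  then have ts': "ts = rev (t # ls)" by (metis rev_rev_ident)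
  then have last: "last ts = t" by simp
  have "path_weight B ts = glued_weight B ls t []" by (simp add: glued_weight_eq_path_weight ts')
  moreover have "iter_op Qm B s (t # ls) = Qm (s - t) (\<lambda>x. indicator (B t) x * iter_op Qm B t ls x)"
    using last assms(2) by (intro ext) (simp add: abs_minus_commute)
  ultimately show ?thesis
    using exp_integral_Qm[of "s - t" "\<lambda>x. indicator (B t) x * iter_op Qm B t ls x"] assms(2)
    by (simp add: ts last glued_weight_def)
qed

text \<open>The starting time 0 need not be an observation time. Duality turns the backward step
  from 0 into a forward step towards 0, and the semigroup property merges it with the step that
  follows, so 0 disappears from the list.\<close>

lemma exp_integral_two_sided:
  assumes "ls \<noteq> []" "us \<noteq> []" "hd ls \<le> 0" "0 \<le> hd us"
  shows "exp_integral (\<lambda>x. iter_op Qm B 0 ls x * iter_op Qp B 0 us x) = path_weight B (rev ls @ us)"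
proof -
  obtain l ls' where ls: "ls = l # ls'" using assms(1) by (cases ls) auto
  obtain u us' where us: "us = u # us'" using assms(2) by (cases us) auto
  let ?g = "\<lambda>x. indicator (B u) x * iter_op Qp B u us' x" and ?h = "\<lambda>x. indicator (B l) x * iter_op Qm B l ls' x"
  have lu: "l \<le> 0" "0 \<le> u" using assms ls us by auto
  have "exp_integral (\<lambda>x. iter_op Qm B 0 ls x * iter_op Qp B 0 us x) = exp_integral (\<lambda>x. Qp u ?g x * Qm (- l) ?h x)"
    using lu by (simp add: ls us mult.commute)
  also have "\<dots> = exp_integral (\<lambda>y. ?h y * Qp (- l) (Qp u ?g) y)"
    using lu by (intro exp_integral_dual measurable_killed_op[OF xi]) auto
  also have "\<dots> = exp_integral (\<lambda>y. ?h y * Qp (u - l) ?g y)"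
    using lu by (subst killed_op_killed_op[OF xi]) auto
  also have "\<dots> = glued_weight B ls' l us"
    using lu by (simp add: glued_weight_def us mult_ac)
  also have "\<dots> = path_weight B (rev ls @ us)" by (simp add: glued_weight_eq_path_weight ls)
  finally show ?thesis .
qed

end

end

section \<open>Versions and intensities\<close>

text \<open>
  \<open>\<nu>\<close> is the law on the paths in \<open>\<Omega>\<close> of a version of a process with law \<open>Q\<close>;
  \<open>\<Omega>\<close> itself need not be measurable.
\<close>
definition version_law ::
  "real set \<Rightarrow> (real \<Rightarrow> ereal) set \<Rightarrow> (real \<Rightarrow> ereal) measure \<Rightarrow> (real \<Rightarrow> ereal) measure \<Rightarrow> bool" where
  "version_law T \<Omega> Q \<nu> \<longleftrightarrow> prob_space \<nu> \<and> sets \<nu> = sets (restrict_space (path_space T) \<Omega>) \<and>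
     (\<forall>A\<in>sets (path_space T). emeasure \<nu> (\<Omega> \<inter> A) = emeasure Q A)"

lemma version_lawI:
  assumes M: "prob_space M" and Y: "is_copy M T Q Y"
    and \<Omega>: "\<And>\<omega>. \<omega> \<in> space M \<Longrightarrow> restrict (Y \<omega>) T \<in> \<Omega>"
  shows "(\<lambda>\<omega>. restrict (Y \<omega>) T) \<in> M \<rightarrow>\<^sub>M restrict_space (path_space T) \<Omega>"
    and "version_law T \<Omega> Q (distr M (restrict_space (path_space T) \<Omega>) (\<lambda>\<omega>. restrict (Y \<omega>) T))"
proof -
  have Ym: "(\<lambda>\<omega>. restrict (Y \<omega>) T) \<in> M \<rightarrow>\<^sub>M path_space T" and Q: "distr M (path_space T) (\<lambda>\<omega>. restrict (Y \<omega>) T) = Q"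
    using Y by (auto simp: is_copy_def)
  show m: "(\<lambda>\<omega>. restrict (Y \<omega>) T) \<in> M \<rightarrow>\<^sub>M restrict_space (path_space T) \<Omega>"
    using Ym \<Omega> by (intro measurable_restrict_space2) auto
  have "emeasure (distr M (restrict_space (path_space T) \<Omega>) (\<lambda>\<omega>. restrict (Y \<omega>) T)) (\<Omega> \<inter> A) = emeasure Q A"
    if A: "A \<in> sets (path_space T)" for A
  proof -
    have "\<Omega> \<inter> A \<in> sets (restrict_space (path_space T) \<Omega>)" using A by (auto simp: sets_restrict_space)
    moreover have "(\<lambda>\<omega>. restrict (Y \<omega>) T) -` (\<Omega> \<inter> A) \<inter> space M = (\<lambda>\<omega>. restrict (Y \<omega>) T) -` A \<inter> space M"
      using \<Omega> by auto
    ultimately show ?thesis unfolding Q[symmetric] by (simp only: emeasure_distr[OF m] emeasure_distr[OF Ym A])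
  qed
  then show "version_law T \<Omega> Q (distr M (restrict_space (path_space T) \<Omega>) (\<lambda>\<omega>. restrict (Y \<omega>) T))"
    by (simp add: version_law_def prob_space.prob_space_distr[OF M m])
qed

text \<open>All sets are traces on \<open>\<Omega>\<close>, and their mass is prescribed by
  \<open>Q\<close>. Hence all copies have the same law on regular paths, on whatever probability
  space they live.\<close>

lemma version_law_unique:
  assumes "version_law T \<Omega> Q \<nu>" "version_law T \<Omega> Q \<nu>'"
  shows "\<nu> = \<nu>'"
proof (rule measure_eqI)
  show "sets \<nu> = sets \<nu>'" using assms by (simp add: version_law_def)
  fix A assume "A \<in> sets \<nu>"
  then obtain C where "C \<in> sets (path_space T)" "A = \<Omega> \<inter> C"
    using assms by (auto simp: version_law_def sets_restrict_space)
  then show "emeasure \<nu> A = emeasure \<nu>' A" using assms by (simp add: version_law_def)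
qed

lemma version_law_space: "version_law T \<Omega> Q \<nu> \<Longrightarrow> space \<nu> = \<Omega> \<inter> space (path_space T)"
  unfolding version_law_def by (metis sets_eq_imp_space_eq space_restrict_space)

lemma version_law_alive_in:
  assumes \<nu>: "version_law T \<Omega> Q \<nu>" and J: "finite J" "J \<subseteq> T" and B: "\<And>t. B t \<in> sets borel"
  shows "emeasure \<nu> {f \<in> space \<nu>. alive_in B J u f} = emeasure Q {f \<in> space (path_space T). alive_in B J u f}"
proof -
  have "{f \<in> space (path_space T). alive_in B J u f} \<in> sets (path_space T)"
    using J B by (intro sets_alive_in measurable_component_singleton) auto
  moreover have "{f \<in> space \<nu>. alive_in B J u f} = \<Omega> \<inter> {f \<in> space (path_space T). alive_in B J u f}"
    using version_law_space[OF \<nu>] by auto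
  ultimately show ?thesis using \<nu> by (simp add: version_law_def)
qed

section \<open>Survival events of born, dying and shifted paths\<close>

lemma alive_in_birth_path:
  "alive_in B J 0 (birth_path (s, v) f) \<longleftrightarrow>
    (\<forall>t\<in>J. s \<le> t) \<and> alive_in (\<lambda>r. B (r + s)) ((\<lambda>t. t - s) ` J) v f"
  unfolding alive_in_def by (force simp: birth_path_def zero_ereal_def[symmetric] split: if_splits)

lemma alive_in_death_path:
  "alive_in B J 0 (death_path (s, v) f) \<longleftrightarrow>
    (\<forall>t\<in>J. t < s) \<and> alive_in (\<lambda>r. B (s - r)) ((\<lambda>t. s - t) ` J) v f"
  unfolding alive_in_def by (force simp: death_path_def zero_ereal_def[symmetric] split: if_splits)

lemma alive_in_shift_path: "alive_in B J 0 (shift_path u f) \<longleftrightarrow> alive_in B J u f"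
  by (simp add: alive_in_def shift_path_def zero_ereal_def[symmetric])

section \<open>Integration against the intensities of points and marks\<close>

lemma sigma_finite_exp_intensity: "sigma_finite_measure exp_intensity"
  unfolding exp_intensity_def
  by (subst sigma_finite_measure.sigma_finite_iff_density_finite'[OF lborel.sigma_finite_measure_axioms]) auto

lemma sets_exp_intensity [simp, measurable_cong]: "sets exp_intensity = sets borel"
  by (simp add: exp_intensity_def)

lemma measurable_time_intensity:
  assumes f: "f \<in> borel \<Otimes>\<^sub>M borel \<rightarrow>\<^sub>M N"
  shows "f \<in> time_intensity \<theta> T \<rightarrow>\<^sub>M N"
proof -
  let ?D = "density (restrict_space lborel T) (\<lambda>_. ennreal \<theta>)"
  have "(\<lambda>x. x) \<in> restrict_space lborel T \<rightarrow>\<^sub>M borel" by (intro measurable_restrict_space1) simp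
  then have [measurable]: "(\<lambda>x. x) \<in> ?D \<rightarrow>\<^sub>M borel" by simp
  have [measurable]: "(\<lambda>x. x) \<in> exp_intensity \<rightarrow>\<^sub>M borel" by (simp add: exp_intensity_def)
  have "(\<lambda>p. (fst p, snd p)) \<in> ?D \<Otimes>\<^sub>M exp_intensity \<rightarrow>\<^sub>M borel \<Otimes>\<^sub>M borel"
    by (intro measurable_Pair measurable_compose[OF measurable_fst] measurable_compose[OF measurable_snd]) measurable
  from measurable_compose[OF this f] show ?thesis by (simp add: time_intensity_def)
qed

lemma nn_integral_time_intensity:
  assumes T: "T \<in> sets borel" and g [measurable]: "g \<in> borel_measurable (borel \<Otimes>\<^sub>M borel)"
  shows "(\<integral>\<^sup>+p. g p \<partial>time_intensity \<theta> T)
    = (\<integral>\<^sup>+s. indicator T s * (ennreal \<theta> * exp_integral (\<lambda>v. g (s, v))) \<partial>lborel)"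
proof -
  interpret e: sigma_finite_measure exp_intensity by (rule sigma_finite_exp_intensity)
  let ?D = "density (restrict_space lborel T) (\<lambda>_. ennreal \<theta>)"
  have g': "g \<in> borel_measurable (?D \<Otimes>\<^sub>M exp_intensity)"
    using measurable_time_intensity[OF g] by (simp add: time_intensity_def)
  have w: "(\<lambda>s. exp_integral (\<lambda>v. g (s, v))) \<in> borel_measurable borel"
    unfolding exp_integral_def by measurable
  have "(\<integral>\<^sup>+p. g p \<partial>time_intensity \<theta> T) = (\<integral>\<^sup>+s. (\<integral>\<^sup>+v. g (s, v) \<partial>exp_intensity) \<partial>?D)"
    unfolding time_intensity_def by (rule e.nn_integral_fst[OF g', symmetric])
  also have "\<dots> = (\<integral>\<^sup>+s. exp_integral (\<lambda>v. g (s, v)) \<partial>?D)"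
    by (intro nn_integral_cong nn_integral_exp_intensity) measurable
  also have "\<dots> = (\<integral>\<^sup>+s. ennreal \<theta> * exp_integral (\<lambda>v. g (s, v)) \<partial>restrict_space lborel T)"
    using w by (intro nn_integral_density) (auto intro: measurable_restrict_space1)
  also have "\<dots> = (\<integral>\<^sup>+s. indicator T s * (ennreal \<theta> * exp_integral (\<lambda>v. g (s, v))) \<partial>lborel)"
    using T by (subst nn_integral_restrict_space) (auto simp: mult.commute)
  finally show ?thesis .
qed

lemma emeasure_marked:
  assumes \<nu>: "prob_space \<nu>" and F: "(\<lambda>(x, f). F x f) \<in> \<mu> \<Otimes>\<^sub>M \<nu> \<rightarrow>\<^sub>M S" and C: "C \<in> sets S"
  shows "emeasure (distr (\<mu> \<Otimes>\<^sub>M \<nu>) S (\<lambda>(x, f). F x f)) C = (\<integral>\<^sup>+x. emeasure \<nu> {f \<in> space \<nu>. F x f \<in> C} \<partial>\<mu>)"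
    and "(\<lambda>x. emeasure \<nu> {f \<in> space \<nu>. F x f \<in> C}) \<in> borel_measurable \<mu>"
proof -
  interpret prob_space \<nu> by fact
  let ?X = "(\<lambda>(x, f). F x f) -` C \<inter> space (\<mu> \<Otimes>\<^sub>M \<nu>)"
  have X: "?X \<in> sets (\<mu> \<Otimes>\<^sub>M \<nu>)" by (rule measurable_sets[OF F C])
  have eq: "Pair x -` ?X = {f \<in> space \<nu>. F x f \<in> C}" if "x \<in> space \<mu>" for x
    using that by (auto simp: space_pair_measure)
  have "emeasure (distr (\<mu> \<Otimes>\<^sub>M \<nu>) S (\<lambda>(x, f). F x f)) C = (\<integral>\<^sup>+x. emeasure \<nu> (Pair x -` ?X) \<partial>\<mu>)"
    unfolding emeasure_distr[OF F C] by (rule emeasure_pair_measure_alt[OF X])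
  also have "\<dots> = (\<integral>\<^sup>+x. emeasure \<nu> {f \<in> space \<nu>. F x f \<in> C} \<partial>\<mu>)"
    by (intro nn_integral_cong) (simp only: eq)
  finally show "emeasure (distr (\<mu> \<Otimes>\<^sub>M \<nu>) S (\<lambda>(x, f). F x f)) C = (\<integral>\<^sup>+x. emeasure \<nu> {f \<in> space \<nu>. F x f \<in> C} \<partial>\<mu>)" .
  have "(\<lambda>x. emeasure \<nu> (Pair x -` ?X)) \<in> borel_measurable \<mu>"
    by (rule measurable_emeasure_Pair[OF X])
  then show "(\<lambda>x. emeasure \<nu> {f \<in> space \<nu>. F x f \<in> C}) \<in> borel_measurable \<mu>"
    by (rule measurable_cong[THEN iffD1, rotated]) (simp only: eq)
qed

text \<open>In terms of the age \<open>t - s\<close> at time \<open>t\<close> this is the total mass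
  of the exponential law. A positive rate is essential: for rate 0 the integral is 0.\<close>

lemma nn_integral_birth_times:
  assumes "0 < \<theta>"
  shows "(\<integral>\<^sup>+s. indicator {..t} s * ennreal (\<theta> * exp (- \<theta> * (t - s))) \<partial>lborel) = 1"
proof -
  have "(\<integral>\<^sup>+s. indicator {..t} s * ennreal (\<theta> * exp (- \<theta> * (t - s))) \<partial>lborel)
      = (\<integral>\<^sup>+r. indicator {..t} (t + - 1 * r) * ennreal (\<theta> * exp (- \<theta> * (t - (t + - 1 * r)))) \<partial>lborel)"
    by (subst nn_integral_real_affine[where c="-1" and t=t]) auto
  also have "\<dots> = (\<integral>\<^sup>+r\<in>{0..}. ennreal (\<theta> * exp (- \<theta> * r)) \<partial>lborel)"
    by (intro nn_integral_cong) (auto simp: indicator_def)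
  also have "\<dots> = ennreal (0 - (- exp (- \<theta> * 0)))"
  proof (rule nn_integral_FTC_atLeast)
    show "((\<lambda>r. - exp (- \<theta> * r)) \<longlongrightarrow> 0) at_top"
      using assms by real_asymp
    show "((\<lambda>r. - exp (- \<theta> * r)) has_real_derivative \<theta> * exp (- \<theta> * r)) (at r)" for r
      by (auto intro!: derivative_eq_intros)
  qed (use assms in auto)
  finally show ?thesis by simp
qed

text \<open>Births between 0 and \<open>t\<close> supply exactly what the share
  \<open>exp (- \<theta> * t)\<close> of paths through 0 leaves missing from 1.\<close>

lemma nn_integral_birth_times_pos:
  assumes "0 \<le> \<theta>" "0 \<le> t"
  shows "(\<integral>\<^sup>+s. indicator {0<..} s * (indicator {..t} s * ennreal (\<theta> * exp (- \<theta> * (t - s)))) \<partial>lborel) = ennreal (1 - exp (- \<theta> * t))"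
proof -
  have "(\<integral>\<^sup>+s. indicator {0<..} s * (indicator {..t} s * ennreal (\<theta> * exp (- \<theta> * (t - s)))) \<partial>lborel)
      = (\<integral>\<^sup>+s\<in>{0..t}. ennreal (\<theta> * exp (- \<theta> * (t - s))) \<partial>lborel)"
    using AE_lborel_singleton[of 0] by (intro nn_integral_cong_AE) (auto simp: indicator_def)
  also have "\<dots> = ennreal (exp (- \<theta> * (t - t)) - exp (- \<theta> * (t - 0)))"
    using assms by (intro nn_integral_FTC_Icc) (auto intro!: derivative_eq_intros)
  finally show ?thesis by simp
qed

lemma nn_integral_death_times_neg:
  assumes "0 \<le> \<theta>" "t \<le> 0"
  shows "(\<integral>\<^sup>+s. indicator {..<0} s * (indicator {t<..} s * ennreal (\<theta> * exp (- \<theta> * (s - t)))) \<partial>lborel) = ennreal (1 - exp (\<theta> * t))"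
proof -
  have "(\<integral>\<^sup>+s. indicator {..<0} s * (indicator {t<..} s * ennreal (\<theta> * exp (- \<theta> * (s - t)))) \<partial>lborel)
      = (\<integral>\<^sup>+s\<in>{t..0}. ennreal (\<theta> * exp (- \<theta> * (s - t))) \<partial>lborel)"
    using AE_lborel_singleton[of 0] AE_lborel_singleton[of t]
    by (intro nn_integral_cong_AE) (auto simp: indicator_def)
  also have "\<dots> = ennreal (- exp (- \<theta> * (0 - t)) - - exp (- \<theta> * (t - t)))"
    using assms by (intro nn_integral_FTC_Icc) (auto intro!: derivative_eq_intros)
  finally show ?thesis by simp
qed

section \<open>Measures on the path space\<close>

lemma measurable_pair_coarsen:
  assumes f: "f \<in> A \<Otimes>\<^sub>M B \<rightarrow>\<^sub>M S" and A: "(\<lambda>x. x) \<in> A' \<rightarrow>\<^sub>M A" and B: "(\<lambda>x. x) \<in> B' \<rightarrow>\<^sub>M B"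
  shows "f \<in> A' \<Otimes>\<^sub>M B' \<rightarrow>\<^sub>M S"
proof -
  have "(\<lambda>p. (fst p, snd p)) \<in> A' \<Otimes>\<^sub>M B' \<rightarrow>\<^sub>M A \<Otimes>\<^sub>M B"
    by (intro measurable_Pair measurable_compose[OF measurable_fst A] measurable_compose[OF measurable_snd B])
  from measurable_compose[OF this f] show ?thesis by simp
qed

section \<open>Cylinder sets of living paths and uniqueness of measures\<close>

definition cylinder :: "(real \<Rightarrow> real set) \<Rightarrow> real set \<Rightarrow> (real \<Rightarrow> ereal) set" where
  "cylinder B J = {f \<in> space Dbar. alive_in B J 0 f}"

lemma sets_cylinder: "finite J \<Longrightarrow> (\<And>t. B t \<in> sets borel) \<Longrightarrow> cylinder B J \<in> sets Dbar"
  unfolding cylinder_def by (intro sets_alive_in) auto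

lemma space_Dbar: "f \<in> space Dbar \<longleftrightarrow> cadlag_on UNIV f"
  by (simp add: Dbar_def space_restrict_space space_PiM)

lemma cylinder_singleton: "cylinder (\<lambda>_. S) {t} = {f \<in> space Dbar. f t \<in> ereal ` S}"
  by (simp add: cylinder_def alive_in_def zero_ereal_def[symmetric])

text \<open>At a time in only one of the index sets the other condition becomes \<open>UNIV\<close>,
  which asks for mere survival; the first condition already forces that.\<close>

lemma cylinder_Int:
  "cylinder B J \<inter> cylinder B' J' =
    cylinder (\<lambda>t. (if t \<in> J then B t else UNIV) \<inter> (if t \<in> J' then B' t else UNIV)) (J \<union> J')"
proof -
  have "x \<in> ereal ` ((if t \<in> J then B t else UNIV) \<inter> (if t \<in> J' then B' t else UNIV)) \<longleftrightarrow>
      (t \<in> J \<longrightarrow> x \<in> ereal ` B t) \<and> (t \<in> J' \<longrightarrow> x \<in> ereal ` B' t)" if "t \<in> J \<union> J'" for x t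
    using that by (cases "t \<in> J"; cases "t \<in> J'") (simp_all add: image_Int)
  then show ?thesis unfolding cylinder_def alive_in_def by blast
qed

text \<open>The weights are computed for at least one observation time, so \<open>J\<close> is
  non-empty. The whole space is added separately, as the covering set that uniqueness of measures
  requires.\<close>

definition cylinders :: "(real \<Rightarrow> ereal) set set" where
  "cylinders = insert (space Dbar) {cylinder B J |B J. finite J \<and> J \<noteq> {} \<and> (\<forall>t. B t \<in> sets borel)}"

lemma cylinder_in_cylinders: "finite J \<Longrightarrow> J \<noteq> {} \<Longrightarrow> (\<And>t. B t \<in> sets borel) \<Longrightarrow> cylinder B J \<in> cylinders"
  unfolding cylinders_def by (intro insertI2 CollectI exI[of _ B] exI[of _ J]) simp

lemma cylindersE:
  assumes "X \<in> cylinders"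
  obtains "X = space Dbar" | B J where "X = cylinder B J" "finite J" "J \<noteq> {}" "\<And>t. B t \<in> sets borel"
  using assms by (auto simp: cylinders_def)

lemma Int_stable_cylinders: "Int_stable cylinders"
proof (rule Int_stableI)
  fix X Y assume X: "X \<in> cylinders" and Y: "Y \<in> cylinders"
  have sub: "Z \<in> cylinders \<Longrightarrow> Z \<subseteq> space Dbar" for Z by (auto simp: cylinders_def cylinder_def)
  show "X \<inter> Y \<in> cylinders"
  proof (cases "X = space Dbar \<or> Y = space Dbar")
    case True
    then show ?thesis using X Y sub by (auto simp: Int_absorb1 Int_absorb2)
  next
    case False
    then obtain B J B' J' where "X = cylinder B J" "finite J" "J \<noteq> {}" "\<And>t. B t \<in> sets borel"
      and "Y = cylinder B' J'" "finite J'" "\<And>t. B' t \<in> sets borel"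
      using X Y unfolding cylinders_def by blast
    note XY = this
    let ?B = "\<lambda>t. (if t \<in> J then B t else UNIV) \<inter> (if t \<in> J' then B' t else UNIV)"
    have "?B t \<in> sets borel" for t using XY(4,7) by (intro sets.Int) (auto split: if_splits)
    then have "cylinder ?B (J \<union> J') \<in> cylinders"
      using XY unfolding cylinders_def by (intro insertI2 CollectI exI[of _ ?B] exI[of _ "J \<union> J'"]) simp
    then show ?thesis unfolding XY(1,5) cylinder_Int .
  qed
qed

text \<open>Cylinder sets describe real values only. Since \<open>\<infinity>\<close> is not a value
  of a path in \<open>Dbar\<close>, being \<open>- \<infinity>\<close> at time \<open>t\<close> is
  the complement of being alive there, so the evaluations are measurable for the generated
  sigma-algebra.\<close>

lemma sets_Dbar_eq_cylinders: "sets Dbar = sigma_sets (space Dbar) cylinders"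
proof
  show "sigma_sets (space Dbar) cylinders \<subseteq> sets Dbar"
    by (rule sets.sigma_sets_subset) (auto simp: cylinders_def intro: sets_cylinder)
next
  let ?G = "sigma (space Dbar) cylinders"
  have sub: "cylinders \<subseteq> Pow (space Dbar)" by (auto simp: cylinders_def cylinder_def)
  have G: "space ?G = space Dbar" "sets ?G = sigma_sets (space Dbar) cylinders"
    using sub by (simp_all add: space_measure_of sets_measure_of)
  have base: "cylinder (\<lambda>_. S) {t} \<in> sets ?G" if "S \<in> sets borel" for S t
    unfolding G using that by (intro sigma_sets.Basic) (auto simp: cylinders_def)
  have "(\<lambda>f. f) \<in> ?G \<rightarrow>\<^sub>M Dbar"
  proof (rule measurable_into_Dbar)
    fix t
    show "(\<lambda>f. f t) \<in> borel_measurable ?G"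
    proof (rule measurableI)
      fix A :: "ereal set" assume A: "A \<in> sets borel"
      have R: "ereal -` A \<in> sets borel" using measurable_sets[OF borel_measurable_ereal[OF measurable_ident] A] by simp
      have fin: "f t = - \<infinity> \<or> (\<exists>r. f t = ereal r)" if "f \<in> space Dbar" for f
        using cadlag_onD(1)[of UNIV f t] that by (cases "f t") (auto simp: space_Dbar)
      show "(\<lambda>f. f t) -` A \<inter> space ?G \<in> sets ?G"
      proof (cases "- \<infinity> \<in> A")
        case True
        have "(\<lambda>f. f t) -` A \<inter> space ?G = space ?G - cylinder (\<lambda>_. - (ereal -` A)) {t}"
          unfolding cylinder_singleton G using fin True by fastforce
        then show ?thesis using base[of "- (ereal -` A)" t] R by auto
      next
        case False
        have "(\<lambda>f. f t) -` A \<inter> space ?G = cylinder (\<lambda>_. ereal -` A) {t}"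
          unfolding cylinder_singleton G using fin False by fastforce
        then show ?thesis using base[OF R, of t] by simp
      qed
    qed simp
  qed (simp add: G space_Dbar)
  then show "sets Dbar \<subseteq> sigma_sets (space Dbar) cylinders"
    unfolding G(2)[symmetric] using measurable_sets[of "\<lambda>f. f" ?G Dbar] sets.sets_into_space[of _ Dbar]
    by (auto simp: G(1) Int_absorb2)
qed

definition null_paths :: "(real \<Rightarrow> ereal) set" where
  "null_paths = {f \<in> space Dbar. \<forall>t. f t = - \<infinity>}"

text \<open>A path above \<open>- \<infinity>\<close> at some time stays above it on an interval to
  the right, and that interval contains a rational number.\<close>

lemma cadlag_rat_eq_bot:
  assumes f: "cadlag_on UNIV f" and q: "\<And>q. q \<in> \<rat> \<Longrightarrow> f q = - \<infinity>"
  shows "f t = - \<infinity>"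
proof (rule ccontr)
  assume "f t \<noteq> - \<infinity>"
  then have "- \<infinity> < f t" by simp
  with cadlag_onD(2)[OF f, of t] have "\<forall>\<^sub>F x in at_right t. - \<infinity> < f x"
    by (intro order_tendstoD(1)) auto
  then obtain b where b: "t < b" "\<And>x. t < x \<Longrightarrow> x < b \<Longrightarrow> - \<infinity> < f x"
    unfolding eventually_at_right[OF less_add_one[of t]] by blast
  obtain r where "r \<in> \<rat>" "t < r" "r < b" using Rats_dense_in_real[OF b(1)] by auto
  then show False using b(2)[of r] q[of r] by simp
qed

text \<open>Both measures may be infinite, so uniqueness is applied to their restrictions to sets on
  which the path exceeds \<open>- real k\<close> at one time. Countably many of these, with rational
  times, cover all paths that are ever alive, and the rest has measure 0.\<close>

lemma measure_Dbar_eqI: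
  assumes M: "sets M = sets Dbar" and N: "sets N = sets Dbar"
    and null: "emeasure M null_paths = 0" "emeasure N null_paths = 0"
    and eq: "\<And>B J. finite J \<Longrightarrow> J \<noteq> {} \<Longrightarrow> (\<And>t. B t \<in> sets borel) \<Longrightarrow> emeasure M (cylinder B J) = emeasure N (cylinder B J)"
    and fin: "\<And>t k. emeasure M (cylinder (\<lambda>_. {- real k<..}) {t}) \<noteq> \<infinity>"
  shows "M = N"
proof (rule measure_eqI)
  show "sets M = sets N" using M N by simp
  \<comment> \<open>One sequence runs through all pairs of a rational time and a level.\<close>
  define C where "C i = (let (j, k) = prod_decode i in cylinder (\<lambda>_. {- real k<..}) {from_nat_into \<rat> j})" for i
  have Cm: "C i \<in> sets Dbar" for i
    unfolding C_def Let_def by (auto intro!: sets_cylinder split: prod.splits)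
  have Ceq: "emeasure M (C i \<inter> A) = emeasure N (C i \<inter> A)" if A: "A \<in> sets Dbar" for i A
  proof -
    obtain t k where C: "C i = cylinder (\<lambda>_. {- real k<..}) {t}"
      unfolding C_def Let_def by (cases "prod_decode i") auto
    have emM: "emeasure (density M (indicator (C i))) X = emeasure M (C i \<inter> X)" if "X \<in> sets Dbar" for X
      using that Cm M by (intro emeasure_restricted) auto
    have emN: "emeasure (density N (indicator (C i))) X = emeasure N (C i \<inter> X)" if "X \<in> sets Dbar" for X
      using that Cm N by (intro emeasure_restricted) auto
    have cylindersD: "X \<in> sets Dbar" if "X \<in> cylinders" for X
      using that unfolding sets_Dbar_eq_cylinders by (rule sigma_sets.Basic)
    have C_cylinders: "C i \<in> cylinders" unfolding C by (rule cylinder_in_cylinders) auto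
    have eq': "emeasure M X = emeasure N X" if "X \<in> cylinders" "X \<noteq> space Dbar" for X
      using that by (elim cylindersE) (simp_all add: eq)
    have eqC: "emeasure M (C i \<inter> X) = emeasure N (C i \<inter> X)" if "X \<in> cylinders" for X
    \<comment> \<open>Agreement on the whole space is not known in advance; if the intersection is
      the whole space, then so is \<open>C i\<close>, which is itself a cylinder set with one
      time.\<close>
    proof (cases "C i \<inter> X = space Dbar")
      case True
      then have "C i = space Dbar" using sets.sets_into_space[OF Cm[of i]] by auto
      then show ?thesis using True eq[of "{t}" "\<lambda>_. {- real k<..}"] C by simp
    next
      case False
      then show ?thesis using Int_stableD[OF Int_stable_cylinders C_cylinders that] eq' by blast
    qed
    have "density M (indicator (C i)) = density N (indicator (C i))"
    proof (rule measure_eqI_generator_eq[OF Int_stable_cylinders, where A="\<lambda>_. space Dbar"])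
      show "cylinders \<subseteq> Pow (space Dbar)" using cylindersD sets.sets_into_space by blast
      show "emeasure (density M (indicator (C i))) X = emeasure (density N (indicator (C i))) X" if "X \<in> cylinders" for X
        using that by (simp add: emM emN cylindersD eqC)
      show "sets (density M (indicator (C i))) = sigma_sets (space Dbar) cylinders"
        "sets (density N (indicator (C i))) = sigma_sets (space Dbar) cylinders"
        by (simp_all add: M N sets_Dbar_eq_cylinders)
      show "range (\<lambda>_. space Dbar) \<subseteq> cylinders" by (auto simp: cylinders_def)
      show "(\<Union>x. space Dbar) = space Dbar" by simp
      show "emeasure (density M (indicator (C i))) (space Dbar) \<noteq> \<infinity>"
        unfolding emM[OF sets.top] using fin[of k t] sets.sets_into_space[OF Cm[of i]] C
        by (simp add: Int_absorb2)
    qed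
    then show ?thesis using A by (simp add: emM[symmetric] emN[symmetric])
  qed
  have null_eq: "null_paths = space Dbar - (\<Union>i. C i)"
    proof (intro set_eqI iffI)
      fix f assume "f \<in> null_paths"
      then show "f \<in> space Dbar - (\<Union>i. C i)"
        by (auto simp: null_paths_def C_def Let_def cylinder_singleton split: prod.splits)
    next
      fix f assume f: "f \<in> space Dbar - (\<Union>i. C i)"
      have "f q = - \<infinity>" if q: "q \<in> \<rat>" for q
      proof (rule ccontr)
        assume "f q \<noteq> - \<infinity>"
        then obtain r where r: "f q = ereal r"
          using f cadlag_onD(1)[of UNIV f q] by (cases "f q") (auto simp: space_Dbar)
        obtain k :: nat where k: "- r < real k" using reals_Archimedean2 by blast
        obtain j where j: "from_nat_into \<rat> j = q"
          using from_nat_into_surj[OF countable_rat q] by blast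
        have "f \<in> C (prod_encode (j, k))"
          using f r k j by (auto simp: C_def cylinder_singleton)
        with f show False by blast
      qed
      then show "f \<in> null_paths" using f cadlag_rat_eq_bot[of f] by (auto simp: null_paths_def space_Dbar)
    qed
  have null_m: "null_paths \<in> sets Dbar" unfolding null_eq using Cm by auto
  fix A assume "A \<in> sets M"
  then have A: "A \<in> sets Dbar" using M by simp
  \<comment> \<open>Discarding the null path leaves the union of the \<open>C i\<close>, and
    disjoint pieces of it let the local equalities be summed.\<close>
  have decomp: "emeasure L A = (\<Sum>i. emeasure L (A \<inter> disjointed C i))"
    if L: "sets L = sets Dbar" and Lnull: "emeasure L null_paths = 0" for L
  proof -
    have D: "disjointed C i \<in> sets L" for i
      using Cm L unfolding disjointed_def by auto
    have "emeasure L A = emeasure L (A \<inter> (\<Union>i. C i))"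
    proof (rule emeasure_eq_AE)
      have "AE f in L. f \<notin> null_paths" using Lnull null_m L by (intro AE_not_in null_setsI) auto
      then show "AE f in L. f \<in> A \<longleftrightarrow> f \<in> A \<inter> (\<Union>i. C i)"
        using null_eq sets_eq_imp_space_eq[OF L] by (elim AE_mp, intro AE_I2) auto
      show "A \<in> sets L" "A \<inter> (\<Union>i. C i) \<in> sets L" using A Cm L by auto
    qed
    also have "A \<inter> (\<Union>i. C i) = (\<Union>i. A \<inter> disjointed C i)"
      using UN_disjointed_eq[of C] by blast
    also have "emeasure L \<dots> = (\<Sum>i. emeasure L (A \<inter> disjointed C i))"
    proof (rule suminf_emeasure[symmetric])
      show "range (\<lambda>i. A \<inter> disjointed C i) \<subseteq> sets L" using A D L by auto
      show "disjoint_family (\<lambda>i. A \<inter> disjointed C i)"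
        using disjoint_family_disjointed[of C] unfolding disjoint_family_on_def by blast
    qed
    finally show ?thesis .
  qed
  have "emeasure M (A \<inter> disjointed C i) = emeasure N (A \<inter> disjointed C i)" for i
  proof -
    have D: "disjointed C i \<in> sets Dbar" using Cm unfolding disjointed_def by auto
    have "C i \<inter> (A \<inter> disjointed C i) = A \<inter> disjointed C i" using disjointed_subset[of C i] by auto
    with Ceq[OF sets.Int[OF A D], of i] show ?thesis by simp
  qed
  then show "emeasure M A = emeasure N A"
    by (simp add: decomp[OF M null(1)] decomp[OF N null(2)])
qed

section \<open>The sum of two measures\<close>

definition sum_measure :: "'a measure \<Rightarrow> 'a measure \<Rightarrow> 'a measure" where
  "sum_measure M N = measure_of (space M) (sets M) (\<lambda>A. emeasure M A + emeasure N A)"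

lemma sets_sum_measure [simp]: "sets (sum_measure M N) = sets M"
  by (simp add: sum_measure_def)

lemma emeasure_sum_measure:
  assumes "sets N = sets M" "A \<in> sets M"
  shows "emeasure (sum_measure M N) A = emeasure M A + emeasure N A"
  unfolding sum_measure_def
proof (rule emeasure_measure_of_sigma)
  show "sigma_algebra (space M) (sets M)" ..
  show "positive (sets M) (\<lambda>A. emeasure M A + emeasure N A)" by (simp add: positive_def)
  show "countably_additive (sets M) (\<lambda>A. emeasure M A + emeasure N A)"
  proof (rule countably_additiveI)
    fix F :: "nat \<Rightarrow> 'a set" assume F: "range F \<subseteq> sets M" "disjoint_family F"
    have "(\<Sum>i. emeasure M (F i) + emeasure N (F i)) = (\<Sum>i. emeasure M (F i)) + (\<Sum>i. emeasure N (F i))"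
      by (rule suminf_add[symmetric]) auto
    also have "\<dots> = emeasure M (\<Union>i. F i) + emeasure N (\<Union>i. F i)"
      using F assms(1) by (simp add: suminf_emeasure)
    finally show "(\<Sum>i. emeasure M (F i) + emeasure N (F i)) = emeasure M (\<Union>i. F i) + emeasure N (\<Union>i. F i)" .
  qed
qed (use assms in auto)

section \<open>Intensities of cylinder sets\<close>

lemma sorted_shift: "sorted ts \<Longrightarrow> s \<le> hd ts \<Longrightarrow> sorted (0 # map (\<lambda>t. t - s) ts)" for s :: real
  by (cases ts) (auto simp: sorted_wrt_map)

lemma sorted_reflect:
  fixes s :: real
  assumes "sorted ts" "ts \<noteq> []" "last ts \<le> s"
  shows "sorted (0 # map (\<lambda>t. s - t) (rev ts))"
proof -
  have "t \<le> last ts" if "t \<in> set ts" for t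
    using assms(1) that by (induction ts) auto
  then have "t \<le> s" if "t \<in> set ts" for t
    using that assms(3) by (meson order_trans)
  then show ?thesis using assms by (auto simp: sorted_wrt_map sorted_wrt_rev elim: sorted_wrt_mono_rel[rotated])
qed

lemma hd_le: "sorted ts \<Longrightarrow> t \<in> set ts \<Longrightarrow> hd ts \<le> t" for t :: real
  by (cases ts) auto

lemma le_last: "sorted ts \<Longrightarrow> t \<in> set ts \<Longrightarrow> t \<le> last ts" for t :: real
  by (induction ts) auto

locale dual_levy_versions = dual_levy_pair +
  fixes \<nu>p \<nu>m \<nu>0 :: "(real \<Rightarrow> ereal) measure"
  assumes \<nu>p: "version_law {0..} {f. cadlag_on {0..} f} (killed_law P \<xi> \<theta>m) \<nu>p"
    and \<nu>m: "version_law {0..} {f. caglad_on {0..} f} (killed_law P' \<eta> \<theta>p) \<nu>m"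
    and \<nu>0: "version_law UNIV {f. cadlag_on UNIV f}
      (two_sided_law (killed_law P \<xi> \<theta>m) (killed_law P' \<eta> \<theta>p)) \<nu>0"
begin

lemma prob_\<nu>: "prob_space \<nu>p" "prob_space \<nu>m" "prob_space \<nu>0"
  using \<nu>p \<nu>m \<nu>0 by (auto simp: version_law_def)

lemma sets_\<nu>: "sets \<nu>p = sets cadlag_paths" "sets \<nu>m = sets caglad_paths" "sets \<nu>0 = sets Dbar"
  using \<nu>p \<nu>m \<nu>0 by (auto simp: version_law_def cadlag_paths_def caglad_paths_def Dbar_def)

text \<open>With births at all times this will be the intensity of \<open>\<Pi>'\<close>; with
  births in \<open>{0<..}\<close> it is the contribution of the paths of \<open>\<Pi>\<close> that
  are born.\<close>

definition birth_measure :: "real set \<Rightarrow> (real \<Rightarrow> ereal) measure" where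
  "birth_measure T = distr (time_intensity \<theta>p T \<Otimes>\<^sub>M \<nu>p) Dbar (\<lambda>(p, f). birth_path p f)"

definition death_measure :: "(real \<Rightarrow> ereal) measure" where
  "death_measure = distr (time_intensity \<theta>m {..<0} \<Otimes>\<^sub>M \<nu>m) Dbar (\<lambda>(p, f). death_path p f)"

definition line_measure :: "(real \<Rightarrow> ereal) measure" where
  "line_measure = distr (exp_intensity \<Otimes>\<^sub>M \<nu>0) Dbar (\<lambda>(u, f). shift_path u f)"

lemma ident_measurable:
  "(\<lambda>x. x) \<in> \<nu>p \<rightarrow>\<^sub>M cadlag_paths" "(\<lambda>x. x) \<in> \<nu>m \<rightarrow>\<^sub>M caglad_paths" "(\<lambda>x. x) \<in> \<nu>0 \<rightarrow>\<^sub>M Dbar"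
  by (simp_all add: measurable_ident_sets sets_\<nu>)

lemma measurable_birth [measurable]:
  "(\<lambda>(p, f). birth_path p f) \<in> (borel \<Otimes>\<^sub>M borel) \<Otimes>\<^sub>M \<nu>p \<rightarrow>\<^sub>M Dbar"
  "(\<lambda>(p, f). birth_path p f) \<in> time_intensity \<theta> T \<Otimes>\<^sub>M \<nu>p \<rightarrow>\<^sub>M Dbar"
  by (rule measurable_pair_coarsen[OF measurable_birth_path _ ident_measurable(1)];
      auto intro: measurable_time_intensity)+

lemma measurable_death [measurable]:
  "(\<lambda>(p, f). death_path p f) \<in> (borel \<Otimes>\<^sub>M borel) \<Otimes>\<^sub>M \<nu>m \<rightarrow>\<^sub>M Dbar"
  "(\<lambda>(p, f). death_path p f) \<in> time_intensity \<theta> T \<Otimes>\<^sub>M \<nu>m \<rightarrow>\<^sub>M Dbar"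
  by (rule measurable_pair_coarsen[OF measurable_death_path _ ident_measurable(2)];
      auto intro: measurable_time_intensity)+

lemma measurable_line [measurable]:
  "(\<lambda>(u, f). shift_path u f) \<in> borel \<Otimes>\<^sub>M \<nu>0 \<rightarrow>\<^sub>M Dbar"
  "(\<lambda>(u, f). shift_path u f) \<in> exp_intensity \<Otimes>\<^sub>M \<nu>0 \<rightarrow>\<^sub>M Dbar"
  by (rule measurable_pair_coarsen[OF measurable_shift_path _ ident_measurable(3)];
      simp add: measurable_ident_sets)+

lemma space_\<nu>: "f \<in> space \<nu>p \<Longrightarrow> cadlag_on {0..} f" "f \<in> space \<nu>m \<Longrightarrow> caglad_on {0..} f"
    "f \<in> space \<nu>0 \<longleftrightarrow> f \<in> space Dbar"
  using version_law_space[OF \<nu>p] version_law_space[OF \<nu>m] sets_eq_imp_space_eq[OF sets_\<nu>(3)] by auto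

section \<open>Mass of one cylinder set under each component\<close>

context
  fixes B :: "real \<Rightarrow> real set" and ts :: "real list"
  assumes B: "\<And>t. B t \<in> sets borel" and ts: "sorted ts" "ts \<noteq> []"
begin

text \<open>The event constrains the mark at the ages \<open>t - s\<close>, and translation by
  \<open>s\<close> restores the original times. A path born after the first observation cannot be
  alive at it.\<close>

lemma birth_prob:
  "emeasure \<nu>p {f \<in> space \<nu>p. birth_path (s, v) f \<in> cylinder B (set ts)}
    = (if s \<le> hd ts then iter_op Qp B s ts v else 0)"
proof (cases "s \<le> hd ts")
  case True
  then have le: "\<forall>t\<in>set ts. s \<le> t" using hd_le[OF ts(1)] by force
  let ?B = "\<lambda>r. B (r + s)" and ?ts = "map (\<lambda>t. t - s) ts"
  have "{f \<in> space \<nu>p. birth_path (s, v) f \<in> cylinder B (set ts)} = {f \<in> space \<nu>p. alive_in ?B (set ?ts) v f}"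
    using le space_\<nu>(1) cadlag_birth_path by (auto simp: cylinder_def space_Dbar alive_in_birth_path)
  then have "emeasure \<nu>p {f \<in> space \<nu>p. birth_path (s, v) f \<in> cylinder B (set ts)}
    = emeasure (killed_law P \<xi> \<theta>m) {f \<in> space (path_space {0..}). alive_in ?B (set ?ts) v f}"
    using le B by (subst version_law_alive_in[OF \<nu>p, symmetric]) auto
  also have "\<dots> = iter_op Qp ?B 0 ?ts v"
    by (rule fdd_killed_law[OF xi rate_nonneg(2) B sorted_shift[OF ts(1) True]])
  also have "\<dots> = iter_op Qp B (0 + s) (map (\<lambda>r. r + s) ?ts) v"
    by (rule iter_op_reindex[symmetric]) simp
  finally show ?thesis using True by (simp add: o_def)
next
  case False
  then have "\<not> (\<forall>t\<in>set ts. s \<le> t)" using ts(2) hd_in_set by blast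
  then have e: "{f \<in> space \<nu>p. birth_path (s, v) f \<in> cylinder B (set ts)} = {}"
    by (auto simp: cylinder_def alive_in_birth_path)
  show ?thesis unfolding e using False by simp
qed

lemma death_prob:
  "emeasure \<nu>m {f \<in> space \<nu>m. death_path (s, v) f \<in> cylinder B (set ts)}
    = (if last ts < s then iter_op Qm B s (rev ts) v else 0)"
proof (cases "last ts < s")
  case True
  then have le: "\<forall>t\<in>set ts. t < s" using le_last[OF ts(1)] by force
  let ?B = "\<lambda>r. B (s - r)" and ?ts = "map (\<lambda>t. s - t) (rev ts)"
  have "{f \<in> space \<nu>m. death_path (s, v) f \<in> cylinder B (set ts)} = {f \<in> space \<nu>m. alive_in ?B (set ?ts) v f}"
    using le space_\<nu>(2) cadlag_death_path by (auto simp: cylinder_def space_Dbar alive_in_death_path)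
  then have "emeasure \<nu>m {f \<in> space \<nu>m. death_path (s, v) f \<in> cylinder B (set ts)}
    = emeasure (killed_law P' \<eta> \<theta>p) {f \<in> space (path_space {0..}). alive_in ?B (set ?ts) v f}"
    using le B by (subst version_law_alive_in[OF \<nu>m, symmetric]) (auto intro: less_imp_le)
  also have "\<dots> = iter_op Qm ?B 0 ?ts v"
    by (rule fdd_killed_law[OF eta rate_nonneg(1) B sorted_reflect[OF ts]]) (use True in simp)
  also have "\<dots> = iter_op Qm B (s - 0) (map (\<lambda>r. s - r) ?ts) v"
    by (rule iter_op_reindex[symmetric]) simp
  finally show ?thesis using True by (simp add: o_def)
next
  case False
  then have "\<not> (\<forall>t\<in>set ts. t < s)" using ts(2) last_in_set by blast
  then have e: "{f \<in> space \<nu>m. death_path (s, v) f \<in> cylinder B (set ts)} = {}"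
    by (auto simp: cylinder_def alive_in_death_path)
  show ?thesis unfolding e using False by simp
qed

text \<open>The two halves are independent, and time 0 belongs to the forward half. The negative
  times are reversed because the backward process meets them in order of their distance from
  0.\<close>

lemma line_prob:
  "emeasure \<nu>0 {f \<in> space \<nu>0. shift_path u f \<in> cylinder B (set ts)}
    = iter_op Qm B 0 (rev (filter (\<lambda>t. t < 0) ts)) u * iter_op Qp B 0 (filter (\<lambda>t. 0 \<le> t) ts) u"
proof -
  let ?N = "filter (\<lambda>t. t < 0) ts" and ?U = "filter (\<lambda>t. 0 \<le> t) ts"
  let ?LP = "killed_law P \<xi> \<theta>m" and ?LM = "killed_law P' \<eta> \<theta>p"
  let ?h = "\<lambda>(f, g) t. if 0 \<le> t then f t else g (- t)" and ?C = "{f \<in> space (path_space UNIV). alive_in B (set ts) u f}"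
  interpret LP: prob_space ?LP by (rule prob_space_killed_law[OF xi rate_nonneg(2)])
  interpret LM: prob_space ?LM by (rule prob_space_killed_law[OF eta rate_nonneg(1)])
  have sets_L: "sets ?LP = sets (path_space {0..})" "sets ?LM = sets (path_space {0..})"
    by (simp_all add: killed_law_def)
  note space_L = sets_L[THEN sets_eq_imp_space_eq]
  have "(\<lambda>x. fst x t) \<in> borel_measurable (?LP \<Otimes>\<^sub>M ?LM)" if "t \<in> {0..}" for t :: real
  proof -
    have "(\<lambda>f. f t) \<in> borel_measurable ?LP"
      using measurable_component_singleton[OF that] by (simp cong: measurable_cong_sets add: sets_L)
    then show ?thesis by (rule measurable_compose[OF measurable_fst])
  qed
  moreover have "(\<lambda>x. snd x t) \<in> borel_measurable (?LP \<Otimes>\<^sub>M ?LM)" if "t \<in> {0..}" for t :: real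
  proof -
    have "(\<lambda>f. f t) \<in> borel_measurable ?LM"
      using measurable_component_singleton[OF that] by (simp cong: measurable_cong_sets add: sets_L)
    then show ?thesis by (rule measurable_compose[OF measurable_snd])
  qed
  ultimately have "(\<lambda>x. (if 0 \<le> t then fst x t else snd x (- t))) \<in> borel_measurable (?LP \<Otimes>\<^sub>M ?LM)" for t :: real
    by (cases "0 \<le> t") auto
  then have "(\<lambda>x t. (if 0 \<le> t then fst x t else snd x (- t))) \<in> ?LP \<Otimes>\<^sub>M ?LM \<rightarrow>\<^sub>M path_space UNIV"
    by (intro measurable_PiM_single') auto
  then have h: "?h \<in> ?LP \<Otimes>\<^sub>M ?LM \<rightarrow>\<^sub>M path_space UNIV" by (simp add: split_beta')
  have C: "?C \<in> sets (path_space UNIV)"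
    using B by (intro sets_alive_in measurable_component_singleton) auto
  let ?A = "{f \<in> space (path_space {0..}). alive_in B (set ?U) u f}"
  let ?D = "{f \<in> space (path_space {0..}). alive_in (\<lambda>r. B (0 - r)) (set (map (\<lambda>t. 0 - t) (rev ?N))) u f}"
  have A: "?A \<in> sets ?LP" and D: "?D \<in> sets ?LM"
    unfolding sets_L using B by (intro sets_alive_in measurable_component_singleton; force)+
  have "{f \<in> space \<nu>0. shift_path u f \<in> cylinder B (set ts)} = {f \<in> space \<nu>0. alive_in B (set ts) u f}"
    using cadlag_shift_path by (auto simp: cylinder_def space_\<nu> space_Dbar alive_in_shift_path)
  then have "emeasure \<nu>0 {f \<in> space \<nu>0. shift_path u f \<in> cylinder B (set ts)} = emeasure (two_sided_law ?LP ?LM) ?C"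
    using B by (subst version_law_alive_in[OF \<nu>0, symmetric]) auto
  also have "\<dots> = emeasure (?LP \<Otimes>\<^sub>M ?LM) (?h -` ?C \<inter> space (?LP \<Otimes>\<^sub>M ?LM))"
    unfolding two_sided_law_def by (rule emeasure_distr[OF h C])
  also have "?h -` ?C \<inter> space (?LP \<Otimes>\<^sub>M ?LM) = ?A \<times> ?D"
    by (auto simp: space_pair_measure space_L alive_in_def space_PiM not_le split: if_splits)
  also have "emeasure (?LP \<Otimes>\<^sub>M ?LM) (?A \<times> ?D) = emeasure ?LP ?A * emeasure ?LM ?D"
    by (rule LM.emeasure_pair_measure_Times[OF A D])
  also have "emeasure ?LP ?A = iter_op Qp B 0 ?U u"
    using ts(1) by (intro fdd_killed_law[OF xi rate_nonneg(2) B]) (simp add: sorted_wrt_filter)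
  also have "emeasure ?LM ?D = iter_op Qm (\<lambda>r. B (0 - r)) 0 (map (\<lambda>t. 0 - t) (rev ?N)) u"
  proof (rule fdd_killed_law[OF eta rate_nonneg(1) B])
    show "sorted (0 # map (\<lambda>t. 0 - t) (rev ?N))"
    proof (cases "?N = []")
      case False
      then have "last ?N < 0" using last_in_set[OF False] by auto
      with False ts(1) show ?thesis by (intro sorted_reflect) (auto simp: sorted_wrt_filter)
    next
      case True
      then show ?thesis by (simp only:) simp
    qed
  qed
  also have "\<dots> = iter_op Qm B (0 - 0) (map (\<lambda>r. 0 - r) (map (\<lambda>t. 0 - t) (rev ?N))) u"
    by (rule iter_op_reindex[symmetric]) simp
  finally show ?thesis by (simp add: o_def mult.commute)
qed

lemma sets_cylinder_ts: "cylinder B (set ts) \<in> sets Dbar"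
  by (rule sets_cylinder) (auto simp: B)

lemma birth_cylinder:
  assumes T: "T \<in> sets borel"
  shows "emeasure (birth_measure T) (cylinder B (set ts))
    = (\<integral>\<^sup>+s. indicator T s * (indicator {..hd ts} s * ennreal (\<theta>p * exp (- \<theta>p * (hd ts - s)))) \<partial>lborel) * path_weight B ts"
proof -
  have m: "(\<lambda>p. emeasure \<nu>p {f \<in> space \<nu>p. birth_path p f \<in> cylinder B (set ts)}) \<in> borel_measurable (borel \<Otimes>\<^sub>M borel)"
    by (rule emeasure_marked(2)[OF prob_\<nu>(1) measurable_birth(1) sets_cylinder_ts])
  have "emeasure (birth_measure T) (cylinder B (set ts))
    = (\<integral>\<^sup>+p. emeasure \<nu>p {f \<in> space \<nu>p. birth_path p f \<in> cylinder B (set ts)} \<partial>time_intensity \<theta>p T)"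
    unfolding birth_measure_def by (rule emeasure_marked(1)[OF prob_\<nu>(1) measurable_birth(2) sets_cylinder_ts])
  also have "\<dots> = (\<integral>\<^sup>+s. indicator T s * (ennreal \<theta>p * exp_integral (\<lambda>v. if s \<le> hd ts then iter_op Qp B s ts v else 0)) \<partial>lborel)"
    by (simp only: nn_integral_time_intensity[OF T m] birth_prob)
  also have "\<dots> = (\<integral>\<^sup>+s. indicator T s * (indicator {..hd ts} s * ennreal (\<theta>p * exp (- \<theta>p * (hd ts - s)))) * path_weight B ts \<partial>lborel)"
  proof (rule nn_integral_cong)
    fix s
    show "indicator T s * (ennreal \<theta>p * exp_integral (\<lambda>v. if s \<le> hd ts then iter_op Qp B s ts v else 0))
      = indicator T s * (indicator {..hd ts} s * ennreal (\<theta>p * exp (- \<theta>p * (hd ts - s)))) * path_weight B ts"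
    proof (cases "s \<le> hd ts")
      case True
      then show ?thesis using exp_integral_birth[OF B ts(2) True] rate_nonneg by (simp add: ennreal_mult mult_ac)
    qed (simp add: exp_integral_def)
  qed
  also have "\<dots> = (\<integral>\<^sup>+s. indicator T s * (indicator {..hd ts} s * ennreal (\<theta>p * exp (- \<theta>p * (hd ts - s)))) \<partial>lborel) * path_weight B ts"
    using T by (intro nn_integral_multc) auto
  finally show ?thesis .
qed

lemma death_cylinder:
  "emeasure death_measure (cylinder B (set ts))
    = (\<integral>\<^sup>+s. indicator {..<0} s * (indicator {last ts<..} s * ennreal (\<theta>m * exp (- \<theta>m * (s - last ts)))) \<partial>lborel) * path_weight B ts"
proof -
  have m: "(\<lambda>p. emeasure \<nu>m {f \<in> space \<nu>m. death_path p f \<in> cylinder B (set ts)}) \<in> borel_measurable (borel \<Otimes>\<^sub>M borel)"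
    by (rule emeasure_marked(2)[OF prob_\<nu>(2) measurable_death(1) sets_cylinder_ts])
  have T: "{..<0::real} \<in> sets borel" by simp
  have "emeasure death_measure (cylinder B (set ts))
    = (\<integral>\<^sup>+p. emeasure \<nu>m {f \<in> space \<nu>m. death_path p f \<in> cylinder B (set ts)} \<partial>time_intensity \<theta>m {..<0})"
    unfolding death_measure_def by (rule emeasure_marked(1)[OF prob_\<nu>(2) measurable_death(2) sets_cylinder_ts])
  also have "\<dots> = (\<integral>\<^sup>+s. indicator {..<0} s * (ennreal \<theta>m * exp_integral (\<lambda>v. if last ts < s then iter_op Qm B s (rev ts) v else 0)) \<partial>lborel)"
    by (simp only: nn_integral_time_intensity[OF T m] death_prob)
  also have "\<dots> = (\<integral>\<^sup>+s. indicator {..<0} s * (indicator {last ts<..} s * ennreal (\<theta>m * exp (- \<theta>m * (s - last ts)))) * path_weight B ts \<partial>lborel)"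
  proof (rule nn_integral_cong)
    fix s
    show "indicator {..<0} s * (ennreal \<theta>m * exp_integral (\<lambda>v. if last ts < s then iter_op Qm B s (rev ts) v else 0))
      = indicator {..<0} s * (indicator {last ts<..} s * ennreal (\<theta>m * exp (- \<theta>m * (s - last ts)))) * path_weight B ts"
    proof (cases "last ts < s")
      case True
      then show ?thesis using exp_integral_death[OF B ts(2), of s] rate_nonneg by (simp add: ennreal_mult mult_ac)
    qed (simp add: exp_integral_def)
  qed
  also have "\<dots> = (\<integral>\<^sup>+s. indicator {..<0} s * (indicator {last ts<..} s * ennreal (\<theta>m * exp (- \<theta>m * (s - last ts)))) \<partial>lborel) * path_weight B ts"
    by (intro nn_integral_multc) auto
  finally show ?thesis .
qed

lemma line_cylinder:
  "emeasure line_measure (cylinder B (set ts))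
    = exp_integral (\<lambda>u. iter_op Qm B 0 (rev (filter (\<lambda>t. t < 0) ts)) u * iter_op Qp B 0 (filter (\<lambda>t. 0 \<le> t) ts) u)"
proof -
  have m: "(\<lambda>u. emeasure \<nu>0 {f \<in> space \<nu>0. shift_path u f \<in> cylinder B (set ts)}) \<in> borel_measurable borel"
    by (rule emeasure_marked(2)[OF prob_\<nu>(3) measurable_line(1) sets_cylinder_ts])
  have "emeasure line_measure (cylinder B (set ts))
    = (\<integral>\<^sup>+u. emeasure \<nu>0 {f \<in> space \<nu>0. shift_path u f \<in> cylinder B (set ts)} \<partial>exp_intensity)"
    unfolding line_measure_def by (rule emeasure_marked(1)[OF prob_\<nu>(3) measurable_line(2) sets_cylinder_ts])
  then show ?thesis by (subst (asm) nn_integral_exp_intensity[OF m]) (simp only: line_prob)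
qed

lemma birth_cylinder_UNIV:
  assumes "0 < \<theta>p" shows "emeasure (birth_measure UNIV) (cylinder B (set ts)) = path_weight B ts"
  using nn_integral_birth_times[OF assms, of "hd ts"] by (simp add: birth_cylinder)

text \<open>A path observed on both sides of 0 was born before 0 and dies after it, so only the line
  component counts. If all times are non-negative, the paths through 0 carry the share
  \<open>exp (- \<theta>p * hd ts)\<close> and the later births the remainder. If all are negative,
  paths through 0 and earlier deaths split the weight in the same way, at rate
  \<open>\<theta>m\<close> from the last time.\<close>

lemma cylinder_balance:
  "path_weight B ts = emeasure line_measure (cylinder B (set ts)) + emeasure (birth_measure {0<..}) (cylinder B (set ts))
    + emeasure death_measure (cylinder B (set ts))"
proof -
  let ?N = "filter (\<lambda>t. t < 0) ts" and ?U = "filter (\<lambda>t. 0 \<le> t) ts"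
  have split: "ts = ?N @ ?U"
    using ts(1)
  proof (induction ts)
    case (Cons a ts)
    show ?case
    proof (cases "a < 0")
      case False
      with Cons.prems have "filter (\<lambda>t. t < 0) ts = []" by (auto simp: filter_empty_conv)
      with False Cons show ?thesis by simp
    qed (use Cons in simp)
  qed simp
  \<comment> \<open>The bounds on \<open>e\<close> are needed because subtraction is truncated once
    it is embedded in the extended non-negative numbers.\<close>
  have one: "ennreal e * c + ennreal (1 - e) * c = c" if "0 \<le> e" "e \<le> 1" for e :: real and c
    using that by (simp add: distrib_right[symmetric] ennreal_plus[symmetric] del: ennreal_plus)
  have birth0: "emeasure (birth_measure {0<..}) (cylinder B (set ts)) = 0" if "hd ts < 0"
  proof -
    have "(indicator {0<..} s * (indicator {..hd ts} s * ennreal (\<theta>p * exp (- \<theta>p * (hd ts - s)))) :: ennreal) = 0" for s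
      using that by (auto simp: indicator_def)
    note z = this
    show ?thesis by (subst birth_cylinder, simp, simp only: z, simp)
  qed
  have death0: "emeasure death_measure (cylinder B (set ts)) = 0" if "0 \<le> last ts"
  proof -
    have "(indicator {..<0} s * (indicator {last ts<..} s * ennreal (\<theta>m * exp (- \<theta>m * (s - last ts)))) :: ennreal) = 0" for s
      using that by (auto simp: indicator_def)
    note z = this
    show ?thesis by (subst death_cylinder, simp only: z, simp)
  qed
  consider "?N = []" "0 \<le> hd ts" "0 \<le> last ts" | "?U = []" "hd ts < 0" "last ts < 0"
    | "?N \<noteq> []" "?U \<noteq> []" "hd ts < 0" "0 \<le> last ts"
  proof -
    have hN: "hd ts < 0" if "?N \<noteq> []" using that hd_in_set[OF that] by (subst split) (simp add: hd_append)
    have hU: "0 \<le> last ts" if "?U \<noteq> []" using that last_in_set[OF that] by (subst split) (simp add: last_append)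
    have h0: "0 \<le> hd ts" if "?N = []"
      using that hd_in_set[OF ts(2)] by (auto simp: filter_empty_conv not_less)
    have l0: "last ts < 0" if "?U = []"
      using that last_in_set[OF ts(2)] by (auto simp: filter_empty_conv not_le)
    have "?U \<noteq> []" if "?N = []" using split that ts(2) by auto
    then show ?thesis using that h0 l0 hN hU by (cases "?N = []"; cases "?U = []") simp_all
  qed
  then show ?thesis
  proof cases
    case 1
    then have U: "?U = ts" using split by simp
    have "emeasure line_measure (cylinder B (set ts)) = ennreal (exp (- \<theta>p * hd ts)) * path_weight B ts"
      using exp_integral_birth[OF B ts(2), of 0] 1 by (simp add: line_cylinder U)
    moreover have "emeasure (birth_measure {0<..}) (cylinder B (set ts)) = ennreal (1 - exp (- \<theta>p * hd ts)) * path_weight B ts"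
      using nn_integral_birth_times_pos[OF rate_nonneg(1) 1(2)] by (simp add: birth_cylinder)
    moreover have "exp (- \<theta>p * hd ts) \<le> 1" using 1 rate_nonneg by simp
    ultimately show ?thesis using death0[OF 1(3)] one[of "exp (- \<theta>p * hd ts)"] by simp
  next
    case 2
    then have N: "?N = ts" using split by simp
    have "emeasure line_measure (cylinder B (set ts)) = ennreal (exp (\<theta>m * last ts)) * path_weight B ts"
      using exp_integral_death[OF B ts(2), of 0] 2 by (simp add: line_cylinder N)
    moreover have "emeasure death_measure (cylinder B (set ts)) = ennreal (1 - exp (\<theta>m * last ts)) * path_weight B ts"
      using nn_integral_death_times_neg[OF rate_nonneg(2), of "last ts"] 2 by (simp add: death_cylinder)
    moreover have "exp (\<theta>m * last ts) \<le> 1" using 2 rate_nonneg by (simp add: mult_nonneg_nonpos)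
    ultimately show ?thesis using birth0[OF 2(2)] one[of "exp (\<theta>m * last ts)"] by simp
  next
    case 3
    have "hd (rev ?N) \<le> 0"
      using 3(1) last_in_set[OF 3(1)] by (auto simp: hd_rev)
    moreover have "0 \<le> hd ?U" using hd_in_set[OF 3(2)] by auto
    ultimately have "emeasure line_measure (cylinder B (set ts)) = path_weight B (rev (rev ?N) @ ?U)"
      unfolding line_cylinder using 3 by (intro exp_integral_two_sided[OF B]) auto
    then show ?thesis using split birth0[OF 3(3)] death0[OF 3(4)] by simp
  qed
qed

end

end

section \<open>The path that is never alive\<close>

lemma sets_null_paths: "null_paths \<in> sets Dbar"
proof -
  have "null_paths = (\<Inter>q\<in>\<rat>. {f \<in> space Dbar. f q = - \<infinity>})"
    using cadlag_rat_eq_bot Rats_0 by (auto simp: null_paths_def space_Dbar)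
  also have "\<dots> \<in> sets Dbar"
  proof (rule sets.countable_INT')
    show "(\<lambda>q. {f \<in> space Dbar. f q = - \<infinity>}) ` \<rat> \<subseteq> sets Dbar" by auto
  qed (auto simp: countable_rat)
  finally show ?thesis .
qed

text \<open>Being alive at time \<open>t\<close> excludes the null path, so its probability is at
  most that of the complement.\<close>

lemma emeasure_null_paths_le:
  assumes \<nu>: "prob_space \<nu>" and F [measurable]: "F \<in> \<nu> \<rightarrow>\<^sub>M Dbar" and p: "0 \<le> p"
    and cylinder: "emeasure \<nu> {f \<in> space \<nu>. F f \<in> cylinder (\<lambda>_. UNIV) {t}} = ennreal p"
  shows "emeasure \<nu> {f \<in> space \<nu>. F f \<in> null_paths} \<le> ennreal (1 - p)"
proof -
  interpret prob_space \<nu> by fact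
  let ?C = "{f \<in> space \<nu>. F f \<in> cylinder (\<lambda>_. UNIV) {t}}" and ?Z = "{f \<in> space \<nu>. F f \<in> null_paths}"
  have "F -` cylinder (\<lambda>_. UNIV) {t} \<inter> space \<nu> \<in> events" by (rule measurable_sets[OF F sets_cylinder]) auto
  then have C: "?C \<in> events" by (simp add: vimage_def Int_def conj_commute)
  have "F -` null_paths \<inter> space \<nu> \<in> events" by (rule measurable_sets[OF F sets_null_paths])
  then have Z: "?Z \<in> events" by (simp add: vimage_def Int_def conj_commute)
  have "?C \<inter> ?Z = {}" by (auto simp: cylinder_singleton null_paths_def)
  then have "prob ?C + prob ?Z = prob (?C \<union> ?Z)" by (intro finite_measure_Union[symmetric] C Z)
  also have "\<dots> \<le> 1" by simp
  finally have "prob ?Z \<le> 1 - prob ?C" by simp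
  moreover have "prob ?C = p" using cylinder p by (simp add: emeasure_eq_measure)
  ultimately show ?thesis by (simp add: emeasure_eq_measure ennreal_leI)
qed

context dual_levy_versions
begin

lemma sets_component [simp]:
  "sets (birth_measure T) = sets Dbar" "sets death_measure = sets Dbar" "sets line_measure = sets Dbar"
  by (simp_all add: birth_measure_def death_measure_def line_measure_def)

lemma birth_null: "emeasure (birth_measure T) null_paths = 0"
proof -
  have "emeasure \<nu>p {f \<in> space \<nu>p. birth_path p f \<in> null_paths} = 0" for p
  proof -
    obtain s v where p: "p = (s, v)" by (cases p)
    have F: "(\<lambda>f. birth_path p f) \<in> \<nu>p \<rightarrow>\<^sub>M Dbar"
      using measurable_compose[OF measurable_Pair1' measurable_birth(1), of p] by (simp add: space_pair_measure)
    \<comment> \<open>At its birth a path has age 0 and is alive with probability 1.\<close>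
    have "emeasure \<nu>p {f \<in> space \<nu>p. birth_path (s, v) f \<in> cylinder (\<lambda>_. UNIV) (set [s])} = iter_op Qp (\<lambda>_. UNIV) s [s] v"
      by (subst birth_prob) auto
    also have "\<dots> = ennreal 1" using killed_op_one[OF xi, of \<theta>m 0 v] by simp
    finally have "emeasure \<nu>p {f \<in> space \<nu>p. birth_path p f \<in> cylinder (\<lambda>_. UNIV) {s}} = ennreal 1" by (simp add: p)
    from emeasure_null_paths_le[OF prob_\<nu>(1) F _ this] show ?thesis by simp
  qed
  then show ?thesis
    unfolding birth_measure_def by (subst emeasure_marked(1)[OF prob_\<nu>(1) measurable_birth(2) sets_null_paths]) simp
qed

lemma line_null: "emeasure line_measure null_paths = 0"
proof -
  have "emeasure \<nu>0 {f \<in> space \<nu>0. shift_path u f \<in> null_paths} = 0" for u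
  proof -
    have F: "(\<lambda>f. shift_path u f) \<in> \<nu>0 \<rightarrow>\<^sub>M Dbar"
      using measurable_compose[OF measurable_Pair1' measurable_line(1), of u] by simp
    have "emeasure \<nu>0 {f \<in> space \<nu>0. shift_path u f \<in> cylinder (\<lambda>_. UNIV) (set [0])} = ennreal 1"
      by (subst line_prob) (use killed_op_one[OF xi, of \<theta>m 0 u] in auto)
    then have "emeasure \<nu>0 {f \<in> space \<nu>0. shift_path u f \<in> cylinder (\<lambda>_. UNIV) {0}} = ennreal 1" by simp
    from emeasure_null_paths_le[OF prob_\<nu>(3) F _ this] show ?thesis by simp
  qed
  then show ?thesis
    unfolding line_measure_def by (subst emeasure_marked(1)[OF prob_\<nu>(3) measurable_line(2) sets_null_paths]) simp
qed

text \<open>A dying path is already \<open>- \<infinity>\<close> at its death time, so no single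
  time shows that it was alive. At \<open>s - r\<close> it is alive with probability
  \<open>exp (- \<theta>p * r)\<close>, which tends to 1 as \<open>r\<close> tends to 0.\<close>

lemma death_null: "emeasure death_measure null_paths = 0"
proof -
  interpret m: prob_space \<nu>m by (rule prob_\<nu>(2))
  have "emeasure \<nu>m {f \<in> space \<nu>m. death_path p f \<in> null_paths} = 0" for p
  proof -
    obtain s v where p: "p = (s, v)" by (cases p)
    have F: "(\<lambda>f. death_path p f) \<in> \<nu>m \<rightarrow>\<^sub>M Dbar"
      using measurable_compose[OF measurable_Pair1' measurable_death(1), of p] by (simp add: space_pair_measure)
    have le: "m.prob {f \<in> space \<nu>m. death_path p f \<in> null_paths} \<le> 1 - exp (- \<theta>p * r)" if r: "0 < r" for r
    proof -
      have "emeasure \<nu>m {f \<in> space \<nu>m. death_path (s, v) f \<in> cylinder (\<lambda>_. UNIV) (set [s - r])} = iter_op Qm (\<lambda>_. UNIV) s (rev [s - r]) v"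
        using r by (subst death_prob) auto
      also have "\<dots> = ennreal (exp (- \<theta>p * r))" using killed_op_one[OF eta, of \<theta>p r v] r by simp
      finally have "emeasure \<nu>m {f \<in> space \<nu>m. death_path p f \<in> cylinder (\<lambda>_. UNIV) {s - r}} = ennreal (exp (- \<theta>p * r))"
        by (simp add: p)
      from emeasure_null_paths_le[OF prob_\<nu>(2) F _ this] r rate_nonneg show ?thesis
        by (simp add: m.emeasure_eq_measure)
    qed
    have "(\<lambda>n. 1 - exp (- \<theta>p * inverse (real (Suc n)))) \<longlonglongrightarrow> 1 - exp (- \<theta>p * 0)"
      by (intro tendsto_intros LIMSEQ_inverse_real_of_nat)
    then have "m.prob {f \<in> space \<nu>m. death_path p f \<in> null_paths} \<le> 1 - exp (- \<theta>p * 0)"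
      by (rule LIMSEQ_le_const) (intro exI[of _ 0] allI impI le, simp)
    then show ?thesis by (simp add: m.emeasure_eq_measure measure_le_0_iff)
  qed
  then show ?thesis
    unfolding death_measure_def by (subst emeasure_marked(1)[OF prob_\<nu>(2) measurable_death(2) sets_null_paths]) simp
qed

text \<open>\<open>cylinder_balance\<close> gives the equality on cylinder sets with sorted times,
  and none of the components charges the null path. Positivity of \<open>\<theta>p\<close> enters
  through the total mass 1 of the birth times.\<close>

lemma birth_measure_eq_sum:
  assumes \<theta>: "0 < \<theta>p" and A: "A \<in> sets Dbar"
  shows "emeasure (birth_measure UNIV) A
    = emeasure line_measure A + emeasure (birth_measure {0<..}) A + emeasure death_measure A"
proof -
  let ?N = "sum_measure (sum_measure line_measure (birth_measure {0<..})) death_measure"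
  have N: "emeasure ?N X = emeasure line_measure X + emeasure (birth_measure {0<..}) X + emeasure death_measure X"
    if "X \<in> sets Dbar" for X
    using that by (simp add: emeasure_sum_measure)
  have "birth_measure UNIV = ?N"
  proof (rule measure_Dbar_eqI)
    show "emeasure (birth_measure UNIV) null_paths = 0" by (rule birth_null)
    show "emeasure ?N null_paths = 0"
      by (simp add: N sets_null_paths birth_null line_null death_null)
    show "emeasure (birth_measure UNIV) (cylinder B J) = emeasure ?N (cylinder B J)"
      if J: "finite J" "J \<noteq> {}" and B: "\<And>t. B t \<in> sets borel" for B J
    proof -
      define ts where "ts = sorted_list_of_set J"
      have ts: "sorted ts" "ts \<noteq> []" "set ts = J" using J by (auto simp: ts_def)
      show ?thesis
        using birth_cylinder_UNIV[OF B ts(1,2) \<theta>] cylinder_balance[OF B ts(1,2)] sets_cylinder[OF J(1) B]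
        by (simp add: N ts(3))
    qed
    show "emeasure (birth_measure UNIV) (cylinder (\<lambda>_. {- real k<..}) {t}) \<noteq> \<infinity>" for t k
    proof -
      \<comment> \<open>With one observation time the weight is the integral of
        \<open>exp (- x)\<close> over \<open>x > - real k\<close>, which is
        \<open>exp (real k)\<close>.\<close>
      have "emeasure (birth_measure UNIV) (cylinder (\<lambda>_. {- real k<..}) {t}) = path_weight (\<lambda>_. {- real k<..}) [t]"
        using birth_cylinder_UNIV[of "\<lambda>_. {- real k<..}" "[t]"] \<theta> by simp
      also have "\<dots> \<le> (\<integral>\<^sup>+x\<in>{- real k..}. ennreal (exp (- x)) \<partial>lborel)"
        unfolding path_weight_def glued_weight_def exp_integral_def by (intro nn_integral_mono) (auto simp: indicator_def)
      also have "\<dots> = ennreal (0 - (- exp (- (- real k))))"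
      proof (rule nn_integral_FTC_atLeast)
        show "((\<lambda>x. - exp (- x)) \<longlongrightarrow> (0::real)) at_top" by real_asymp
        show "((\<lambda>x. - exp (- x)) has_real_derivative exp (- x)) (at x)" for x :: real
          by (auto intro!: derivative_eq_intros)
      qed auto
      finally show ?thesis by (auto simp: top_unique)
    qed
  qed simp_all
  then show ?thesis using N[OF A] by simp
qed

end

section \<open>Superposition\<close>

lemma nn_integral_count_space_Plus:
  "(\<integral>\<^sup>+k. f k \<partial>count_space (A <+> B))
    = (\<integral>\<^sup>+i. f (Inl i) \<partial>count_space A) + (\<integral>\<^sup>+i. f (Inr i) \<partial>count_space B)"
proof -
  let ?C = "count_space (A <+> B)"
  have sub: "Inl ` A \<subseteq> A <+> B" "Inr ` B \<subseteq> A <+> B" by auto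
  have "(\<integral>\<^sup>+k. f k \<partial>?C) = (\<integral>\<^sup>+k. f k * indicator (Inl ` A) k + f k * indicator (Inr ` B) k \<partial>?C)"
    by (intro nn_integral_cong) (auto simp: indicator_def)
  also have "\<dots> = (\<integral>\<^sup>+k. f k * indicator (Inl ` A) k \<partial>?C) + (\<integral>\<^sup>+k. f k * indicator (Inr ` B) k \<partial>?C)"
    by (rule nn_integral_add) auto
  also have "(\<integral>\<^sup>+k. f k * indicator (Inl ` A) k \<partial>?C) = (\<integral>\<^sup>+k. f k \<partial>count_space (Inl ` A))"
    using sub(1) by (subst nn_integral_restrict_space[symmetric]) (auto simp: restrict_count_space Int_absorb2)
  also have "\<dots> = (\<integral>\<^sup>+i. f (Inl i) \<partial>count_space A)"
    by (rule nn_integral_bij_count_space[symmetric]) (simp add: bij_betw_def)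
  also have "(\<integral>\<^sup>+k. f k * indicator (Inr ` B) k \<partial>?C) = (\<integral>\<^sup>+k. f k \<partial>count_space (Inr ` B))"
    using sub(2) by (subst nn_integral_restrict_space[symmetric]) (auto simp: restrict_count_space Int_absorb2)
  also have "\<dots> = (\<integral>\<^sup>+i. f (Inr i) \<partial>count_space B)"
    by (rule nn_integral_bij_count_space[symmetric]) (simp add: bij_betw_def)
  finally show ?thesis .
qed

lemma borel_measurable_nn_integral_count_space:
  fixes I :: "nat set"
  assumes f: "\<And>i. i \<in> I \<Longrightarrow> f i \<in> borel_measurable M"
  shows "(\<lambda>\<omega>. \<integral>\<^sup>+i. f i \<omega> \<partial>count_space I) \<in> borel_measurable M"
proof -
  have "(\<integral>\<^sup>+i. f i \<omega> \<partial>count_space I) = (\<Sum>i. if i \<in> I then f i \<omega> else 0)" for \<omega>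
    by (subst nn_integral_count_space_indicator)
      (auto simp: nn_integral_count_space_nat[symmetric] indicator_def intro!: nn_integral_cong)
  moreover have "(\<lambda>\<omega>. if i \<in> I then f i \<omega> else 0) \<in> borel_measurable M" for i
    using f by (cases "i \<in> I") auto
  ultimately show ?thesis by simp
qed

lemma nn_integral_sum_indicator:
  assumes "\<And>j. j \<in> J \<Longrightarrow> A j \<in> sets M"
  shows "(\<integral>\<^sup>+x. (\<Sum>j\<in>J. c j * indicator (A j) x) \<partial>M) = (\<Sum>j\<in>J. c j * emeasure M (A j))"
proof -
  have "(\<integral>\<^sup>+x. (\<Sum>j\<in>J. c j * indicator (A j) x) \<partial>M) = (\<Sum>j\<in>J. \<integral>\<^sup>+x. c j * indicator (A j) x \<partial>M)"
    using assms by (intro nn_integral_sum) auto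
  also have "\<dots> = (\<Sum>j\<in>J. c j * emeasure M (A j))"
    using assms by (intro sum.cong refl nn_integral_cmult_indicator)
  finally show ?thesis .
qed

text \<open>At most one of the disjoint indicators is non-zero at any point, so the non-linear
  expression can be applied to each term separately.\<close>

lemma nn_integral_one_minus_exp_neg_simple:
  assumes J: "finite J" "disjoint_family_on A J" "\<And>j. j \<in> J \<Longrightarrow> A j \<in> sets M" and s: "\<And>j. j \<in> J \<Longrightarrow> 0 < s j"
  shows "(\<integral>\<^sup>+x. 1 - exp_neg (\<Sum>j\<in>J. ennreal (s j) * indicator (A j) x) \<partial>M)
    = (\<Sum>j\<in>J. ennreal (1 - exp (- s j)) * emeasure M (A j))"
proof -
  have "1 - exp_neg (\<Sum>j\<in>J. ennreal (s j) * indicator (A j) x) = (\<Sum>j\<in>J. ennreal (1 - exp (- s j)) * indicator (A j) x)" for x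
  proof (cases "\<exists>i\<in>J. x \<in> A i")
    case True
    then obtain i where i: "i \<in> J" "x \<in> A i" by auto
    have other: "indicator (A j) x = (0::ennreal)" if "j \<in> J - {i}" for j
      using J(2) i that by (auto simp: disjoint_family_on_def indicator_def)
    have "(\<Sum>j\<in>J. c j * indicator (A j) x) = c i" for c :: "_ \<Rightarrow> ennreal"
      using i other by (subst sum.remove[OF J(1) i(1)]) simp
    moreover have "1 - exp_neg (ennreal (s i)) = ennreal (1 - exp (- s i))"
      using s[OF i(1)] by (simp add: exp_neg_ennreal ennreal_minus[symmetric])
    ultimately show ?thesis by simp
  next
    case False
    then have "indicator (A j) x = (0::ennreal)" if "j \<in> J" for j using that by (auto simp: indicator_def)
    then show ?thesis by simp
  qed
  then show ?thesis by (simp only: nn_integral_sum_indicator[OF J(3)])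
qed

context prob_space
begin

text \<open>A product of Laplace functionals adds the exponents, hence the intensities. Testing with
  step functions on disjoint sets recovers the joint transforms of counts that
  \<open>poisson_ppI\<close> asks for.\<close>

lemma poisson_pp_superposeI:
  fixes \<kappa> :: "'k \<Rightarrow> 'p measure"
  assumes sets: "\<And>\<omega>. \<omega> \<in> space M \<Longrightarrow> sets (N \<omega>) = sets \<mu>"
    and meas: "\<And>A. A \<in> sets \<mu> \<Longrightarrow> (\<lambda>\<omega>. emeasure (N \<omega>) A) \<in> borel_measurable M"
    and nat: "\<And>A \<omega>. A \<in> sets \<mu> \<Longrightarrow> \<omega> \<in> space M \<Longrightarrow> nat_valued (emeasure (N \<omega>) A)"
    and \<kappa>: "\<And>k. sets (\<kappa> k) = sets \<mu>" and \<mu>: "\<And>A. A \<in> sets \<mu> \<Longrightarrow> emeasure \<mu> A = (\<Sum>k\<in>H. emeasure (\<kappa> k) A)"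
    and lap: "\<And>g. g \<in> borel_measurable \<mu> \<Longrightarrow>
      (\<integral>\<^sup>+\<omega>. exp_neg (\<integral>\<^sup>+x. g x \<partial>N \<omega>) \<partial>M) = (\<Prod>k\<in>H. exp_neg (\<integral>\<^sup>+x. 1 - exp_neg (g x) \<partial>\<kappa> k))"
  shows "poisson_pp M \<mu> N"
proof (rule poisson_ppI[OF sets meas nat])
  fix J :: "nat set" and A and s :: "nat \<Rightarrow> real"
  assume J: "finite J" "A ` J \<subseteq> sets \<mu>" "disjoint_family_on A J" and s: "\<And>j. j \<in> J \<Longrightarrow> 0 < s j"
  define g where "g x = (\<Sum>j\<in>J. ennreal (s j) * indicator (A j) x)" for x
  have A: "A j \<in> sets \<mu>" if "j \<in> J" for j using J that by auto
  have gm: "g \<in> borel_measurable \<mu>" unfolding g_def using A by measurable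
  have "(\<integral>\<^sup>+\<omega>. (\<Prod>j\<in>J. exp_neg (ennreal (s j) * emeasure (N \<omega>) (A j))) \<partial>M) = (\<integral>\<^sup>+\<omega>. exp_neg (\<integral>\<^sup>+x. g x \<partial>N \<omega>) \<partial>M)"
  proof (rule nn_integral_cong)
    fix \<omega> assume "\<omega> \<in> space M"
    then have "A j \<in> sets (N \<omega>)" if "j \<in> J" for j using A[OF that] sets by simp
    then have "(\<integral>\<^sup>+x. g x \<partial>N \<omega>) = (\<Sum>j\<in>J. ennreal (s j) * emeasure (N \<omega>) (A j))"
      unfolding g_def by (rule nn_integral_sum_indicator)
    then show "(\<Prod>j\<in>J. exp_neg (ennreal (s j) * emeasure (N \<omega>) (A j))) = exp_neg (\<integral>\<^sup>+x. g x \<partial>N \<omega>)" by (simp add: exp_neg_sum)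
  qed
  also have "\<dots> = (\<Prod>k\<in>H. exp_neg (\<integral>\<^sup>+x. 1 - exp_neg (g x) \<partial>\<kappa> k))" by (rule lap[OF gm])
  also have "\<dots> = exp_neg (\<Sum>k\<in>H. \<Sum>j\<in>J. ennreal (1 - exp (- s j)) * emeasure (\<kappa> k) (A j))"
    unfolding exp_neg_sum[symmetric] g_def using J(1,3) s A \<kappa>
    by (subst nn_integral_one_minus_exp_neg_simple) auto
  also have "(\<Sum>k\<in>H. \<Sum>j\<in>J. ennreal (1 - exp (- s j)) * emeasure (\<kappa> k) (A j))
      = (\<Sum>j\<in>J. ennreal (1 - exp (- s j)) * emeasure \<mu> (A j))"
    using A by (subst sum.swap) (simp add: \<mu> sum_distrib_left)
  finally show "(\<integral>\<^sup>+\<omega>. (\<Prod>j\<in>J. exp_neg (ennreal (s j) * emeasure (N \<omega>) (A j))) \<partial>M)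
      = (\<Prod>j\<in>J. exp_neg (ennreal (1 - exp (- s j)) * emeasure \<mu> (A j)))"
    by (simp add: exp_neg_sum)
qed

lemma nn_integral_indep_mult:
  fixes W Y :: "'a \<Rightarrow> ennreal"
  assumes ind: "indep_sets F (I1 \<union> I2)" and disj: "I1 \<inter> I2 = {}"
    and st: "\<And>i. i \<in> I1 \<union> I2 \<Longrightarrow> Int_stable (F i)"
    and W: "W \<in> borel_measurable (sigma (space M) (\<Union>i\<in>I1. F i))"
    and Y: "Y \<in> borel_measurable (sigma (space M) (\<Union>i\<in>I2. F i))"
  shows "(\<integral>\<^sup>+\<omega>. W \<omega> * Y \<omega> \<partial>M) = (\<integral>\<^sup>+\<omega>. W \<omega> \<partial>M) * (\<integral>\<^sup>+\<omega>. Y \<omega> \<partial>M)"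
proof -
  have F: "F i \<subseteq> Pow (space M)" if "i \<in> I1 \<union> I2" for i
  proof -
    have "F i \<subseteq> events" using ind that unfolding indep_sets_def by blast
    then show ?thesis using sets.space_closed[of M] by (rule subset_trans)
  qed
  note g = indep_groups[OF ind disj st F W Y]
  have f: "(\<lambda>p. fst p * snd p) \<in> borel_measurable (borel \<Otimes>\<^sub>M (borel :: ennreal measure))" by measurable
  note [measurable] = g(1,2)
  have "(\<integral>\<^sup>+\<omega>. W \<omega> * Y \<omega> \<partial>M) = (\<integral>\<^sup>+\<omega>. (\<integral>\<^sup>+y. W \<omega> * y \<partial>distr M borel Y) \<partial>M)"
    using nn_integral_indep_pair[where W=W and Y=Y and S=borel and T=borel and f="\<lambda>p. fst p * snd p", OF g(1,2) g(3) f]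
    by (simp only: fst_conv snd_conv)
  also have "\<dots> = (\<integral>\<^sup>+\<omega>. W \<omega> * (\<integral>\<^sup>+\<omega>. Y \<omega> \<partial>M) \<partial>M)"
    by (simp add: nn_integral_cmult nn_integral_distr)
  finally show ?thesis by (simp add: nn_integral_multc)
qed

text \<open>Extracts from the joint independence of all ingredients the points and marks of one
  component, under their own indexing.\<close>

lemma indep_sets_reindex:
  assumes f: "inj_on f J" and ind: "indep_sets F (f ` J)"
  shows "indep_sets (\<lambda>j. F (f j)) J"
  unfolding indep_sets_def
proof (intro conjI ballI allI impI)
  fix j assume "j \<in> J" then show "F (f j) \<subseteq> events" using ind unfolding indep_sets_def by blast
next
  fix K A assume K: "K \<subseteq> J" "K \<noteq> {}" "finite K" and A: "A \<in> (\<Pi> j\<in>K. F (f j))"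
  have injK: "inj_on f K" using f K(1) by (rule inj_on_subset)
  let ?A = "\<lambda>i. A (inv_into K f i)"
  have "prob (\<Inter>i\<in>f ` K. ?A i) = (\<Prod>i\<in>f ` K. prob (?A i))"
  proof (rule indep_setsD[OF ind])
    show "f ` K \<subseteq> f ` J" "f ` K \<noteq> {}" "finite (f ` K)" using K by auto
    show "\<forall>i\<in>f ` K. ?A i \<in> F i" using A by (auto simp: inv_into_f_f[OF injK])
  qed
  moreover have "(\<Inter>i\<in>f ` K. ?A i) = \<Inter> (A ` K)" by (simp add: inv_into_f_f[OF injK])
  moreover have "(\<Prod>i\<in>f ` K. prob (?A i)) = (\<Prod>j\<in>K. prob (A j))"
    by (subst prod.reindex[OF injK]) (simp add: inv_into_f_f[OF injK])
  ultimately show "prob (\<Inter> (A ` K)) = (\<Prod>j\<in>K. prob (A j))" by simp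
qed

lemma measurable_path_sigma:
  assumes Y: "(\<lambda>\<omega>. restrict (Y \<omega>) T) \<in> M \<rightarrow>\<^sub>M path_space T" and \<Omega>: "\<And>\<omega>. \<omega> \<in> space M \<Longrightarrow> restrict (Y \<omega>) T \<in> \<Omega>"
    and sub: "path_sigma M T Y \<subseteq> sets G" and sp: "space G = space M"
  shows "(\<lambda>\<omega>. restrict (Y \<omega>) T) \<in> G \<rightarrow>\<^sub>M restrict_space (path_space T) \<Omega>"
proof (rule measurable_restrict_space2)
  show "(\<lambda>\<omega>. restrict (Y \<omega>) T) \<in> space G \<rightarrow> \<Omega>" using \<Omega> sp by auto
  let ?f = "\<lambda>\<omega>. restrict (Y \<omega>) T"
  have "?f \<in> vimage_algebra (space M) ?f (path_space T) \<rightarrow>\<^sub>M path_space T"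
    using measurable_space[OF Y] by (intro measurable_vimage_algebra1) auto
  then show "?f \<in> G \<rightarrow>\<^sub>M path_space T"
    by (rule measurable_mono_domain) (use sub sp in \<open>auto simp: path_sigma_def generated_by_def\<close>)
qed

text \<open>Regarding a path as an element of \<open>\<Omega>\<close> adds no events: all
  realisations lie in \<open>\<Omega>\<close>, so a trace and the full set have the same preimage.
  Independence therefore passes to the regular marks.\<close>

lemma vimage_subset_path_sigma:
  assumes Y: "(\<lambda>\<omega>. restrict (Y \<omega>) T) \<in> M \<rightarrow>\<^sub>M path_space T"
    and \<Omega>: "\<And>\<omega>. \<omega> \<in> space M \<Longrightarrow> restrict (Y \<omega>) T \<in> \<Omega>"
  shows "{(\<lambda>\<omega>. restrict (Y \<omega>) T) -` A \<inter> space M |A. A \<in> sets (restrict_space (path_space T) \<Omega>)} \<subseteq> path_sigma M T Y"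
proof -
  let ?V = "vimage_algebra (space M) (\<lambda>\<omega>. restrict (Y \<omega>) T) (path_space T)"
  have "(\<lambda>\<omega>. restrict (Y \<omega>) T) \<in> ?V \<rightarrow>\<^sub>M restrict_space (path_space T) \<Omega>"
    by (rule measurable_path_sigma[OF Y \<Omega>]) (auto simp: path_sigma_def generated_by_def)
  then show ?thesis
    by (auto simp: path_sigma_def generated_by_def dest: measurable_sets)
qed

lemma Int_stable_generated: "Int_stable (points_sigma M I \<mu> X)" "Int_stable (path_sigma M T Y)"
  by (simp_all add: points_sigma_def path_sigma_def generated_by_def sets.Int_stable)

end

lemma version_law_measurable:
  assumes "version_law T \<Omega> Q \<nu>" "f \<in> G \<rightarrow>\<^sub>M restrict_space (path_space T) \<Omega>"
  shows "f \<in> G \<rightarrow>\<^sub>M \<nu>"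
proof -
  have "sets \<nu> = sets (restrict_space (path_space T) \<Omega>)" using assms(1) by (simp add: version_law_def)
  from measurable_cong_sets[OF refl this] assms(2) show ?thesis by blast
qed

context prob_space
begin

text \<open>\<open>marked_laplace\<close> for paths, transported to the measure on \<open>S\<close>.
  A copy is specified on \<open>T\<close> only, so \<open>F\<close> has to ignore all other times;
  this is the purpose of \<open>F_restrict\<close>.\<close>

lemma marked_paths_laplace:
  assumes pts: "poisson_points M UNIV \<mu> X" and \<nu>: "version_law T \<Omega> Q \<nu>"
    and copy: "\<And>i. is_copy M T Q (Y i)" and \<Omega>: "\<And>i \<omega>. \<omega> \<in> space M \<Longrightarrow> restrict (Y i \<omega>) T \<in> \<Omega>"
    and ind: "indep_sets (\<lambda>k. case k of None \<Rightarrow> points_sigma M UNIV \<mu> X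
        | Some i \<Rightarrow> path_sigma M T (Y i)) UNIV"
    and F: "(\<lambda>(x, f). F x f) \<in> \<mu> \<Otimes>\<^sub>M \<nu> \<rightarrow>\<^sub>M S" and F_restrict: "\<And>x f. F x (restrict f T) = F x f"
    and g [measurable]: "g \<in> borel_measurable S"
  shows "(\<integral>\<^sup>+\<omega>. exp_neg (\<integral>\<^sup>+i. g (F (X i \<omega>) (Y i \<omega>)) \<partial>count_space (UNIV :: nat set)) \<partial>M)
    = exp_neg (\<integral>\<^sup>+x. 1 - exp_neg (g x) \<partial>distr (\<mu> \<Otimes>\<^sub>M \<nu>) S (\<lambda>(x, f). F x f))"
proof -
  let ?D = "restrict_space (path_space T) \<Omega>"
  let ?Y = "\<lambda>i \<omega>. restrict (Y i \<omega>) T"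
  have pr: "prob_space \<nu>" and sets_\<nu>: "sets \<nu> = sets ?D" using \<nu> by (auto simp: version_law_def)
  have YM: "?Y i \<in> M \<rightarrow>\<^sub>M path_space T" for i using copy[of i] by (simp add: is_copy_def)
  have YD: "?Y i \<in> M \<rightarrow>\<^sub>M ?D" and law: "distr M ?D (?Y i) = \<nu>" for i
    using version_lawI[OF prob_space_axioms copy[of i] \<Omega>] version_law_unique[OF _ \<nu>] by auto
  have Y\<nu>: "?Y i \<in> M \<rightarrow>\<^sub>M \<nu>" for i by (rule version_law_measurable[OF \<nu> YD])
  have law\<nu>: "distr M \<nu> (?Y i) = \<nu>" for i
    using law[of i] by (subst distr_cong[OF refl sets_\<nu> refl]) auto
  have ind': "indep_sets (\<lambda>k. case k of None \<Rightarrow> points_sigma M UNIV \<mu> X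
        | Some i \<Rightarrow> {?Y i -` A \<inter> space M |A. A \<in> sets \<nu>}) UNIV"
    by (rule indep_sets_mono_sets[OF ind])
      (use vimage_subset_path_sigma[OF YM \<Omega>] in \<open>auto simp: sets_\<nu> split: option.splits\<close>)
  have gF: "(\<lambda>z. g (case z of (x, f) \<Rightarrow> F x f)) \<in> borel_measurable (\<mu> \<Otimes>\<^sub>M \<nu>)"
    by (rule measurable_compose[OF F g])
  have "(\<integral>\<^sup>+\<omega>. exp_neg (\<integral>\<^sup>+i. g (case (X i \<omega>, ?Y i \<omega>) of (x, f) \<Rightarrow> F x f) \<partial>count_space UNIV) \<partial>M)
    = exp_neg (\<integral>\<^sup>+z. 1 - exp_neg (g (case z of (x, f) \<Rightarrow> F x f)) \<partial>(\<mu> \<Otimes>\<^sub>M \<nu>))"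
    by (rule marked_laplace[OF pts pr Y\<nu> law\<nu> ind' gF])
  also have "(\<integral>\<^sup>+z. 1 - exp_neg (g (case z of (x, f) \<Rightarrow> F x f)) \<partial>(\<mu> \<Otimes>\<^sub>M \<nu>))
    = (\<integral>\<^sup>+x. 1 - exp_neg (g x) \<partial>distr (\<mu> \<Otimes>\<^sub>M \<nu>) S (\<lambda>(x, f). F x f))"
    by (rule nn_integral_distr[OF F, symmetric]) simp
  finally show ?thesis by (simp only: prod.case F_restrict)
qed

end

lemma measurable_marked_sum:
  fixes I :: "nat set"
  assumes X: "\<And>i. i \<in> I \<Longrightarrow> X i \<in> G \<rightarrow>\<^sub>M \<mu>" and Y: "\<And>i. i \<in> I \<Longrightarrow> (\<lambda>\<omega>. restrict (Y i \<omega>) T) \<in> G \<rightarrow>\<^sub>M \<nu>"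
    and F: "(\<lambda>(x, f). F x f) \<in> \<mu> \<Otimes>\<^sub>M \<nu> \<rightarrow>\<^sub>M S" and F_restrict: "\<And>x f. F x (restrict f T) = F x f"
    and g: "g \<in> borel_measurable S"
  shows "(\<lambda>\<omega>. \<integral>\<^sup>+i. g (F (X i \<omega>) (Y i \<omega>)) \<partial>count_space I) \<in> borel_measurable G"
proof (rule borel_measurable_nn_integral_count_space)
  fix i assume i: "i \<in> I"
  have "(\<lambda>\<omega>. (X i \<omega>, restrict (Y i \<omega>) T)) \<in> G \<rightarrow>\<^sub>M \<mu> \<Otimes>\<^sub>M \<nu>"
    using X[OF i] Y[OF i] by (rule measurable_Pair)
  from measurable_compose[OF this measurable_compose[OF F g]]
  show "(\<lambda>\<omega>. g (F (X i \<omega>) (Y i \<omega>))) \<in> borel_measurable G" by (simp only: prod.case F_restrict)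
qed

text \<open>Without deaths the index set is empty, whereas the marking lemma enumerates by all
  natural numbers; the component then has to be seen to vanish directly.\<close>

lemma (in dual_levy_versions) nn_integral_death_measure_zero:
  assumes "\<theta>m = 0" shows "(\<integral>\<^sup>+x. f x \<partial>death_measure) = 0"
proof -
  have m: "(\<lambda>p. emeasure \<nu>m {f \<in> space \<nu>m. death_path p f \<in> space Dbar}) \<in> borel_measurable (borel \<Otimes>\<^sub>M borel)"
    by (rule emeasure_marked(2)[OF prob_\<nu>(2) measurable_death(1) sets.top])
  have "emeasure death_measure (space Dbar) = 0"
    unfolding death_measure_def emeasure_marked(1)[OF prob_\<nu>(2) measurable_death(2) sets.top]
    by (subst nn_integral_time_intensity[OF _ m]) (simp_all add: assms)
  then have "AE x in death_measure. f x = 0"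
    by (intro AE_I[of _ _ "space Dbar"]) (auto simp: sets_eq_imp_space_eq[OF sets_component(2)])
  then have "(\<integral>\<^sup>+x. f x \<partial>death_measure) = (\<integral>\<^sup>+x. 0 \<partial>death_measure)" by (rule nn_integral_cong_AE)
  then show ?thesis by simp
qed

context dual_levy_versions
begin

lemma poisson_pp_Pi':
  assumes M: "prob_space M" and pts: "poisson_points M UNIV (time_intensity \<theta>p UNIV) SV"
    and copies: "\<And>i. is_copy M {0..} (killed_law P \<xi> \<theta>m) (Lp i)"
    and cadlag: "\<And>i \<omega>. \<omega> \<in> space M \<Longrightarrow> cadlag_on {0..} (Lp i \<omega>)"
    and indep: "prob_space.indep_sets M
      (\<lambda>k. case k of None \<Rightarrow> points_sigma M UNIV (time_intensity \<theta>p UNIV) SV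
         | Some i \<Rightarrow> path_sigma M {0..} (Lp i)) UNIV"
  shows "poisson_pp M (birth_measure UNIV) (Pi'_process SV Lp)"
    and "intensity M Dbar (Pi'_process SV Lp) = birth_measure UNIV"
proof -
  interpret prob_space M by (rule M)
  have SV: "SV i \<in> M \<rightarrow>\<^sub>M time_intensity \<theta>p UNIV" for i using pts by (simp add: poisson_points_def)
  have inD: "birth_path (SV i \<omega>) (Lp i \<omega>) \<in> space Dbar" if "\<omega> \<in> space M" for i \<omega>
    using cadlag_birth_path[OF cadlag[OF that]] by (simp add: space_Dbar)
  have \<Omega>: "restrict (Lp i \<omega>) {0..} \<in> {f. cadlag_on {0..} f}" if "\<omega> \<in> space M" for i \<omega>
    using cadlag_on_restrict[OF cadlag[OF that]] by simp
  have Y: "(\<lambda>\<omega>. restrict (Lp i \<omega>) {0..}) \<in> M \<rightarrow>\<^sub>M \<nu>p" for i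
    by (rule version_law_measurable[OF \<nu>p version_lawI(1)[OF M copies \<Omega>]])
  have int: "(\<integral>\<^sup>+x. g x \<partial>Pi'_process SV Lp \<omega>) = (\<integral>\<^sup>+i. g (birth_path (SV i \<omega>) (Lp i \<omega>)) \<partial>count_space UNIV)"
    if "\<omega> \<in> space M" "g \<in> borel_measurable Dbar" for g \<omega>
    unfolding Pi'_process_def using inD[OF that(1)] that(2) by (intro nn_integral_dirac_sum) auto
  have nat: "nat_valued (emeasure (Pi'_process SV Lp \<omega>) A)" if "A \<in> sets (birth_measure UNIV)" "\<omega> \<in> space M" for A \<omega>
    unfolding Pi'_process_def using inD[OF that(2)] that(1) by (intro nat_valued_dirac_sum) auto
  show pp: "poisson_pp M (birth_measure UNIV) (Pi'_process SV Lp)"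
  \<comment> \<open>A superposition of a single component.\<close>
  proof (rule poisson_pp_superposeI[where \<kappa>="\<lambda>_. birth_measure UNIV" and H="{()}"])
    show "sets (Pi'_process SV Lp \<omega>) = sets (birth_measure UNIV)" for \<omega> by (simp add: Pi'_process_def)
    show "(\<lambda>\<omega>. emeasure (Pi'_process SV Lp \<omega>) A) \<in> borel_measurable M" if A: "A \<in> sets (birth_measure UNIV)" for A
    proof -
      have A': "indicator A \<in> borel_measurable Dbar" using A by simp
      have "emeasure (Pi'_process SV Lp \<omega>) A = (\<integral>\<^sup>+i. indicator A (birth_path (SV i \<omega>) (Lp i \<omega>)) \<partial>count_space UNIV)"
        if "\<omega> \<in> space M" for \<omega>
        unfolding Pi'_process_def using inD[OF that] A by (intro emeasure_dirac_sum) auto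
      moreover have "(\<lambda>\<omega>. \<integral>\<^sup>+i. indicator A (birth_path (SV i \<omega>) (Lp i \<omega>)) \<partial>count_space UNIV) \<in> borel_measurable M"
        by (rule measurable_marked_sum[OF SV Y measurable_birth(2) birth_path_restrict A'])
      ultimately show ?thesis by (simp cong: measurable_cong)
    qed
    show "(\<integral>\<^sup>+\<omega>. exp_neg (\<integral>\<^sup>+x. g x \<partial>Pi'_process SV Lp \<omega>) \<partial>M)
        = (\<Prod>k\<in>{()}. exp_neg (\<integral>\<^sup>+x. 1 - exp_neg (g x) \<partial>birth_measure UNIV))"
      if "g \<in> borel_measurable (birth_measure UNIV)" for g
    proof -
      have g: "g \<in> borel_measurable Dbar" using that by (simp add: birth_measure_def)
      have "(\<integral>\<^sup>+\<omega>. exp_neg (\<integral>\<^sup>+x. g x \<partial>Pi'_process SV Lp \<omega>) \<partial>M)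
          = (\<integral>\<^sup>+\<omega>. exp_neg (\<integral>\<^sup>+i. g (birth_path (SV i \<omega>) (Lp i \<omega>)) \<partial>count_space UNIV) \<partial>M)"
        by (intro nn_integral_cong) (simp add: int g)
      also have "\<dots> = exp_neg (\<integral>\<^sup>+x. 1 - exp_neg (g x) \<partial>birth_measure UNIV)"
        unfolding birth_measure_def
        by (rule marked_paths_laplace[OF pts \<nu>p copies \<Omega> indep measurable_birth(2) birth_path_restrict g])
      finally show ?thesis by simp
    qed
  qed (use nat in simp_all)
  show "intensity M Dbar (Pi'_process SV Lp) = birth_measure UNIV"
    by (rule poisson_pp_intensity[OF pp]) (use nat in simp_all)
qed

text \<open>The three components use disjoint families of ingredients, so the Laplace functional of
  their sum is the product of three marked functionals. Their intensities add up to
  \<open>birth_measure UNIV\<close> by \<open>birth_measure_eq_sum\<close>.\<close>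

lemma poisson_pp_Pi:
  assumes \<theta>: "0 < \<theta>p" and M: "prob_space M"
    and pi_0: "poisson_points M UNIV exp_intensity U"
    and pi_plus: "poisson_points M (atom_index \<theta>p) (time_intensity \<theta>p {0<..}) Tp"
    and pi_minus: "poisson_points M (atom_index \<theta>m) (time_intensity \<theta>m {..<0}) Tm"
    and L: "\<And>i. is_copy M UNIV (two_sided_law (killed_law P \<xi> \<theta>m) (killed_law P' \<eta> \<theta>p)) (L i)"
      "\<And>i \<omega>. \<omega> \<in> space M \<Longrightarrow> cadlag_on UNIV (L i \<omega>)"
    and Lp: "\<And>i. is_copy M {0..} (killed_law P \<xi> \<theta>m) (Lp i)"
      "\<And>i \<omega>. \<omega> \<in> space M \<Longrightarrow> cadlag_on {0..} (Lp i \<omega>)"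
    and Lm: "\<And>i. is_copy M {0..} (killed_law P' \<eta> \<theta>p) (Lm i)"
      "\<And>i \<omega>. \<omega> \<in> space M \<Longrightarrow> caglad_on {0..} (Lm i \<omega>)"
    and indep: "prob_space.indep_sets M
      (\<lambda>k. case k of
           Points_0 \<Rightarrow> points_sigma M UNIV exp_intensity U
         | Points_plus \<Rightarrow> points_sigma M (atom_index \<theta>p) (time_intensity \<theta>p {0<..}) Tp
         | Points_minus \<Rightarrow> points_sigma M (atom_index \<theta>m) (time_intensity \<theta>m {..<0}) Tm
         | Two_sided i \<Rightarrow> path_sigma M UNIV (L i)
         | Path_plus i \<Rightarrow> path_sigma M {0..} (Lp i)
         | Path_minus i \<Rightarrow> path_sigma M {0..} (Lm i)) UNIV"
  shows "poisson_pp M (birth_measure UNIV) (Pi_process \<theta>p \<theta>m U Tp Tm L Lp Lm)"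
    and "intensity M Dbar (Pi_process \<theta>p \<theta>m U Tp Tm L Lp Lm) = birth_measure UNIV"
proof -
  interpret prob_space M by (rule M)
  let ?Ip = "atom_index \<theta>p" and ?Im = "atom_index \<theta>m"
  let ?N = "Pi_process \<theta>p \<theta>m U Tp Tm L Lp Lm"
  have Ip: "?Ip = UNIV" using \<theta> by (simp add: atom_index_def)
  define F where "F k = (case k of
           Points_0 \<Rightarrow> points_sigma M UNIV exp_intensity U
         | Points_plus \<Rightarrow> points_sigma M ?Ip (time_intensity \<theta>p {0<..}) Tp
         | Points_minus \<Rightarrow> points_sigma M ?Im (time_intensity \<theta>m {..<0}) Tm
         | Two_sided i \<Rightarrow> path_sigma M UNIV (L i)
         | Path_plus i \<Rightarrow> path_sigma M {0..} (Lp i)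
         | Path_minus i \<Rightarrow> path_sigma M {0..} (Lm i))" for k
  have indF: "indep_sets F UNIV" unfolding F_def by (rule indep)
  have stF: "Int_stable (F k)" for k
    unfolding F_def by (cases k) (simp_all add: Int_stable_generated)
  have FM: "F k \<subseteq> events" for k using indF unfolding indep_sets_def by blast
  \<comment> \<open>Each component must be measurable for the sigma-algebra of its own ingredients
    and not only for \<open>M\<close>, since independence of the components is drawn from
    this.\<close>
  define G where "G I = sigma (space M) (\<Union>k\<in>I. F k)" for I
  have "(\<Union>k\<in>I. F k) \<subseteq> Pow (space M)" for I using FM sets.space_closed[of M] by blast
  then have spG: "space (G I) = space M" and setsG: "sets (G I) = sigma_sets (space M) (\<Union>k\<in>I. F k)" for I
    unfolding G_def by (simp_all add: space_measure_of sets_measure_of)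
  have subG: "F k \<subseteq> sets (G I)" if "k \<in> I" for k I
    unfolding setsG using that by (intro subsetI sigma_sets.Basic UN_I)
  have G_le: "f \<in> borel_measurable M" if "f \<in> borel_measurable (G I)" for f :: "_ \<Rightarrow> ennreal" and I
  proof (rule measurable_mono_domain[OF that spG])
    show "sets (G I) \<subseteq> events" unfolding setsG by (rule sets.sigma_sets_subset) (use FM in blast)
  qed
  have G_mono: "f \<in> borel_measurable (G J)" if "f \<in> borel_measurable (G I)" "I \<subseteq> J" for f :: "_ \<Rightarrow> ennreal" and I J
    by (rule measurable_mono_domain[OF that(1)])
      (use that(2) in \<open>auto simp: spG setsG intro!: sigma_sets_mono' elim: sigma_sets_mono'[THEN subsetD, rotated]\<close>)

  have \<Omega>0: "restrict (L i \<omega>) UNIV \<in> {f. cadlag_on UNIV f}" if "\<omega> \<in> space M" for i \<omega>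
    using L(2)[OF that] by (simp add: restrict_def)
  have \<Omega>p: "restrict (Lp i \<omega>) {0..} \<in> {f. cadlag_on {0..} f}" if "\<omega> \<in> space M" for i \<omega>
    using cadlag_on_restrict[OF Lp(2)[OF that]] by simp
  have \<Omega>m: "restrict (Lm i \<omega>) {0..} \<in> {f. caglad_on {0..} f}" if "\<omega> \<in> space M" for i \<omega>
    using caglad_on_restrict[OF Lm(2)[OF that]] by simp
  have shift_restrict: "shift_path u (restrict f UNIV) = shift_path u f" for u f by (simp add: restrict_def)

  define I0 where "I0 = insert Points_0 (range Two_sided)"
  define I1 where "I1 = insert Points_plus (range Path_plus)"
  define I2 where "I2 = insert Points_minus (range Path_minus)"
  have disj: "I0 \<inter> (I1 \<union> I2) = {}" "I1 \<inter> I2 = {}" by (auto simp: I0_def I1_def I2_def)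

  have X0: "U i \<in> G I0 \<rightarrow>\<^sub>M exp_intensity" for i
    by (rule measurable_points_sigma[where I=UNIV and X=U])
      (use pi_0 subG[of Points_0 I0] in \<open>auto simp: poisson_points_def F_def I0_def spG\<close>)
  have X1: "Tp i \<in> G I1 \<rightarrow>\<^sub>M time_intensity \<theta>p {0<..}" if "i \<in> ?Ip" for i
    by (rule measurable_points_sigma[where I="?Ip" and X=Tp])
      (use that pi_plus subG[of Points_plus I1] in \<open>auto simp: poisson_points_def F_def I1_def spG\<close>)
  have X2: "Tm i \<in> G I2 \<rightarrow>\<^sub>M time_intensity \<theta>m {..<0}" if "i \<in> ?Im" for i
    by (rule measurable_points_sigma[where I="?Im" and X=Tm])
      (use that pi_minus subG[of Points_minus I2] in \<open>auto simp: poisson_points_def F_def I2_def spG\<close>)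
  have Y0: "(\<lambda>\<omega>. restrict (L i \<omega>) UNIV) \<in> G I0 \<rightarrow>\<^sub>M \<nu>0" for i
  proof (rule version_law_measurable[OF \<nu>0 measurable_path_sigma[OF _ \<Omega>0]])
    show "(\<lambda>\<omega>. restrict (L i \<omega>) UNIV) \<in> M \<rightarrow>\<^sub>M path_space UNIV" using L(1)[of i] unfolding is_copy_def by blast
    show "path_sigma M UNIV (L i) \<subseteq> sets (G I0)" using subG[of "Two_sided i" I0] by (simp add: F_def I0_def)
  qed (simp_all add: spG)
  have Y1: "(\<lambda>\<omega>. restrict (Lp i \<omega>) {0..}) \<in> G I1 \<rightarrow>\<^sub>M \<nu>p" for i
  proof (rule version_law_measurable[OF \<nu>p measurable_path_sigma[OF _ \<Omega>p]])
    show "(\<lambda>\<omega>. restrict (Lp i \<omega>) {0..}) \<in> M \<rightarrow>\<^sub>M path_space {0..}" using Lp(1)[of i] unfolding is_copy_def by blast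
    show "path_sigma M {0..} (Lp i) \<subseteq> sets (G I1)" using subG[of "Path_plus i" I1] by (simp add: F_def I1_def)
  qed (simp_all add: spG)
  have Y2: "(\<lambda>\<omega>. restrict (Lm i \<omega>) {0..}) \<in> G I2 \<rightarrow>\<^sub>M \<nu>m" for i
  proof (rule version_law_measurable[OF \<nu>m measurable_path_sigma[OF _ \<Omega>m]])
    show "(\<lambda>\<omega>. restrict (Lm i \<omega>) {0..}) \<in> M \<rightarrow>\<^sub>M path_space {0..}" using Lm(1)[of i] unfolding is_copy_def by blast
    show "path_sigma M {0..} (Lm i) \<subseteq> sets (G I2)" using subG[of "Path_minus i" I2] by (simp add: F_def I2_def)
  qed (simp_all add: spG)

  define S0 where "S0 g \<omega> = (\<integral>\<^sup>+i. g (shift_path (U i \<omega>) (L i \<omega>)) \<partial>count_space UNIV)" for g :: "_ \<Rightarrow> ennreal" and \<omega>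
  define S1 where "S1 g \<omega> = (\<integral>\<^sup>+i. g (birth_path (Tp i \<omega>) (Lp i \<omega>)) \<partial>count_space ?Ip)" for g :: "_ \<Rightarrow> ennreal" and \<omega>
  define S2 where "S2 g \<omega> = (\<integral>\<^sup>+i. g (death_path (Tm i \<omega>) (Lm i \<omega>)) \<partial>count_space ?Im)" for g :: "_ \<Rightarrow> ennreal" and \<omega>
  have S0m: "S0 g \<in> borel_measurable (G I0)" if "g \<in> borel_measurable Dbar" for g
    unfolding S0_def by (rule measurable_marked_sum[OF X0 Y0 measurable_line(2) shift_restrict that])
  have S1m: "S1 g \<in> borel_measurable (G I1)" if "g \<in> borel_measurable Dbar" for g
    unfolding S1_def by (rule measurable_marked_sum[OF X1 Y1 measurable_birth(2) birth_path_restrict that])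
  have S2m: "S2 g \<in> borel_measurable (G I2)" if "g \<in> borel_measurable Dbar" for g
    unfolding S2_def by (rule measurable_marked_sum[OF X2 Y2 measurable_death(2) death_path_restrict that])

  let ?X = "\<lambda>k \<omega>. case k of Inl i \<Rightarrow> shift_path (U i \<omega>) (L i \<omega>)
          | Inr (Inl i) \<Rightarrow> birth_path (Tp i \<omega>) (Lp i \<omega>)
          | Inr (Inr i) \<Rightarrow> death_path (Tm i \<omega>) (Lm i \<omega>)"
  have inD: "?X k \<omega> \<in> space Dbar" if "\<omega> \<in> space M" for k \<omega>
    using cadlag_shift_path[OF L(2)[OF that]] cadlag_birth_path[OF Lp(2)[OF that]] cadlag_death_path[OF Lm(2)[OF that]]
    by (auto simp: space_Dbar split: sum.splits)
  have int: "(\<integral>\<^sup>+x. g x \<partial>?N \<omega>) = S0 g \<omega> + (S1 g \<omega> + S2 g \<omega>)"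
    if "\<omega> \<in> space M" "g \<in> borel_measurable Dbar" for g \<omega>
  proof -
    have "(\<integral>\<^sup>+x. g x \<partial>?N \<omega>) = (\<integral>\<^sup>+k. g (?X k \<omega>) \<partial>count_space (UNIV <+> (?Ip <+> ?Im)))"
      unfolding Pi_process_def by (rule nn_integral_dirac_sum[where X="?X" and \<omega>=\<omega>, OF inD[OF that(1)] that(2)])
    then show ?thesis by (simp add: nn_integral_count_space_Plus S0_def S1_def S2_def)
  qed
  have setsN: "sets (?N \<omega>) = sets Dbar" for \<omega> by (simp add: Pi_process_def)
  have nat: "nat_valued (emeasure (?N \<omega>) A)" if "A \<in> sets Dbar" "\<omega> \<in> space M" for A \<omega>
    unfolding Pi_process_def by (rule nat_valued_dirac_sum[where X="?X" and \<omega>=\<omega>, OF inD[OF that(2)] that(1)])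
  have meas: "(\<lambda>\<omega>. emeasure (?N \<omega>) A) \<in> borel_measurable M" if A: "A \<in> sets Dbar" for A
  proof -
    have gA: "indicator A \<in> borel_measurable Dbar" using A by simp
    have "emeasure (?N \<omega>) A = S0 (indicator A) \<omega> + (S1 (indicator A) \<omega> + S2 (indicator A) \<omega>)" if "\<omega> \<in> space M" for \<omega>
      using int[OF that gA] A setsN by simp
    moreover have "(\<lambda>\<omega>. S0 (indicator A) \<omega> + (S1 (indicator A) \<omega> + S2 (indicator A) \<omega>)) \<in> borel_measurable M"
      using G_le[OF S0m[OF gA]] G_le[OF S1m[OF gA]] G_le[OF S2m[OF gA]] by measurable
    ultimately show ?thesis by (simp cong: measurable_cong)
  qed

  \<comment> \<open>The marking lemma wants the points at \<open>None\<close> and the marks at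
    \<open>Some i\<close>; an injective renaming of the ingredients provides this.\<close>
  have sub_indep: "indep_sets (\<lambda>k. case k of None \<Rightarrow> F a | Some i \<Rightarrow> F (b i)) UNIV"
    if "inj (case_option a b)" for a and b :: "nat \<Rightarrow> ingredient"
  proof -
    have "indep_sets (\<lambda>k. F (case_option a b k)) UNIV"
      using that by (rule indep_sets_reindex) (rule indep_sets_mono_index[OF _ indF], simp)
    moreover have "(\<lambda>k. F (case_option a b k)) = (\<lambda>k. case k of None \<Rightarrow> F a | Some i \<Rightarrow> F (b i))"
      by (auto simp: fun_eq_iff split: option.splits)
    ultimately show ?thesis by simp
  qed
  have lap0: "(\<integral>\<^sup>+\<omega>. exp_neg (S0 g \<omega>) \<partial>M) = exp_neg (\<integral>\<^sup>+x. 1 - exp_neg (g x) \<partial>line_measure)" if g: "g \<in> borel_measurable Dbar" for g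
  proof -
    have "indep_sets (\<lambda>k. case k of None \<Rightarrow> points_sigma M UNIV exp_intensity U | Some i \<Rightarrow> path_sigma M UNIV (L i)) UNIV"
    proof -
      have "inj (case_option Points_0 Two_sided)" by (auto simp: inj_def split: option.splits)
      from sub_indep[OF this] show ?thesis by (simp add: F_def cong: option.case_cong)
    qed
    note ind = this
    show ?thesis unfolding S0_def line_measure_def
      by (rule marked_paths_laplace[OF pi_0 \<nu>0 L(1) \<Omega>0 ind measurable_line(2) shift_restrict g])
  qed
  have lap1: "(\<integral>\<^sup>+\<omega>. exp_neg (S1 g \<omega>) \<partial>M) = exp_neg (\<integral>\<^sup>+x. 1 - exp_neg (g x) \<partial>birth_measure {0<..})" if g: "g \<in> borel_measurable Dbar" for g
  proof -
    have "indep_sets (\<lambda>k. case k of None \<Rightarrow> points_sigma M UNIV (time_intensity \<theta>p {0<..}) Tp | Some i \<Rightarrow> path_sigma M {0..} (Lp i)) UNIV"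
    proof -
      have "inj (case_option Points_plus Path_plus)" by (auto simp: inj_def split: option.splits)
      from sub_indep[OF this] show ?thesis by (simp add: F_def Ip cong: option.case_cong)
    qed
    note ind = this
    show ?thesis unfolding S1_def birth_measure_def Ip
      by (rule marked_paths_laplace[OF pi_plus[unfolded Ip] \<nu>p Lp(1) \<Omega>p ind measurable_birth(2) birth_path_restrict g])
  qed
  have lap2: "(\<integral>\<^sup>+\<omega>. exp_neg (S2 g \<omega>) \<partial>M) = exp_neg (\<integral>\<^sup>+x. 1 - exp_neg (g x) \<partial>death_measure)" if g: "g \<in> borel_measurable Dbar" for g
  proof (cases "\<theta>m = 0")
    case True
    then have "S2 g \<omega> = 0" for \<omega> by (simp add: S2_def atom_index_def nn_integral_empty)
    note S = this
    show ?thesis by (simp only: S nn_integral_death_measure_zero[OF True]) (simp add: emeasure_space_1)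
  next
    case False
    then have Im: "?Im = UNIV" by (simp add: atom_index_def)
    have "indep_sets (\<lambda>k. case k of None \<Rightarrow> points_sigma M UNIV (time_intensity \<theta>m {..<0}) Tm | Some i \<Rightarrow> path_sigma M {0..} (Lm i)) UNIV"
    proof -
      have "inj (case_option Points_minus Path_minus)" by (auto simp: inj_def split: option.splits)
      from sub_indep[OF this] show ?thesis by (simp add: F_def Im cong: option.case_cong)
    qed
    note ind = this
    show ?thesis unfolding S2_def death_measure_def Im
      by (rule marked_paths_laplace[OF pi_minus[unfolded Im] \<nu>m Lm(1) \<Omega>m ind measurable_death(2) death_path_restrict g])
  qed

  \<comment> \<open>Any index other than 0 and 1 yields the death component; the superposition uses
    2.\<close>
  define \<kappa> where "\<kappa> k = (if k = 0 then line_measure else if k = 1 then birth_measure {0<..} else death_measure)" for k :: nat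
  show pp: "poisson_pp M (birth_measure UNIV) ?N"
  proof (rule poisson_pp_superposeI[where \<kappa>=\<kappa> and H="{0, 1, 2}"])
    \<comment> \<open>The comparison of the intensities enters here: the superposed intensity is
      that of births at all times.\<close>
    show "emeasure (birth_measure UNIV) A = (\<Sum>k\<in>{0, 1, 2}. emeasure (\<kappa> k) A)" if "A \<in> sets (birth_measure UNIV)" for A
      using birth_measure_eq_sum[OF \<theta>, of A] that by (simp add: \<kappa>_def add.assoc)
    show "(\<integral>\<^sup>+\<omega>. exp_neg (\<integral>\<^sup>+x. g x \<partial>?N \<omega>) \<partial>M) = (\<Prod>k\<in>{0, 1, 2}. exp_neg (\<integral>\<^sup>+x. 1 - exp_neg (g x) \<partial>\<kappa> k))"
      if "g \<in> borel_measurable (birth_measure UNIV)" for g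
    proof -
      have g: "g \<in> borel_measurable Dbar" using that by (simp add: birth_measure_def)
      have e0: "(\<lambda>\<omega>. exp_neg (S0 g \<omega>)) \<in> borel_measurable (G I0)" using S0m[OF g] by measurable
      have e1: "(\<lambda>\<omega>. exp_neg (S1 g \<omega>)) \<in> borel_measurable (G I1)" using S1m[OF g] by measurable
      have e2: "(\<lambda>\<omega>. exp_neg (S2 g \<omega>)) \<in> borel_measurable (G I2)" using S2m[OF g] by measurable
      have e12: "(\<lambda>\<omega>. exp_neg (S1 g \<omega>) * exp_neg (S2 g \<omega>)) \<in> borel_measurable (G (I1 \<union> I2))"
        by (intro borel_measurable_times_ennreal G_mono[OF e1] G_mono[OF e2]) auto
      have "(\<integral>\<^sup>+\<omega>. exp_neg (\<integral>\<^sup>+x. g x \<partial>?N \<omega>) \<partial>M) = (\<integral>\<^sup>+\<omega>. exp_neg (S0 g \<omega>) * (exp_neg (S1 g \<omega>) * exp_neg (S2 g \<omega>)) \<partial>M)"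
        by (intro nn_integral_cong) (simp add: int g exp_neg_add)
      also have "\<dots> = (\<integral>\<^sup>+\<omega>. exp_neg (S0 g \<omega>) \<partial>M) * (\<integral>\<^sup>+\<omega>. exp_neg (S1 g \<omega>) * exp_neg (S2 g \<omega>) \<partial>M)"
        by (rule nn_integral_indep_mult[OF indep_sets_mono_index[OF subset_UNIV indF] disj(1) stF
              e0[unfolded G_def] e12[unfolded G_def]])
      also have "(\<integral>\<^sup>+\<omega>. exp_neg (S1 g \<omega>) * exp_neg (S2 g \<omega>) \<partial>M) = (\<integral>\<^sup>+\<omega>. exp_neg (S1 g \<omega>) \<partial>M) * (\<integral>\<^sup>+\<omega>. exp_neg (S2 g \<omega>) \<partial>M)"
        by (rule nn_integral_indep_mult[OF indep_sets_mono_index[OF subset_UNIV indF] disj(2) stF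
              e1[unfolded G_def] e2[unfolded G_def]])
      finally show ?thesis by (simp add: lap0[OF g] lap1[OF g] lap2[OF g] \<kappa>_def)
    qed
  qed (use meas nat setsN in \<open>simp_all add: \<kappa>_def\<close>)
  show "intensity M Dbar ?N = birth_measure UNIV"
    by (rule poisson_pp_intensity[OF pp]) (use nat in simp_all)
qed

end

section \<open>The two constructions\<close>

theorem theorem1p13:
  fixes P :: "'w measure" and \<xi> :: "real \<Rightarrow> 'w \<Rightarrow> real"
    and P' :: "'v measure" and \<eta> :: "real \<Rightarrow> 'v \<Rightarrow> real"
    and \<theta>p \<theta>m :: real
    and M :: "'a measure"
    and U :: "nat \<Rightarrow> 'a \<Rightarrow> real" and Tp Tm :: "nat \<Rightarrow> 'a \<Rightarrow> real \<times> real"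
    and L Lp Lm :: "nat \<Rightarrow> 'a \<Rightarrow> real \<Rightarrow> ereal"
    and M' :: "'b measure"
    and SV :: "nat \<Rightarrow> 'b \<Rightarrow> real \<times> real" and Lp' :: "nat \<Rightarrow> 'b \<Rightarrow> real \<Rightarrow> ereal"
  assumes xi: "levy_process P \<xi>"
    and psi_finite: "integrable P (\<lambda>\<omega>. exp (\<xi> 1 \<omega>))"
    and psi_eq: "ln (\<integral>\<omega>. exp (\<xi> 1 \<omega>) \<partial>P) = \<theta>m - \<theta>p"
    and theta_nonneg: "0 \<le> \<theta>p" "0 \<le> \<theta>m"
    and theta_plus_pos: "0 < \<theta>p"
    (* the killed process L^- is eta killed at rate theta_+ *)
    and eta: "levy_process P' \<eta>"
    and dual: "dual_kernels (killed_kernel P' \<eta> \<theta>p) (killed_kernel P \<xi> \<theta>m)"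
    (* the ingredients of Pi *)
    and M: "prob_space M"
    and pi_0: "poisson_points M UNIV exp_intensity U"
    and pi_plus: "poisson_points M (atom_index \<theta>p) (time_intensity \<theta>p {0<..}) Tp"
    and pi_minus: "poisson_points M (atom_index \<theta>m) (time_intensity \<theta>m {..<0}) Tm"
    and L_copies:
      "\<And>i. is_copy M UNIV (two_sided_law (killed_law P \<xi> \<theta>m) (killed_law P' \<eta> \<theta>p)) (L i)"
      "\<And>i \<omega>. \<omega> \<in> space M \<Longrightarrow> cadlag_on UNIV (L i \<omega>)"
    and Lp_copies:
      "\<And>i. is_copy M {0..} (killed_law P \<xi> \<theta>m) (Lp i)"
      "\<And>i \<omega>. \<omega> \<in> space M \<Longrightarrow> cadlag_on {0..} (Lp i \<omega>)"
    and Lm_copies: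
      "\<And>i. is_copy M {0..} (killed_law P' \<eta> \<theta>p) (Lm i)"
      "\<And>i \<omega>. \<omega> \<in> space M \<Longrightarrow> caglad_on {0..} (Lm i \<omega>)"
    and indep: "prob_space.indep_sets M
      (\<lambda>k. case k of
           Points_0 \<Rightarrow> points_sigma M UNIV exp_intensity U
         | Points_plus \<Rightarrow> points_sigma M (atom_index \<theta>p) (time_intensity \<theta>p {0<..}) Tp
         | Points_minus \<Rightarrow> points_sigma M (atom_index \<theta>m) (time_intensity \<theta>m {..<0}) Tm
         | Two_sided i \<Rightarrow> path_sigma M UNIV (L i)
         | Path_plus i \<Rightarrow> path_sigma M {0..} (Lp i)
         | Path_minus i \<Rightarrow> path_sigma M {0..} (Lm i)) UNIV"
    (* the ingredients of Pi' *)
    and M': "prob_space M'"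
    and rho_plus: "poisson_points M' UNIV (time_intensity \<theta>p UNIV) SV"
    and Lp'_copies:
      "\<And>i. is_copy M' {0..} (killed_law P \<xi> \<theta>m) (Lp' i)"
      "\<And>i \<omega>. \<omega> \<in> space M' \<Longrightarrow> cadlag_on {0..} (Lp' i \<omega>)"
    and indep': "prob_space.indep_sets M'
      (\<lambda>k. case k of
           None \<Rightarrow> points_sigma M' UNIV (time_intensity \<theta>p UNIV) SV
         | Some i \<Rightarrow> path_sigma M' {0..} (Lp' i)) UNIV"
  shows "poisson_pp M' (intensity M' Dbar (Pi'_process SV Lp')) (Pi'_process SV Lp') \<and>
    poisson_pp M (intensity M Dbar (Pi_process \<theta>p \<theta>m U Tp Tm L Lp Lm))
      (Pi_process \<theta>p \<theta>m U Tp Tm L Lp Lm) \<and>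
    intensity M' Dbar (Pi'_process SV Lp') =
      intensity M Dbar (Pi_process \<theta>p \<theta>m U Tp Tm L Lp Lm)"
proof -
  \<comment> \<open>The copies with index 0 on \<open>M\<close> serve as representatives. By
    \<open>version_law_unique\<close> every other copy, also on \<open>M'\<close>, has the same law
    on regular paths, so both processes are compared with the same measures.\<close>
  define \<nu>p where "\<nu>p = distr M (restrict_space (path_space {0..}) {f. cadlag_on {0..} f}) (\<lambda>\<omega>. restrict (Lp 0 \<omega>) {0..})"
  define \<nu>m where "\<nu>m = distr M (restrict_space (path_space {0..}) {f. caglad_on {0..} f}) (\<lambda>\<omega>. restrict (Lm 0 \<omega>) {0..})"
  define \<nu>0 where "\<nu>0 = distr M (restrict_space (path_space UNIV) {f. cadlag_on UNIV f}) (\<lambda>\<omega>. restrict (L 0 \<omega>) UNIV)"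
  interpret dual_levy_versions P \<xi> P' \<eta> \<theta>p \<theta>m \<nu>p \<nu>m \<nu>0
  proof
    show "version_law {0..} {f. cadlag_on {0..} f} (killed_law P \<xi> \<theta>m) \<nu>p"
      unfolding \<nu>p_def
      by (rule version_lawI(2)[OF M Lp_copies(1)]) (simp add: cadlag_on_restrict[OF Lp_copies(2)])
    show "version_law {0..} {f. caglad_on {0..} f} (killed_law P' \<eta> \<theta>p) \<nu>m"
      unfolding \<nu>m_def
      by (rule version_lawI(2)[OF M Lm_copies(1)]) (simp add: caglad_on_restrict[OF Lm_copies(2)])
    show "version_law UNIV {f. cadlag_on UNIV f} (two_sided_law (killed_law P \<xi> \<theta>m) (killed_law P' \<eta> \<theta>p)) \<nu>0"
      unfolding \<nu>0_def
      by (rule version_lawI(2)[OF M L_copies(1)]) (use L_copies(2) in \<open>simp add: restrict_def\<close>)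
  qed (fact xi eta dual theta_nonneg)+
  note Pi' = poisson_pp_Pi'[OF M' rho_plus Lp'_copies indep']
  note Pi = poisson_pp_Pi[OF theta_plus_pos M pi_0 pi_plus pi_minus L_copies Lp_copies Lm_copies indep]
  show ?thesis using Pi' Pi by simp
qed

end
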